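(* Let $d>2$ be an integer and let $F:\mathbb{Z}^d\to\mathbb{R}$ be a $\mathbb{Z}^d$-symmetric function for which there are $K_1,K_2>0$ and $\rho>\max\{\frac{d-8}{2},0\}$ such that for all $x\in\mathbb{Z}^d$ and $k\in\mathbb{T}^d$, $$|F(x)|\le \frac{K_1}{(\max\{|x|,1\})^{d+2+\rho}},\qquad \hat F(0)\ge 0,\qquad \hat F(k)-\hat F(0)\ge K_2|k|^2 .$$ Define $$\lambda=\frac{1}{\hat F(0)-\sum_{x\in\mathbb{Z}^d}|x|^2F(x)},\qquad \mu=1-\lambda\hat F(0)\in(0,1],$$ and let $n_d=d-2+s_0$, where $s_0=0$ if $\rho\le 1+\max\{\frac{d-8}{2},0\}$ and $s_0=1$ if $\rho>1+\max\{\frac{d-8}{2},0\}$. Then the solution $G$ to $F*G=\delta$ given by the Fourier integral $$G(x)=\int_{\mathbb{T}^d}\frac{e^{-ik\cdot x}}{\hat F(k)}\frac{dk}{(2\pi)^d}\qquad(x\in\mathbb{Z}^d)$$ satisfies $$G(x)=\lambda C_\mu(x)+o\left(\frac{1}{|x|^{n_d}}\right)\qquad\text{as }|x|\to\infty .$$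
   Context: $|x|$ is the Euclidean norm. $\mathbb{T}^d=(\mathbb{R}/2\pi\mathbb{Z})^d$ is identified with $(-\pi,\pi]^d\subset\mathbb{R}^d$, and $|k|$ is the Euclidean norm under this identification. The Fourier transform of a summable $f:\mathbb{Z}^d\to\mathbb{R}$ is $\hat f(k)=\sum_{x\in\mathbb{Z}^d}f(x)e^{ik\cdot x}$. The convolution is $(f*g)(x)=\sum_{y\in\mathbb{Z}^d}f(y)g(x-y)$, and $\delta(x)=\delta_{0,x}$. A function on $\mathbb{Z}^d$ is $\mathbb{Z}^d$-symmetric if it is invariant under reflection in coordinate hyperplanes and rotation by $\pi/2$ (i.e., under permutations and sign changes of the coordinates). For $\mu\in(0,1]$ and $d>2$, the lattice Green function is $$C_\mu(x)=\int_{\mathbb{T}^d}\frac{e^{-ik\cdot x}}{1-\mu\hat D(k)}\frac{dk}{(2\pi)^d},\qquad D(x)=\tfrac{1}{2d}\mathbf{1}_{|x|=1},\quad \hat D(k)=d^{-1}\sum_{j=1}^d\cos k_j .$$ *)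

theory Defs
  imports "HOL-Analysis.Analysis" "HOL-Library.Landau_Symbols"
begin

(* The lattice Z^d is int^'d with d = CARD('d); its points are embedded in R^d by lvec. *)
definition lvec :: "int ^ 'd \<Rightarrow> real ^ 'd" where
  "lvec x = (\<chi> i. real_of_int (x $ i))"

definition lattice_symmetric :: "(int ^ 'd \<Rightarrow> 'a) \<Rightarrow> bool" where
  "lattice_symmetric f \<longleftrightarrow>
     (\<forall>p x. bij p \<longrightarrow> f (\<chi> i. x $ p i) = f x) \<and>
     (\<forall>j x. f (\<chi> i. if i = j then - (x $ i) else x $ i) = f x)"

definition torus :: "(real ^ 'd) set" where
  "torus = {k. \<forall>i. - pi < k $ i \<and> k $ i \<le> pi}"

definition fourier :: "(int ^ 'd \<Rightarrow> real) \<Rightarrow> real ^ 'd \<Rightarrow> complex" where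
  "fourier f k =
     (\<Sum>\<^sub>\<infinity>x\<in>UNIV. complex_of_real (f x) * exp (\<i> * complex_of_real (k \<bullet> lvec x)))"

definition fourier_integral :: "(real ^ 'd \<Rightarrow> complex) \<Rightarrow> int ^ 'd \<Rightarrow> complex" where
  "fourier_integral h x =
     (LINT k:torus|lborel. exp (- \<i> * complex_of_real (k \<bullet> lvec x)) * h k)
       / (2 * complex_of_real pi) ^ CARD('d)"

definition convolution ::
    "(int ^ 'd \<Rightarrow> complex) \<Rightarrow> (int ^ 'd \<Rightarrow> complex) \<Rightarrow> int ^ 'd \<Rightarrow> complex" where
  "convolution f g x = (\<Sum>\<^sub>\<infinity>y\<in>UNIV. f y * g (x - y))"

definition lattice_delta :: "int ^ 'd \<Rightarrow> complex" where
  "lattice_delta x = (if x = 0 then 1 else 0)"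

definition step_distribution :: "int ^ 'd \<Rightarrow> real" where
  "step_distribution x = (if norm (lvec x) = 1 then 1 / (2 * real CARD('d)) else 0)"

definition lattice_green :: "real \<Rightarrow> int ^ 'd \<Rightarrow> complex" where
  "lattice_green \<mu> =
     fourier_integral (\<lambda>k. 1 / (1 - complex_of_real \<mu> * fourier step_distribution k))"

(* The filter describing |x| \<rightarrow> \<infinity> on the lattice. *)
definition lattice_at_infinity :: "(int ^ 'd) filter" where
  "lattice_at_infinity = filtercomap (\<lambda>x. norm (lvec x)) at_top"

lemma lattice_symmetric_uminus:
  fixes f :: "int ^ 'd \<Rightarrow> 'a"
  assumes "lattice_symmetric f"
  shows "f (- x) = f x"
proof -
  have "f (\<chi> i. if i \<in> S then - (x $ i) else x $ i) = f x" if "finite S" for S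
    using that
  proof (induction S)
    case empty
    then show ?case by simp
  next
    case (insert j S)
    let ?y = "\<chi> i. if i \<in> S then - (x $ i) else x $ i"
    have "(\<chi> i. if i \<in> insert j S then - (x $ i) else x $ i)
        = (\<chi> i. if i = j then - (?y $ i) else ?y $ i)"
      using insert.hyps by (auto simp: vec_eq_iff)
    then show ?case
      using assms insert.IH by (simp only: lattice_symmetric_def)
  qed
  from this[of UNIV] have "f (\<chi> i. - (x $ i)) = f x" by simp
  moreover have "(\<chi> i. - (x $ i)) = - x" by (simp add: vec_eq_iff)
  ultimately show ?thesis by simp
qed

(* The transform of a symmetric function is real, so real parts of it lose nothing. *)
lemma fourier_symmetric_real:
  fixes f :: "int ^ 'd \<Rightarrow> real"
  assumes "lattice_symmetric f"
  shows "fourier f k = complex_of_real (Re (fourier f k))"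
proof -
  have "cnj (fourier f k)
      = (\<Sum>\<^sub>\<infinity>x\<in>UNIV. complex_of_real (f x) * exp (- \<i> * complex_of_real (k \<bullet> lvec x)))"
    by (simp add: fourier_def exp_cnj flip: infsum_cnj)
  also have "\<dots> = (\<Sum>\<^sub>\<infinity>x\<in>range uminus.
      complex_of_real (f x) * exp (- \<i> * complex_of_real (k \<bullet> lvec x)))"
    by simp
  also have "\<dots> = fourier f k"
  proof -
    have "lvec (- x) = - lvec x" for x :: "int ^ 'd"
      by (simp add: lvec_def vec_eq_iff)
    then show ?thesis
      by (subst infsum_reindex) (simp_all add: fourier_def o_def lattice_symmetric_uminus[OF assms])
  qed
  finally show ?thesis
    by (simp add: complex_eq_iff)
qed

lemma norm_axis_real: "norm (axis j c :: real ^ 'd) = \<bar>c\<bar>"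
  by (simp add: norm_eq_sqrt_inner inner_axis_axis)

lemma norm_lvec_eq_1_iff:
  fixes x :: "int ^ 'd"
  shows "norm (lvec x) = 1 \<longleftrightarrow> (\<exists>j. x = axis j 1 \<or> x = axis j (- 1))"
proof
  assume "norm (lvec x) = 1"
  then have "(\<Sum>i\<in>UNIV. (real_of_int (x $ i))\<^sup>2) = 1"
    by (simp add: norm_vec_def L2_set_def lvec_def)
  then have "real_of_int (\<Sum>i\<in>UNIV. (x $ i)\<^sup>2) = 1" by simp
  then have s: "(\<Sum>i\<in>UNIV. (x $ i)\<^sup>2) = 1" by linarith
  then obtain j where j: "x $ j \<noteq> 0"
    by (metis (no_types, lifting) sum.neutral zero_neq_one zero_power2)
  have e: "(\<Sum>i\<in>UNIV. (x $ i)\<^sup>2) = (x $ j)\<^sup>2 + (\<Sum>i\<in>UNIV - {j}. (x $ i)\<^sup>2)"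
    by (subst sum.remove[of _ j]) auto
  have p: "(x $ j)\<^sup>2 \<ge> 1" using j by (simp add: int_one_le_iff_zero_less)
  have n: "(\<Sum>i\<in>UNIV - {j}. (x $ i)\<^sup>2) \<ge> 0" by (simp add: sum_nonneg)
  have z: "(\<Sum>i\<in>UNIV - {j}. (x $ i)\<^sup>2) = 0" and "(x $ j)\<^sup>2 = 1" using s e p n by linarith+
  then have c: "x $ j = 1 \<or> x $ j = - 1" by (simp add: power2_eq_1_iff)
  have "x $ i = 0" if "i \<noteq> j" for i
    using z that by (simp add: sum_nonneg_eq_0_iff)
  then show "\<exists>j. x = axis j 1 \<or> x = axis j (- 1)"
    using c by (intro exI[of _ j]) (auto simp: vec_eq_iff axis_def)
next
  assume "\<exists>j. x = axis j 1 \<or> x = axis j (- 1)"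
  then obtain j c where "x = axis j c" "c = 1 \<or> c = - 1" by blast
  then have "lvec x = axis j (real_of_int c)" "\<bar>c\<bar> = 1"
    by (auto simp: lvec_def vec_eq_iff axis_def)
  then show "norm (lvec x) = 1"
    by (auto simp: norm_axis_real)
qed

lemma fourier_step_distribution:
  fixes k :: "real ^ 'd"
  shows "fourier step_distribution k
    = complex_of_real ((\<Sum>j\<in>UNIV. cos (k $ j)) / real CARD('d))"
proof -
  let ?g = "\<lambda>x :: int ^ 'd. complex_of_real (step_distribution x) *
              exp (\<i> * complex_of_real (k \<bullet> lvec x))"
  let ?P = "range (\<lambda>j :: 'd. axis j (1 :: int))" and ?N = "range (\<lambda>j :: 'd. axis j (- 1 :: int))"
  have lv: "lvec (axis j c :: int ^ 'd) = axis j (real_of_int c)" for j c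
    by (auto simp: lvec_def vec_eq_iff axis_def)
  have val: "?g (axis j c) = complex_of_real (1 / (2 * real CARD('d))) * cis (c * k $ j)"
    if "\<bar>c\<bar> = 1" for j :: 'd and c
  proof -
    have "norm (lvec (axis j c :: int ^ 'd)) = 1"
      using that by (simp add: lv norm_axis_real)
    then show ?thesis
      by (simp add: step_distribution_def lv inner_axis cis_conv_exp mult.commute)
  qed
  have "fourier step_distribution k = infsum ?g (?P \<union> ?N)"
    unfolding fourier_def
    by (rule infsum_cong_neutral)
       (auto simp: step_distribution_def norm_lvec_eq_1_iff)
  also have "\<dots> = sum ?g (?P \<union> ?N)" by simp
  also have "\<dots> = sum ?g ?P + sum ?g ?N"
    by (rule sum.union_disjoint) (auto simp: axis_eq_axis)
  also have "sum ?g ?P = (\<Sum>j\<in>UNIV. ?g (axis j 1))"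
    by (subst sum.reindex) (auto simp: inj_def axis_eq_axis)
  also have "sum ?g ?N = (\<Sum>j\<in>UNIV. ?g (axis j (- 1)))"
    by (subst sum.reindex) (auto simp: inj_def axis_eq_axis)
  also have "(\<Sum>j\<in>UNIV. ?g (axis j 1)) + (\<Sum>j\<in>UNIV. ?g (axis j (- 1)))
      = (\<Sum>j\<in>UNIV. complex_of_real (cos (k $ j) / real CARD('d)))"
    unfolding sum.distrib[symmetric]
  proof (rule sum.cong)
    fix j :: 'd
    show "?g (axis j 1) + ?g (axis j (- 1)) = complex_of_real (cos (k $ j) / real CARD('d))"
      using val[of 1 j] val[of "- 1" j] by (simp add: complex_eq_iff)
  qed simp
  finally show ?thesis by (simp add: sum_divide_distrib)
qed

end

theory Submission
  imports Defs
begin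

text \<open>
  Since \<open>F\<close> and the walk kernel \<open>\<delta> - \<mu> D\<close> are matched in their zeroth and second moments
  after scaling by \<open>\<lambda>\<close>, the difference of the reciprocals of their transforms is
  \<open>E / (A F)\<close> with a numerator \<open>E\<close> that is \<open>O(|k|\<^sup>2\<^sup>+\<^sup>\<tau>)\<close>, against denominators of order \<open>|k|\<^sup>2\<close>.
  To see that \<open>x\<^sub>j\<^sup>n\<close> times its Fourier coefficients tends to \<open>0\<close>, it suffices by the Riemann--Lebesgue
  lemma that its \<open>n\<close>-th derivative in direction \<open>j\<close> is integrable. One finds a weight
  \<open>V \<ge> 1 / |k|\<close> with \<open>V\<close> in \<open>L\<^sup>D\<close> for some \<open>D < d\<close> such that each derivative costs one factor \<open>V\<close>;
  this bookkeeping is stable under products and reciprocals and gives the bound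
  \<open>V\<^sup>n |k|\<^sup>\<tau>\<^sup>-\<^sup>2 \<le> V\<^sup>D\<close>. All differentiations are done for truncated kernels, shifted by a small
  constant so that the transforms do not vanish; the bounds are uniform in the truncation.
\<close>

section \<open>Sums over the lattice\<close>

text \<open>The obstacle is that \<open>F\<close> is only known to have moments of order below
  \<open>2 + \<rho>\<close>, so its transform need not be \<open>n\<close> times differentiable.
  Truncations are trigonometric polynomials, for which integration by parts is legitimate, and only
  the resulting identity between Fourier coefficients is carried to the limit. Truncation keeps the
  lattice symmetry but spoils the matching of second moments, which is repaired by a factor tending
  to 1.

  The threshold for \<open>\<rho>\<close> comes from three demands on \<open>D\<close>.
  Integrability needs \<open>D < d\<close>. High derivatives of the transform are reached through
  Parseval, hence in Lebesgue spaces of exponent at least 2, which needs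
  \<open>2 * (n - 2 - \<sigma>) \<le> D\<close> for some \<open>\<sigma> < \<rho>\<close>. The
  singularity at the origin needs \<open>n + 2 - \<tau> \<le> D\<close> for some
  \<open>\<tau> \<le> min \<sigma> 2\<close>. For \<open>n = d - 2 + s0\<close> with
  \<open>s0 \<le> 1\<close> such \<open>D\<close>, \<open>\<sigma>\<close> and \<open>\<tau>\<close>
  exist precisely if \<open>\<rho> > s0 + max ((d - 8) / 2) 0\<close>.\<close>

definition lnorm :: "int ^ 'd \<Rightarrow> real" where
  "lnorm x = max (norm (lvec x)) 1"

text \<open>With the strict inequality \<open>lball 0\<close> is empty, because \<open>lnorm\<close>
  is at least 1, and a ball is exactly the disjoint union of the shells of smaller index. Truncating
  by balls also respects permutations and sign changes of the coordinates.\<close>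

definition lball :: "nat \<Rightarrow> (int ^ 'd) set" where
  "lball N = {x. lnorm x < 2 ^ N}"

definition lshell :: "nat \<Rightarrow> (int ^ 'd) set" where
  "lshell J = {x. 2 ^ J \<le> lnorm x \<and> lnorm x < 2 ^ Suc J}"

lemma lnorm_ge_1: "1 \<le> lnorm x"
  and norm_lvec_le_lnorm: "norm (lvec x) \<le> lnorm x"
  by (auto simp: lnorm_def)

lemma abs_component_le_lnorm: "\<bar>real_of_int (x $ i)\<bar> \<le> lnorm x"
  using component_le_norm_cart[of "lvec x" i] norm_lvec_le_lnorm[of x]
  by (simp add: lvec_def)

lemma finite_lball [simp]: "finite (lball N :: (int ^ 'd) set)"
  and card_lball: "real (card (lball (Suc J) :: (int ^ 'd) set)) \<le> (5 * 2 ^ J) ^ CARD('d)"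
proof -
  have *: "finite (lball N :: (int ^ 'd) set) \<and> card (lball N :: (int ^ 'd) set) \<le> (2 * 2 ^ N + 1) ^ CARD('d)" for N
  proof -
    let ?P = "Pi\<^sub>E (UNIV :: 'd set) (\<lambda>_. {- (2 ^ N) .. (2 :: int) ^ N})"
    have sub: "(\<lambda>x :: int ^ 'd. ($) x) ` lball N \<subseteq> ?P"
    proof (clarsimp simp: PiE_def Pi_def)
      fix x :: "int ^ 'd" and i assume "x \<in> lball N"
      then have "\<bar>real_of_int (x $ i)\<bar> \<le> 2 ^ N"
        using abs_component_le_lnorm[of x i] by (simp add: lball_def)
      then have "\<bar>x $ i\<bar> \<le> 2 ^ N"
        by (metis of_int_abs of_int_le_numeral_power_cancel_iff)
      then show "- (2 ^ N) \<le> x $ i \<and> x $ i \<le> 2 ^ N" by linarith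
    qed
    have inj: "inj_on (\<lambda>x :: int ^ 'd. ($) x) (lball N)"
      by (auto simp: inj_on_def vec_eq_iff)
    have fin: "finite ?P" by (intro finite_PiE) auto
    have "card ?P = (2 * 2 ^ N + 1) ^ CARD('d)"
      by (subst card_PiE) (auto simp: nat_add_distrib nat_mult_distrib nat_power_eq)
    then show ?thesis
      using finite_imageD[OF finite_subset[OF sub fin] inj] card_mono[OF fin sub] card_image[OF inj]
      by metis
  qed
  show "finite (lball N :: (int ^ 'd) set)" using * by blast
  have "real (card (lball (Suc J) :: (int ^ 'd) set)) \<le> (2 * 2 ^ Suc J + 1) ^ CARD('d)"
    using *[of "Suc J"] by (metis (mono_tags) of_nat_1 of_nat_add of_nat_le_iff of_nat_mult of_nat_numeral of_nat_power)
  \<comment> \<open>Here \<open>2 * 2 ^ Suc J + 1 = 4 * 2 ^ J + 1\<close>, and the last summand is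
    absorbed by a fifth copy of \<open>2 ^ J\<close>.\<close>
  also have "\<dots> \<le> (5 * 2 ^ J) ^ CARD('d)"
    by (intro power_mono) auto
  finally show "real (card (lball (Suc J) :: (int ^ 'd) set)) \<le> (5 * 2 ^ J) ^ CARD('d)" .
qed

lemma lshell_subset_lball: "lshell J \<subseteq> lball (Suc J)"
  by (auto simp: lshell_def lball_def)

lemma finite_lshell [simp]: "finite (lshell J)"
  using finite_subset[OF lshell_subset_lball] by simp

lemma card_lshell: "real (card (lshell J :: (int ^ 'd) set)) \<le> (5 * 2 ^ J) ^ CARD('d)"
  using card_mono[OF finite_lball lshell_subset_lball] card_lball
  by (metis (mono_tags) of_nat_le_iff order_trans)

lemma lball_0: "lball 0 = {}"
  using lnorm_ge_1 by (auto simp: lball_def not_less)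

lemma lball_Suc: "lball (Suc N) = lball N \<union> lshell N"
  and lball_lshell_disjoint: "lball N \<inter> lshell N = {}"
proof -
  have "x < 2 ^ N \<Longrightarrow> x < 2 ^ Suc N" for x :: real
    by (rule order_less_le_trans[where y = "2 ^ N"]) auto
  then show "lball (Suc N) = lball N \<union> lshell N"
    by (auto simp del: power_Suc simp: lball_def lshell_def)
  show "lball N \<inter> lshell N = {}"
    by (auto simp: lball_def lshell_def)
qed

lemma sum_lball: "sum f (lball N) = (\<Sum>J<N. sum f (lshell J))"
  by (induction N) (auto simp: lball_0 lball_Suc sum.union_disjoint lball_lshell_disjoint)

lemma lball_mono: "M \<le> N \<Longrightarrow> lball M \<subseteq> lball N"
  by (auto simp: lball_def intro: order_less_le_trans[OF _ power_increasing])

lemma finite_subset_lball: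
  assumes "finite X" shows "\<exists>N. X \<subseteq> lball N"
proof -
  obtain N where "Max (lnorm ` X) < 2 ^ N"
    using real_arch_pow[of 2] by auto
  then have "X \<subseteq> lball N"
    using assms by (auto simp: lball_def intro: order_le_less_trans[OF Max_ge])
  then show ?thesis by blast
qed

lemma filterlim_lball: "filterlim lball (finite_subsets_at_top UNIV) sequentially"
  unfolding filterlim_finite_subsets_at_top
proof (intro allI impI)
  fix X :: "(int ^ 'd) set" assume "finite X \<and> X \<subseteq> UNIV"
  then obtain N where "X \<subseteq> lball N" using finite_subset_lball by blast
  then show "\<forall>\<^sub>F y in sequentially. finite (lball y) \<and> X \<subseteq> lball y \<and> lball y \<subseteq> UNIV"
    using lball_mono by (auto simp: eventually_sequentially intro!: exI[of _ N])
qed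

lemma sum_lball_tendsto_infsum:
  fixes f :: "int ^ 'd \<Rightarrow> 'a :: {topological_comm_monoid_add, t2_space}"
  assumes "f summable_on UNIV"
  shows "(\<lambda>N. sum f (lball N)) \<longlonglongrightarrow> infsum f UNIV"
  using filterlim_compose[OF _ filterlim_lball] infsum_tendsto[OF assms] by blast

lemma lnorm_lshell_powr:
  assumes "x \<in> lshell J" "s \<ge> 0"
  shows "lnorm x powr - s \<le> (2 ^ J) powr - s"
  using assms by (intro powr_mono2') (auto simp: lshell_def)

text \<open>Up to a constant, shell \<open>J\<close> has at most \<open>2 ^ (d * J)\<close> points,
  each contributing at most \<open>(2 ^ J) powr - s\<close>. The shell sums are therefore dominated
  by a geometric series of ratio \<open>q < 1\<close>.\<close>

lemma summable_lnorm_powr: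
  assumes "s > real CARD('d)"
  shows "(\<lambda>x :: int ^ 'd. lnorm x powr - s) summable_on UNIV"
proof (rule nonneg_bdd_above_summable_on)
  define q where "q = (2 :: real) powr (real CARD('d) - s)"
  have q: "0 < q" "q < 1"
    using assms by (auto simp: q_def powr_less_one)
  have shell: "(\<Sum>x\<in>(lshell J :: (int ^ 'd) set). lnorm x powr - s) \<le> 5 ^ CARD('d) * q ^ J" for J
  proof -
    have "(\<Sum>x\<in>(lshell J :: (int ^ 'd) set). lnorm x powr - s) \<le> real (card (lshell J :: (int ^ 'd) set)) * (2 ^ J) powr - s"
      using assms by (intro sum_bounded_above lnorm_lshell_powr) auto
    also have "\<dots> \<le> (5 * 2 ^ J) ^ CARD('d) * (2 ^ J) powr - s"
      by (intro mult_right_mono card_lshell) auto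
    also have "\<dots> = 5 ^ CARD('d) * q ^ J"
      by (simp add: q_def power_mult_distrib powr_diff powr_minus powr_power field_simps
           flip: powr_realpow power_mult)
         (simp add: powr_powr powr_realpow[symmetric] mult.commute)
    finally show ?thesis .
  qed
  show "bdd_above (sum (\<lambda>x :: int ^ 'd. lnorm x powr - s) ` {F. F \<subseteq> UNIV \<and> finite F})"
  proof (rule bdd_aboveI2)
    fix X :: "(int ^ 'd) set" assume "X \<in> {F. F \<subseteq> UNIV \<and> finite F}"
    then obtain N where N: "X \<subseteq> lball N" using finite_subset_lball by blast
    have "(\<Sum>x\<in>X. lnorm x powr - s) \<le> (\<Sum>x\<in>(lball N :: (int ^ 'd) set). lnorm x powr - s)"
  using N by (intro sum_mono2) auto
    also have "\<dots> \<le> (\<Sum>J<N. 5 ^ CARD('d) * q ^ J)"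
      unfolding sum_lball by (intro sum_mono shell)
    also have "\<dots> \<le> 5 ^ CARD('d) * (1 / (1 - q))"
      unfolding sum_distrib_left[symmetric]
      using q by (intro mult_left_mono) (auto simp: sum_gp_strict divide_right_mono)
    finally show "(\<Sum>x\<in>X. lnorm x powr - s) \<le> 5 ^ CARD('d) * (1 / (1 - q))" .
  qed
qed auto

section \<open>Decaying kernels and their absolute moments\<close>

definition decays :: "real \<Rightarrow> (int ^ 'd \<Rightarrow> real) \<Rightarrow> bool" where
  "decays s f \<longleftrightarrow> (\<exists>K. \<forall>x. \<bar>f x\<bar> \<le> K * lnorm x powr - s)"

lemma decays_moment_summable:
  fixes f :: "int ^ 'd \<Rightarrow> real"
  assumes "decays s f" "s > real CARD('d) + p"
  shows "(\<lambda>x. \<bar>f x\<bar> * lnorm x powr p) summable_on UNIV"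
proof -
  obtain K where K: "\<And>x. \<bar>f x\<bar> \<le> K * lnorm x powr - s"
    using assms unfolding decays_def by blast
  have "(\<lambda>x :: int ^ 'd. K * lnorm x powr - (s - p)) summable_on UNIV"
    using assms by (intro summable_on_cmult_right summable_lnorm_powr) auto
  then show ?thesis
  proof (rule summable_on_comparison_test)
    fix x :: "int ^ 'd"
    have "\<bar>f x\<bar> * lnorm x powr p \<le> K * lnorm x powr - s * lnorm x powr p"
      using K by (intro mult_right_mono) auto
    also have "\<dots> = K * lnorm x powr - (s - p)"
      using lnorm_ge_1[of x] by (simp add: mult.assoc flip: powr_add)
    finally show "\<bar>f x\<bar> * lnorm x powr p \<le> K * lnorm x powr - (s - p)" .
  qed auto
qed

lemma summable_weighted_le:
  fixes f g :: "int ^ 'd \<Rightarrow> real"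
  assumes "(\<lambda>x. \<bar>f x\<bar> * lnorm x powr p) summable_on UNIV"
    and "\<And>x. \<bar>g x\<bar> \<le> C * lnorm x powr p"
  shows "(\<lambda>x. f x * g x) summable_on UNIV"
proof -
  have "(\<lambda>x. C * (\<bar>f x\<bar> * lnorm x powr p)) summable_on UNIV"
    using assms by (intro summable_on_cmult_right)
  then have "(\<lambda>x. norm (f x * g x)) summable_on UNIV"
  proof (rule summable_on_comparison_test)
    fix x :: "int ^ 'd"
    show "norm (f x * g x) \<le> C * (\<bar>f x\<bar> * lnorm x powr p)"
      using mult_left_mono[OF assms(2)[of x], of "\<bar>f x\<bar>"] by (simp add: abs_mult mult_ac)
  qed auto
  then show ?thesis by (rule abs_summable_summable)
qed

section \<open>Integration and Fourier coefficients on the torus\<close>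

definition torus_periodic :: "(real ^ 'd \<Rightarrow> 'a) \<Rightarrow> bool" where
  "torus_periodic f \<longleftrightarrow> (\<forall>k i. f (k + (2 * pi) *\<^sub>R axis i 1) = f k)"

lemma torus_subset_cbox: "(torus :: (real ^ 'd) set) \<subseteq> cbox (\<chi> i. - pi) (\<chi> i. pi)"
  by (auto simp: torus_def mem_box_cart less_imp_le)

lemma torus_borel [measurable]: "(torus :: (real ^ 'd) set) \<in> sets borel"
  unfolding torus_def by measurable

lemma bounded_torus: "bounded (torus :: (real ^ 'd) set)"
  by (rule bounded_subset[OF bounded_cbox torus_subset_cbox])

lemma measure_torus: "measure lborel (torus :: (real ^ 'd) set) = (2 * pi) ^ CARD('d)"
  and emeasure_torus_finite: "emeasure lborel (torus :: (real ^ 'd) set) < \<infinity>"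
proof -
  let ?a = "(\<chi> i. - pi) :: real ^ 'd" and ?b = "(\<chi> i. pi) :: real ^ 'd"
  have le: "\<forall>b\<in>Basis. ?a \<bullet> b \<le> ?b \<bullet> b"
    by (auto simp: Basis_vec_def inner_axis)
  have pr: "(\<Prod>b\<in>Basis. (?b - ?a) \<bullet> b) = (2 * pi) ^ CARD('d)"
  proof -
    have "(\<Prod>b\<in>(Basis :: (real ^ 'd) set). (?b - ?a) \<bullet> b) = (\<Prod>b\<in>(Basis :: (real ^ 'd) set). 2 * pi)"
      by (intro prod.cong) (auto simp: Basis_vec_def inner_axis)
    then show ?thesis by simp
  qed
  have 1: "emeasure lborel (box ?a ?b) \<le> emeasure lborel (torus :: (real ^ 'd) set)"
    by (intro emeasure_mono) (auto simp: torus_def mem_box_cart less_imp_le)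
  have 2: "emeasure lborel (torus :: (real ^ 'd) set) \<le> emeasure lborel (cbox ?a ?b)"
    by (intro emeasure_mono torus_subset_cbox) auto
  have e: "emeasure lborel (torus :: (real ^ 'd) set) = ennreal ((2 * pi) ^ CARD('d))"
    using 1 2 le by (auto simp: emeasure_lborel_box_eq emeasure_lborel_cbox_eq pr)
  then show "measure lborel (torus :: (real ^ 'd) set) = (2 * pi) ^ CARD('d)"
    by (simp add: measure_def)
  show "emeasure lborel (torus :: (real ^ 'd) set) < \<infinity>"
    unfolding e infinity_ennreal_def by (rule ennreal_less_top)
qed

lemma set_integrable_torus_continuous:
  fixes f :: "real ^ 'd \<Rightarrow> 'a :: {banach, second_countable_topology}"
  assumes "continuous_on UNIV f"
  shows "set_integrable lborel torus f"
proof (rule set_integrable_subset[OF _ _ torus_subset_cbox])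
  show "set_integrable lborel (cbox (\<chi> i. - pi) (\<chi> i. pi)) f"
    unfolding set_integrable_def
    by (intro borel_integrable_compact continuous_on_subset[OF assms]) auto
qed auto

lemma integral_lborel_translate:
  fixes f :: "'b :: euclidean_space \<Rightarrow> 'a :: {banach, second_countable_topology}"
  assumes [measurable]: "f \<in> borel_measurable borel"
  shows "(LINT k|lborel. f (k + c)) = (LINT k|lborel. f k)"
proof -
  have "(LINT k|distr lborel borel ((+) c). f k) = (LINT k|lborel. f (c + k))"
    by (rule integral_distr) auto
  then show ?thesis
    unfolding lborel_distr_plus[of c] by (simp only: add.commute[of c])
qed

text \<open>The shifted cube consists of the part \<open>A\<close> of the old cube that it still
  covers and of the slab \<open>B\<close> moved by a full period; periodicity of \<open>f\<close>
  moves that slab back. The bound \<open>h \<le> 2 * pi\<close> ensures that one wrap is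
  enough.\<close>

lemma torus_integral_shift:
  fixes f :: "real ^ 'd \<Rightarrow> 'a :: {banach, second_countable_topology}"
  assumes cont: "continuous_on UNIV f" and per: "torus_periodic f" and h: "0 \<le> h" "h \<le> 2 * pi"
  shows "(LINT k:torus|lborel. f (k + h *\<^sub>R axis j 1)) = (LINT k:torus|lborel. f k)"
proof -
  define A where "A = torus \<inter> {k :: real ^ 'd. - pi + h < k $ j}"
  define B where "B = torus \<inter> {k :: real ^ 'd. k $ j \<le> - pi + h}"
  have [measurable]: "A \<in> sets borel" "B \<in> sets borel" "f \<in> borel_measurable borel"
    unfolding A_def B_def using borel_measurable_continuous_onI[OF cont] by auto
  have AB: "A \<inter> B = {}" "A \<union> B = torus" by (auto simp: A_def B_def)
  have ind: "indicat_real torus (k + (- h) *\<^sub>R axis j 1)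
      = indicator A k + indicator B (k + (- 2 * pi) *\<^sub>R axis j 1)" for k :: "real ^ 'd"
  proof -
    have j: "(k + c *\<^sub>R axis j 1) $ j = k $ j + c" for c by (simp add: axis_def)
    have i: "(k + c *\<^sub>R axis j 1) $ i = k $ i" if "i \<noteq> j" for c i using that by (simp add: axis_def)
    have split: "(\<forall>i. P i) \<longleftrightarrow> P j \<and> (\<forall>i. i \<noteq> j \<longrightarrow> P i)" for P by metis
    have t: "k + c *\<^sub>R axis j 1 \<in> torus \<longleftrightarrow>
        - pi < k $ j + c \<and> k $ j + c \<le> pi \<and> (\<forall>i. i \<noteq> j \<longrightarrow> - pi < k $ i \<and> k $ i \<le> pi)" for c
    proof -
      have "k + c *\<^sub>R axis j 1 \<in> torus \<longleftrightarrow> (- pi < (k + c *\<^sub>R axis j 1) $ j \<and> (k + c *\<^sub>R axis j 1) $ j \<le> pi) \<and>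
          (\<forall>i. i \<noteq> j \<longrightarrow> - pi < (k + c *\<^sub>R axis j 1) $ i \<and> (k + c *\<^sub>R axis j 1) $ i \<le> pi)"
        unfolding torus_def mem_Collect_eq by (rule split)
      then show ?thesis by (simp only: i j conj_assoc simp_thms cong: imp_cong)
    qed
    have t0: "k \<in> torus \<longleftrightarrow>
        - pi < k $ j \<and> k $ j \<le> pi \<and> (\<forall>i. i \<noteq> j \<longrightarrow> - pi < k $ i \<and> k $ i \<le> pi)"
      using t[of 0] by simp
    have "k \<in> A \<longleftrightarrow> - pi + h < k $ j \<and> k $ j \<le> pi \<and> (\<forall>i. i \<noteq> j \<longrightarrow> - pi < k $ i \<and> k $ i \<le> pi)"
      unfolding A_def using t0 h by auto
    moreover have "k + (- 2 * pi) *\<^sub>R axis j 1 \<in> B \<longleftrightarrow>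
        pi < k $ j \<and> k $ j \<le> pi + h \<and> (\<forall>i. i \<noteq> j \<longrightarrow> - pi < k $ i \<and> k $ i \<le> pi)"
      unfolding B_def Int_iff t mem_Collect_eq j using h by auto
    ultimately show ?thesis
      using t[of "- h"] h
      by (cases "\<forall>i. i \<noteq> j \<longrightarrow> - pi < k $ i \<and> k $ i \<le> pi"; cases "k $ j \<le> pi") (simp_all only: indicator_def, auto)
  qed
  have intA: "set_integrable lborel A f" and intB: "set_integrable lborel B f"
    using set_integrable_torus_continuous[OF cont] by (rule set_integrable_subset; auto simp: A_def B_def)+
  have per': "f (k + (- 2 * pi) *\<^sub>R axis j 1) = f k" for k
    using per[unfolded torus_periodic_def, rule_format, of "k + (- 2 * pi) *\<^sub>R axis j 1" j] by simp
  define c :: "real ^ 'd" where "c = (- 2 * pi) *\<^sub>R axis j 1"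
  have per'': "f (k + c) = f k" for k
    using per' unfolding c_def .
  have tr: "(LINT k|lborel. indicat_real B (k + c) *\<^sub>R f k) = (LINT k:B|lborel. f k)"
    using integral_lborel_translate[of "\<lambda>k. indicat_real B k *\<^sub>R f k" c]
    unfolding per'' set_lebesgue_integral_def by measurable
  have intB': "integrable lborel (\<lambda>k. indicat_real B (k + c) *\<^sub>R f k)"
  proof -
    have "integrable (distr lborel borel ((+) c)) (\<lambda>k. indicat_real B k *\<^sub>R f k)"
      unfolding lborel_distr_plus using intB by (simp only: set_integrable_def)
    then have "integrable lborel (\<lambda>k. indicat_real B (c + k) *\<^sub>R f (c + k))"
      by (subst (asm) integrable_distr_eq) auto
    then show ?thesis by (simp only: add.commute[of c] per'')
  qed
  have hh: "k + h *\<^sub>R axis j 1 + (- h) *\<^sub>R axis j 1 = k" for k :: "real ^ 'd"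
    by simp
  have "(LINT k:torus|lborel. f (k + h *\<^sub>R axis j 1)) = (LINT k|lborel. indicat_real torus (k + (- h) *\<^sub>R axis j 1) *\<^sub>R f k)"
    unfolding set_lebesgue_integral_def
    using integral_lborel_translate[of "\<lambda>k. indicat_real torus (k + (- h) *\<^sub>R axis j 1) *\<^sub>R f k" "h *\<^sub>R axis j 1"]
    unfolding hh by measurable
  also have "\<dots> = (LINT k:A|lborel. f k) + (LINT k:B|lborel. f k)"
    unfolding ind scaleR_add_left c_def[symmetric] set_lebesgue_integral_def
      tr[unfolded set_lebesgue_integral_def, symmetric]
    using intA intB' by (intro Bochner_Integration.integral_add) (auto simp: set_integrable_def)
  also have "\<dots> = (LINT k:torus|lborel. f k)"
    using AB intA intB by (subst set_integral_Un[symmetric]) auto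
  finally show ?thesis .
qed

section \<open>Characters and their orthogonality\<close>

abbreviation character :: "int ^ 'd \<Rightarrow> real ^ 'd \<Rightarrow> complex" where
  "character x k \<equiv> exp (\<i> * complex_of_real (k \<bullet> lvec x))"

lemma character_shift: "character x (k + t *\<^sub>R axis j 1) = cis (t * real_of_int (x $ j)) * character x k"
  by (simp add: inner_add_left inner_axis' lvec_def distrib_left exp_add cis_conv_exp mult_ac)

lemma torus_periodic_character: "torus_periodic (character x)"
  unfolding torus_periodic_def
  by (simp only: character_shift cis_multiple_2pi[OF Ints_of_int] mult_1 simp_thms)

lemma continuous_on_character: "continuous_on A (character x)"
  by (intro continuous_intros)

lemma norm_character [simp]: "norm (character x k) = 1"
  by simp

lemma cnj_character: "cnj (character x k) = character (- x) k"
  and character_add: "character (x + y) k = character x k * character y k"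
proof -
  have 1: "k \<bullet> lvec (- x) = - (k \<bullet> lvec x)"
    by (simp add: lvec_def inner_vec_def sum_negf)
  show "cnj (character x k) = character (- x) k"
    unfolding 1 by (simp add: exp_cnj)
  have 2: "k \<bullet> lvec (x + y) = k \<bullet> lvec x + k \<bullet> lvec y"
    by (simp add: lvec_def inner_vec_def sum.distrib distrib_left)
  show "character (x + y) k = character x k * character y k"
    unfolding 2 by (simp add: distrib_left exp_add)
qed

text \<open>If \<open>x $ j \<noteq> 0\<close>, a shift by \<open>pi / \<bar>x $ j\<bar>\<close> in
  direction \<open>j\<close> is half a period of the character: it changes its sign and keeps its
  integral, which is therefore 0.\<close>

lemma integral_character:
  "(LINT k:(torus :: (real ^ 'd) set)|lborel. character x k)
     = (if x = 0 then (2 * complex_of_real pi) ^ CARD('d) else 0)"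
proof (cases "x = 0")
  case True
  have l: "lvec (0 :: int ^ 'd) = 0" by (simp add: lvec_def vec_eq_iff)
  show ?thesis
    using measure_torus[where 'd = 'd] emeasure_torus_finite[where 'd = 'd] True
    by (simp add: l set_lebesgue_integral_def scaleR_conv_of_real)
next
  case False
  then obtain j where j: "x $ j \<noteq> 0" by (auto simp: vec_eq_iff)
  define h where "h = pi / \<bar>real_of_int (x $ j)\<bar>"
  have "\<bar>real_of_int (x $ j)\<bar> \<ge> 1" using j by linarith
  then have h: "0 \<le> h" "h \<le> 2 * pi"
    unfolding h_def by (auto simp: divide_simps intro: order_trans[of _ "2 * pi * 1"])
  have "cis (h * real_of_int (x $ j)) = - 1"
    using j by (cases "x $ j > 0") (auto simp: h_def complex_eq_iff)
  then have "(LINT k:torus|lborel. character x k) = - (LINT k:torus|lborel. character x k)"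
    using torus_integral_shift[of "character x" h j, OF continuous_on_character torus_periodic_character h]
    by (simp only: character_shift set_integral_mult_right) simp
  then show ?thesis using False by simp
qed

section \<open>The torus as a finite measure space\<close>

definition torus_measure :: "(real ^ 'd) measure" where
  "torus_measure = restrict_space lborel torus"

lemma space_torus_measure [simp]: "space torus_measure = torus"
  by (simp add: torus_measure_def space_restrict_space)

lemma measurable_torus_measure [measurable (raw)]:
  "f \<in> borel_measurable borel \<Longrightarrow> f \<in> borel_measurable torus_measure"
  unfolding torus_measure_def by (intro measurable_restrict_space1) simp

lemma torus_integral_eq:
  fixes f :: "real ^ 'd \<Rightarrow> 'a :: {banach, second_countable_topology}"
  shows "(LINT k:torus|lborel. f k) = (LINT k|torus_measure. f k)"
  unfolding torus_measure_def set_lebesgue_integral_def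
  by (subst integral_restrict_space) auto

lemma torus_integrable_eq:
  fixes f :: "real ^ 'd \<Rightarrow> 'a :: {banach, second_countable_topology}"
  shows "set_integrable lborel torus f \<longleftrightarrow> integrable torus_measure f"
  unfolding torus_measure_def set_integrable_def
  by (subst integrable_restrict_space) auto

lemma AE_torus_measure: "(AE k in torus_measure. P k) \<longleftrightarrow> (AE k in lborel. k \<in> torus \<longrightarrow> P k)"
  unfolding torus_measure_def by (subst AE_restrict_space_iff) auto

lemma AE_torus_nonzero: "AE k in torus_measure. k \<noteq> 0"
  unfolding AE_torus_measure using AE_lborel_singleton[of 0] by eventually_elim auto

lemma emeasure_torus_measure: "emeasure torus_measure (torus :: (real ^ 'd) set) < \<infinity>"
  unfolding torus_measure_def
  using emeasure_torus_finite[where 'd = 'd] by (subst emeasure_restrict_space) auto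

interpretation torus: finite_measure "torus_measure :: (real ^ 'd) measure"
  using emeasure_torus_measure[where 'd = 'd, THEN less_imp_neq] by (intro finite_measureI) simp

lemma integrable_torus_continuous:
  fixes f :: "real ^ 'd \<Rightarrow> 'a :: {banach, second_countable_topology}"
  shows "continuous_on UNIV f \<Longrightarrow> integrable torus_measure f"
  using set_integrable_torus_continuous torus_integrable_eq by blast

lemma integrable_torus_bounded:
  fixes f :: "real ^ 'd \<Rightarrow> 'a :: {banach, second_countable_topology}"
  assumes "f \<in> borel_measurable torus_measure" "\<And>k. k \<in> torus \<Longrightarrow> norm (f k) \<le> B"
  shows "integrable torus_measure f"
  using assms by (intro torus.integrable_const_bound[where B = B]) auto

lemma character_measurable [measurable]: "character x \<in> borel_measurable borel"
  by (intro borel_measurable_continuous_onI continuous_on_character)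

lemma integrable_character_mult:
  assumes "integrable torus_measure h"
  shows "integrable torus_measure (\<lambda>k. character x k * h k)"
  by (rule Bochner_Integration.integrable_bound[OF assms])
     (use assms in \<open>auto simp: norm_mult intro: borel_measurable_times\<close>)

lemma fourier_integral_eq:
  "fourier_integral h x = (LINT k|torus_measure. character (- x) k * h k) / (2 * complex_of_real pi) ^ CARD('d)"
  for x :: "int ^ 'd"
proof -
  have "exp (- \<i> * complex_of_real (k \<bullet> lvec x)) = character (- x) k" for k
    unfolding cnj_character[symmetric] by (simp add: exp_cnj)
  then show ?thesis
    by (simp add: fourier_integral_def torus_integral_eq)
qed

text \<open>Parseval for trigonometric polynomials: after expanding the square, orthogonality leaves
  the diagonal of the double sum.\<close>

lemma integral_trig_poly_square:
  fixes c :: "int ^ 'd \<Rightarrow> complex"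
  assumes B: "finite B"
  shows "(LINT k|torus_measure. (cmod (\<Sum>x\<in>B. c x * character x k))\<^sup>2) = (2 * pi) ^ CARD('d) * (\<Sum>x\<in>B. (cmod (c x))\<^sup>2)"
proof -
  have sq: "complex_of_real ((cmod (\<Sum>x\<in>B. c x * character x k))\<^sup>2)
      = (\<Sum>x\<in>B. \<Sum>y\<in>B. c x * cnj (c y) * character (x - y) k)" for k
  proof -
    have "complex_of_real ((cmod (\<Sum>x\<in>B. c x * character x k))\<^sup>2)
        = (\<Sum>x\<in>B. c x * character x k) * cnj (\<Sum>x\<in>B. c x * character x k)"
      by (rule complex_norm_square)
    also have "\<dots> = (\<Sum>x\<in>B. \<Sum>y\<in>B. (c x * character x k) * (cnj (c y) * cnj (character y k)))"
      by (simp only: cnj_sum complex_cnj_mult sum_product)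
    also have "\<dots> = (\<Sum>x\<in>B. \<Sum>y\<in>B. c x * cnj (c y) * (character x k * cnj (character y k)))"
      by (simp only: mult_ac)
    also have "\<dots> = (\<Sum>x\<in>B. \<Sum>y\<in>B. c x * cnj (c y) * character (x - y) k)"
      by (simp only: cnj_character character_add[symmetric] diff_conv_add_uminus)
    finally show ?thesis .
  qed
  have int: "integrable torus_measure (\<lambda>k. a * character x k)" for a and x :: "int ^ 'd"
    by (intro integrable_torus_continuous continuous_intros)
  have "complex_of_real (LINT k|torus_measure. (cmod (\<Sum>x\<in>B. c x * character x k))\<^sup>2)
      = (LINT k|torus_measure. (\<Sum>x\<in>B. \<Sum>y\<in>B. c x * cnj (c y) * character (x - y) k))"
    unfolding integral_complex_of_real[symmetric] sq ..
  also have "\<dots> = (\<Sum>x\<in>B. \<Sum>y\<in>B. (LINT k|torus_measure. c x * cnj (c y) * character (x - y) k))"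
    using int by (simp add: Bochner_Integration.integral_sum Bochner_Integration.integrable_sum)
  also have "\<dots> = (\<Sum>x\<in>B. \<Sum>y\<in>B. if x = y then c x * cnj (c y) * (2 * complex_of_real pi) ^ CARD('d) else 0)"
    by (intro sum.cong refl) (simp add: torus_integral_eq[symmetric] integral_character)
  also have "\<dots> = (\<Sum>x\<in>B. complex_of_real ((cmod (c x))\<^sup>2) * (2 * complex_of_real pi) ^ CARD('d))"
    using B unfolding complex_norm_square by simp
  also have "\<dots> = complex_of_real ((2 * pi) ^ CARD('d) * (\<Sum>x\<in>B. (cmod (c x))\<^sup>2))"
    by (simp add: sum_distrib_left mult_ac)
  finally show ?thesis
    by (simp only: of_real_eq_iff)
qed

text \<open>Expand the nonnegative integral of the squared distance between \<open>h\<close> and its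
  partial Fourier sum \<open>S\<close>. The cross term \<open>h * Re S\<close> and the square of
  \<open>S\<close> have the same integral, so one copy survives with a minus sign.\<close>

lemma Bessel_inequality:
  fixes h :: "real ^ 'd \<Rightarrow> real"
  assumes h: "h \<in> borel_measurable torus_measure" and bd: "\<And>k. k \<in> torus \<Longrightarrow> \<bar>h k\<bar> \<le> M" and B: "finite B"
  shows "(2 * pi) ^ CARD('d) * (\<Sum>x\<in>B. (cmod (fourier_integral (\<lambda>k. complex_of_real (h k)) x))\<^sup>2)
    \<le> (LINT k|torus_measure. (h k)\<^sup>2)"
proof -
  define a where "a x = fourier_integral (\<lambda>k. complex_of_real (h k)) x" for x
  define S where "S k = (\<Sum>x\<in>B. a x * character x k)" for k
  have M: "integrable torus_measure h"
    using bd by (intro integrable_torus_bounded[OF h]) auto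
  have hc: "integrable torus_measure (\<lambda>k. complex_of_real (h k))"
    using M by simp
  have h2: "integrable torus_measure (\<lambda>k. (h k)\<^sup>2)"
  proof (rule integrable_torus_bounded[where B = "M\<^sup>2"])
    show "norm ((h k)\<^sup>2) \<le> M\<^sup>2" if "k \<in> torus" for k
      using power_mono[OF bd[OF that], of 2] by simp
  qed (use h in measurable)
  have contS: "continuous_on UNIV S"
    unfolding S_def by (intro continuous_intros)
  have S2: "integrable torus_measure (\<lambda>k. (cmod (S k))\<^sup>2)"
    by (intro integrable_torus_continuous continuous_intros contS)
  have hS_eq: "complex_of_real (h k) * S k = (\<Sum>x\<in>B. a x * (character x k * complex_of_real (h k)))" for k
    unfolding S_def sum_distrib_left by (simp only: mult_ac)
  have chi: "integrable torus_measure (\<lambda>k. a x * (character x k * complex_of_real (h k)))" for x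
    by (intro integrable_mult_right integrable_character_mult hc)
  have hS: "integrable torus_measure (\<lambda>k. complex_of_real (h k) * S k)"
    unfolding hS_eq by (intro Bochner_Integration.integrable_sum chi)
  have conj: "(LINT k|torus_measure. character x k * complex_of_real (h k)) = (2 * complex_of_real pi) ^ CARD('d) * cnj (a x)" for x
  proof -
    have "character x k * complex_of_real (h k) = cnj (character (- x) k * complex_of_real (h k))" for k
      by (simp only: complex_cnj_mult cnj_character complex_cnj_complex_of_real minus_minus)
    then have "(LINT k|torus_measure. character x k * complex_of_real (h k)) = cnj (LINT k|torus_measure. character (- x) k * complex_of_real (h k))"
      by (simp only: Bochner_Integration.integral_cnj)
    also have "\<dots> = (2 * complex_of_real pi) ^ CARD('d) * cnj (a x)"
      by (simp add: a_def fourier_integral_eq)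
    finally show ?thesis .
  qed
  have "(LINT k|torus_measure. complex_of_real (h k) * S k)
      = (\<Sum>x\<in>B. a x * (LINT k|torus_measure. character x k * complex_of_real (h k)))"
    unfolding hS_eq by (simp only: Bochner_Integration.integral_sum[OF chi] integral_mult_right_zero)
  also have "\<dots> = complex_of_real ((2 * pi) ^ CARD('d) * (\<Sum>x\<in>B. (cmod (a x))\<^sup>2))"
    unfolding conj of_real_mult of_real_sum complex_norm_square sum_distrib_left
    by (simp add: mult_ac)
  finally have cross: "(LINT k|torus_measure. h k * Re (S k)) = (2 * pi) ^ CARD('d) * (\<Sum>x\<in>B. (cmod (a x))\<^sup>2)"
    using integral_Re[OF hS] by (simp del: of_real_mult of_real_power of_real_sum)
  have hRe: "integrable torus_measure (\<lambda>k. h k * Re (S k))"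
    using integrable_Re[OF hS] by simp
  have "0 \<le> (LINT k|torus_measure. (cmod (complex_of_real (h k) - S k))\<^sup>2)"
    by simp
  also have "\<dots> = (LINT k|torus_measure. (h k)\<^sup>2 - 2 * (h k * Re (S k)) + (cmod (S k))\<^sup>2)"
    by (simp only: cmod_power2) (simp add: power2_eq_square algebra_simps)
  also have "\<dots> = (LINT k|torus_measure. (h k)\<^sup>2) - 2 * (LINT k|torus_measure. h k * Re (S k)) + (LINT k|torus_measure. (cmod (S k))\<^sup>2)"
    using h2 hRe S2 by simp
  also have "(LINT k|torus_measure. (cmod (S k))\<^sup>2) = (2 * pi) ^ CARD('d) * (\<Sum>x\<in>B. (cmod (a x))\<^sup>2)"
    unfolding S_def by (rule integral_trig_poly_square[OF B])
  finally show ?thesis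
    unfolding cross a_def by (simp only: mult.assoc)
qed

section \<open>The Riemann-Lebesgue lemma\<close>

lemma eventually_lattice_at_infinity: 
  "eventually P lattice_at_infinity \<longleftrightarrow> (\<exists>R. \<forall>x. R \<le> norm (lvec x) \<longrightarrow> P x)"
  unfolding lattice_at_infinity_def eventually_filtercomap eventually_at_top_linorder
  by auto

lemma eventually_lattice_not_in_finite:
  assumes "finite X" shows "eventually (\<lambda>x. x \<notin> X) lattice_at_infinity"
proof -
  obtain N where "X \<subseteq> lball N" using finite_subset_lball[OF assms] by blast
  then show ?thesis
    unfolding eventually_lattice_at_infinity
    by (intro exI[of _ "2 ^ N"]) (auto simp: lball_def lnorm_def)
qed

lemma one_le_two_pi_power: "1 \<le> (2 * pi) ^ n"
  using pi_gt3 by (intro one_le_power) auto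

text \<open>By Bessel only finitely many coefficients can have modulus at least \<open>e\<close>,
  and every finite set of lattice points is eventually left behind.\<close>

lemma Riemann_Lebesgue_bounded:
  fixes h :: "real ^ 'd \<Rightarrow> real"
  assumes "h \<in> borel_measurable torus_measure" and "\<And>k. k \<in> torus \<Longrightarrow> \<bar>h k\<bar> \<le> M"
  shows "(fourier_integral (\<lambda>k. complex_of_real (h k)) \<longlongrightarrow> 0) lattice_at_infinity"
proof (rule tendstoI)
  fix e :: real assume e: "e > 0"
  let ?a = "fourier_integral (\<lambda>k. complex_of_real (h k))"
  let ?I = "(LINT k|torus_measure. (h k)\<^sup>2)"
  have "finite {x. e \<le> cmod (?a x)}"
  proof (rule ccontr)
    assume "infinite {x. e \<le> cmod (?a x)}"
    moreover obtain n :: nat where n: "?I < real n * e\<^sup>2"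
      using reals_Archimedean3[of "e\<^sup>2"] e by auto
    ultimately obtain B where B: "finite B" "card B = n" "B \<subseteq> {x. e \<le> cmod (?a x)}"
      using infinite_arbitrarily_large by blast
    have "real n * e\<^sup>2 \<le> (\<Sum>x\<in>B. (cmod (?a x))\<^sup>2)"
      using sum_bounded_below[of B "e\<^sup>2" "\<lambda>x. (cmod (?a x))\<^sup>2"] B e by (auto intro!: power_mono)
    also have "\<dots> \<le> (2 * pi) ^ CARD('d) * (\<Sum>x\<in>B. (cmod (?a x))\<^sup>2)"
      using mult_right_mono[OF one_le_two_pi_power, of "\<Sum>x\<in>B. (cmod (?a x))\<^sup>2" "CARD('d)"]
      by (simp only: mult_1 sum_nonneg zero_le_power2)
    also have "\<dots> \<le> ?I"
      by (rule Bessel_inequality[OF assms B(1)])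
    finally show False using n by simp
  qed
  from eventually_lattice_not_in_finite[OF this]
  show "\<forall>\<^sub>F x in lattice_at_infinity. dist (?a x) 0 < e"
    by eventually_elim auto
qed

lemma norm_fourier_integral_le:
  fixes h :: "real ^ 'd \<Rightarrow> complex"
  assumes "integrable torus_measure h"
  shows "cmod (fourier_integral h x) \<le> (LINT k|torus_measure. cmod (h k))"
proof -
  have "cmod (LINT k|torus_measure. character (- x) k * h k) \<le> (LINT k|torus_measure. cmod (h k))"
    using integral_norm_bound[of torus_measure "\<lambda>k. character (- x) k * h k"]
    by (simp add: norm_mult)
  moreover have "cmod ((2 * complex_of_real pi) ^ CARD('d)) = (2 * pi) ^ CARD('d)"
    by (simp add: norm_power norm_mult)
  moreover have "0 \<le> (LINT k|torus_measure. cmod (h k))" by simp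
  ultimately show ?thesis
    unfolding fourier_integral_eq norm_divide
    using frac_le[of "LINT k|torus_measure. cmod (h k)" "cmod (LINT k|torus_measure. character (- x) k * h k)" 1 "(2 * pi) ^ CARD('d)"]
      one_le_two_pi_power[of "CARD('d)"] by (simp only: div_by_1 zero_less_one)
qed

text \<open>Cutting \<open>h\<close> to 0 where it exceeds \<open>n\<close> gives bounded functions
  that approach \<open>h\<close> in mean, and the Fourier coefficients of the error are bounded by
  its mean, uniformly in \<open>x\<close>.\<close>

theorem Riemann_Lebesgue:
  fixes h :: "real ^ 'd \<Rightarrow> real"
  assumes h: "integrable torus_measure h"
  shows "(fourier_integral (\<lambda>k. complex_of_real (h k)) \<longlongrightarrow> 0) lattice_at_infinity"
proof (rule tendstoI)
  fix e :: real assume e: "e > 0"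
  have [measurable]: "h \<in> borel_measurable torus_measure" using h by auto
  define g where "g n k = (if \<bar>h k\<bar> \<le> real n then h k else 0)" for n k
  have gm [measurable]: "g n \<in> borel_measurable torus_measure" for n
    unfolding g_def by measurable
  have "(\<lambda>n. LINT k|torus_measure. \<bar>h k - g n k\<bar>) \<longlonglongrightarrow> (LINT k|(torus_measure :: (real ^ 'd) measure). 0)"
  proof (rule integral_dominated_convergence[where w = "\<lambda>k. \<bar>h k\<bar>"])
    show "AE k in torus_measure. (\<lambda>n. \<bar>h k - g n k\<bar>) \<longlonglongrightarrow> 0"
    proof (rule AE_I2)
      fix k
      obtain N :: nat where "\<bar>h k\<bar> \<le> real N" using real_arch_simple by blast
      then have "\<forall>n\<ge>N. \<bar>h k - g n k\<bar> = 0" by (auto simp: g_def)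
      then show "(\<lambda>n. \<bar>h k - g n k\<bar>) \<longlonglongrightarrow> 0"
        by (intro tendsto_eventually) (auto simp: eventually_sequentially)
    qed
  qed (use h in \<open>auto simp: g_def\<close>)
  then have "\<forall>\<^sub>F n in sequentially. (LINT k|torus_measure. \<bar>h k - g n k\<bar>) < e / 2"
    using e by (intro order_tendstoD(2)) auto
  then obtain n where n: "(LINT k|torus_measure. \<bar>h k - g n k\<bar>) < e / 2"
    by (auto simp: eventually_sequentially)
  have gi: "integrable torus_measure (g n)"
    by (rule integrable_torus_bounded[where B = "real n"]) (auto simp: g_def)
  have hg: "integrable torus_measure (\<lambda>k. complex_of_real (h k - g n k))"
    using h gi by auto
  have "(fourier_integral (\<lambda>k. complex_of_real (g n k)) \<longlongrightarrow> 0) lattice_at_infinity"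
    by (rule Riemann_Lebesgue_bounded[where M = "real n"]) (auto simp: g_def)
  then have "\<forall>\<^sub>F x in lattice_at_infinity. dist (fourier_integral (\<lambda>k. complex_of_real (g n k)) x) 0 < e / 2"
    using e by (intro tendstoD) auto
  then show "\<forall>\<^sub>F x in lattice_at_infinity. dist (fourier_integral (\<lambda>k. complex_of_real (h k)) x) 0 < e"
  proof eventually_elim
    case (elim x)
    have "fourier_integral (\<lambda>k. complex_of_real (h k)) x
        = fourier_integral (\<lambda>k. complex_of_real (h k - g n k)) x + fourier_integral (\<lambda>k. complex_of_real (g n k)) x"
      unfolding fourier_integral_eq add_divide_distrib[symmetric]
      using integrable_character_mult[OF hg] gi integrable_character_mult[of "\<lambda>k. complex_of_real (g n k)"]
      by (subst Bochner_Integration.integral_add[symmetric]) (auto simp: algebra_simps)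
    moreover have "cmod (fourier_integral (\<lambda>k. complex_of_real (h k - g n k)) x) \<le> (LINT k|torus_measure. \<bar>h k - g n k\<bar>)"
      using norm_fourier_integral_le[OF hg, of x] by (simp del: of_real_diff)
    ultimately show ?case
      using elim n norm_triangle_ineq[of "fourier_integral (\<lambda>k. complex_of_real (h k - g n k)) x" "fourier_integral (\<lambda>k. complex_of_real (g n k)) x"]
      by (simp del: of_real_diff)
  qed
qed

section \<open>Coordinate derivatives and integration by parts\<close>

definition has_pd :: "'d \<Rightarrow> (real ^ 'd \<Rightarrow> 'a :: real_normed_vector) \<Rightarrow> (real ^ 'd \<Rightarrow> 'a) \<Rightarrow> bool" where
  "has_pd j u u' \<longleftrightarrow> (\<forall>k t. ((\<lambda>t. u (k + t *\<^sub>R axis j 1)) has_vector_derivative u' (k + t *\<^sub>R axis j 1)) (at t))"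

text \<open>Shift invariance makes the integral of every difference quotient 0. The quotients
  converge to \<open>v'\<close> and are uniformly bounded by the mean value inequality, so dominated
  convergence applies; no iterated integrals or boundary terms occur.\<close>

lemma integral_pd_eq_0:
  fixes v :: "real ^ 'd \<Rightarrow> 'a :: euclidean_space"
  assumes cont: "continuous_on UNIV v" and per: "torus_periodic v"
    and cont': "continuous_on UNIV v'" and pd: "has_pd j v v'"
  shows "(LINT k|torus_measure. v' k) = 0"
proof -
  define e where "e = (axis j 1 :: real ^ 'd)"
  define h where "h n = 1 / real (Suc n)" for n
  have h: "0 < h n" "h n \<le> 1" for n by (auto simp: h_def divide_simps)
  define q where "q n k = (1 / h n) *\<^sub>R (v (k + h n *\<^sub>R e) - v k)" for n k
  have der: "((\<lambda>t. v (k + t *\<^sub>R e)) has_vector_derivative v' (k + t *\<^sub>R e)) (at t within X)" for k t X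
    using pd unfolding has_pd_def e_def by (blast intro: has_vector_derivative_at_within)
  \<comment> \<open>The increments satisfy \<open>h n \<le> 1\<close>, so segments starting in the
    torus stay in the box enlarged by 1.\<close>
  have "bounded (v' ` cbox (\<chi> i. - pi) (\<chi> i. pi + 1))"
    by (intro compact_imp_bounded compact_continuous_image continuous_on_subset[OF cont']) auto
  then obtain B where B: "\<And>k. k \<in> cbox (\<chi> i. - pi) (\<chi> i. pi + 1) \<Longrightarrow> norm (v' k) \<le> B"
    by (auto simp: bounded_iff)
  have qB: "norm (q n k) \<le> B" if k: "k \<in> torus" for n k
  proof -
    have "norm (v (k + h n *\<^sub>R e) - v (k + 0 *\<^sub>R e)) \<le> B * norm (h n - 0)"
    proof (rule differentiable_bound[of "{0..h n}" "\<lambda>t. v (k + t *\<^sub>R e)" "\<lambda>t s. s *\<^sub>R v' (k + t *\<^sub>R e)"])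
      fix t assume t: "t \<in> {0..h n}"
      show "((\<lambda>t. v (k + t *\<^sub>R e)) has_derivative (\<lambda>s. s *\<^sub>R v' (k + t *\<^sub>R e))) (at t within {0..h n})"
        using der unfolding has_vector_derivative_def .
      have "k + t *\<^sub>R e \<in> cbox (\<chi> i. - pi) (\<chi> i. pi + 1)"
      proof (clarsimp simp: mem_box_cart)
        fix i
        have "- pi < k $ i" "k $ i \<le> pi" using k by (auto simp: torus_def)
        moreover have "0 \<le> t" "t \<le> 1" using t h(2)[of n] by auto
        ultimately show "- pi \<le> k $ i + t * e $ i \<and> k $ i + t * e $ i \<le> pi + 1"
          by (auto simp: e_def axis_def)
      qed
      then have "norm (v' (k + t *\<^sub>R e)) \<le> B" by (rule B)
      then show "onorm (\<lambda>s. s *\<^sub>R v' (k + t *\<^sub>R e)) \<le> B"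
        by (intro onorm_bound) (auto simp: mult.commute[of B] intro: mult_left_mono order_trans[OF norm_ge_zero])
    qed (use h(1)[of n] in auto)
    then show ?thesis
      using h(1)[of n] by (simp add: q_def divide_simps mult.commute)
  qed
  have contq: "continuous_on UNIV (q n)" for n
    unfolding q_def by (intro continuous_intros continuous_on_compose2[OF cont]) auto
  have "(\<lambda>n. LINT k|torus_measure. q n k) \<longlonglongrightarrow> (LINT k|torus_measure. v' k)"
  proof (rule integral_dominated_convergence[where w = "\<lambda>_. B"])
    show "AE k in torus_measure. (\<lambda>n. q n k) \<longlonglongrightarrow> v' k"
    proof (rule AE_I2)
      fix k
      have lim: "((\<lambda>s. (1 / \<bar>s\<bar>) *\<^sub>R (v (k + s *\<^sub>R e) - (v k + s *\<^sub>R v' k))) \<longlongrightarrow> 0) (at 0)"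
        using der[of k 0 UNIV] unfolding has_vector_derivative_def has_derivative_at2 by simp
      \<comment> \<open>The limit \<open>lim\<close> is normalised by \<open>\<bar>s\<bar>\<close>
        and the difference quotient by \<open>s\<close>; the two errors have equal norm, which
        settles both signs of \<open>s\<close>.\<close>
      have "\<forall>\<^sub>F s in at 0. norm ((1 / s) *\<^sub>R (v (k + s *\<^sub>R e) - v k) - v' k)
          \<le> norm ((1 / \<bar>s\<bar>) *\<^sub>R (v (k + s *\<^sub>R e) - (v k + s *\<^sub>R v' k)))"
      proof (intro eventually_at[THEN iffD2] exI[of _ 1] conjI ballI impI zero_less_one)
        fix s :: real assume "s \<noteq> 0 \<and> dist s 0 < 1"
        then have "(1 / s) *\<^sub>R (v (k + s *\<^sub>R e) - v k) - v' k = (1 / s) *\<^sub>R (v (k + s *\<^sub>R e) - (v k + s *\<^sub>R v' k))"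
          by (simp add: algebra_simps)
        then show "norm ((1 / s) *\<^sub>R (v (k + s *\<^sub>R e) - v k) - v' k)
          \<le> norm ((1 / \<bar>s\<bar>) *\<^sub>R (v (k + s *\<^sub>R e) - (v k + s *\<^sub>R v' k)))"
          by simp
      qed
      from Lim_null_comparison[OF this tendsto_norm_zero[OF lim]]
      have "((\<lambda>s. (1 / s) *\<^sub>R (v (k + s *\<^sub>R e) - v k)) \<longlongrightarrow> v' k) (at 0)"
        by (rule LIM_zero_cancel)
      moreover have "filterlim h (at 0) sequentially"
      proof -
        have "h \<longlonglongrightarrow> 0"
          unfolding h_def using LIMSEQ_inverse_real_of_nat by (simp only: inverse_eq_divide)
        then show ?thesis
          unfolding filterlim_at using h(1) by (simp add: less_imp_neq[symmetric])
      qed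
      ultimately show "(\<lambda>n. q n k) \<longlonglongrightarrow> v' k"
        unfolding q_def by (rule filterlim_compose)
    qed
    show "v' \<in> borel_measurable torus_measure"
      by (intro measurable_torus_measure borel_measurable_continuous_onI cont')
    show "q n \<in> borel_measurable torus_measure" for n
      by (intro measurable_torus_measure borel_measurable_continuous_onI contq)
  qed (use qB in auto)
  moreover have "(LINT k|torus_measure. q n k) = 0" for n
  proof -
    have "continuous_on UNIV (\<lambda>k. v (k + h n *\<^sub>R e))"
      by (intro continuous_on_compose2[OF cont] continuous_intros) auto
    then have "(LINT k|torus_measure. q n k)
        = (1 / h n) *\<^sub>R ((LINT k|torus_measure. v (k + h n *\<^sub>R e)) - (LINT k|torus_measure. v k))"
      unfolding q_def
      by (simp only: integral_scaleR_right Bochner_Integration.integral_diff[OF integrable_torus_continuous[of "\<lambda>k. v (k + h n *\<^sub>R e)"] integrable_torus_continuous[OF cont]])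
    also have "\<dots> = 0"
      using torus_integral_shift[OF cont per, of "h n" j] h[of n] pi_gt3
      by (simp add: torus_integral_eq e_def)
    finally show ?thesis .
  qed
  ultimately show ?thesis by (simp add: LIMSEQ_const_iff)
qed

lemma has_pd_mult:
  fixes u v :: "real ^ 'd \<Rightarrow> 'a :: real_normed_algebra"
  assumes "has_pd j u u'" "has_pd j v v'"
  shows "has_pd j (\<lambda>k. u k * v k) (\<lambda>k. u k * v' k + u' k * v k)"
  using assms unfolding has_pd_def by (auto intro: has_vector_derivative_mult)

lemma has_pd_of_real:
  assumes "has_pd j u u'"
  shows "has_pd j (\<lambda>k. complex_of_real (u k)) (\<lambda>k. complex_of_real (u' k))"
  using assms unfolding has_pd_def
  by (intro allI has_vector_derivative_of_real) (simp only: has_real_derivative_iff_has_vector_derivative)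

lemma has_pd_character: "has_pd j (character x) (\<lambda>k. \<i> * real_of_int (x $ j) * character x k)"
  unfolding has_pd_def
proof (intro allI)
  fix k :: "real ^ 'a" and t :: real
  let ?a = "real_of_int (x $ j)"
  have "((\<lambda>t. cis (t * ?a) * character x k) has_vector_derivative (\<i> * ?a * cis (t * ?a)) * character x k) (at t)"
  proof -
    have "((\<lambda>z. exp (\<i> * (z * ?a)) * character x k) has_field_derivative (\<i> * ?a * exp (\<i> * (t * ?a))) * character x k) (at (complex_of_real t))"
      by (auto intro!: derivative_eq_intros)
    from has_vector_derivative_real_field[OF this] show ?thesis
      by (simp add: cis_conv_exp)
  qed
  then show "((\<lambda>t. character x (k + t *\<^sub>R axis j 1)) has_vector_derivative
      \<i> * ?a * character x (k + t *\<^sub>R axis j 1)) (at t)"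
    unfolding character_shift by (simp only: mult.assoc)
qed

lemma torus_periodic_mult:
  fixes u v :: "real ^ 'd \<Rightarrow> 'a :: times"
  shows "torus_periodic u \<Longrightarrow> torus_periodic v \<Longrightarrow> torus_periodic (\<lambda>k. u k * v k)"
  by (simp add: torus_periodic_def)

text \<open>Integration by parts: the derivative of the periodic product of
  \<open>character (- x)\<close> and \<open>u\<close> has integral 0, and the product rule splits it
  into the two sides.\<close>

lemma fourier_integral_pd:
  fixes u :: "real ^ 'd \<Rightarrow> real"
  assumes cont: "continuous_on UNIV u" and per: "torus_periodic u"
    and cont': "continuous_on UNIV u'" and pd: "has_pd j u u'"
  shows "fourier_integral (\<lambda>k. complex_of_real (u' k)) x
    = \<i> * real_of_int (x $ j) * fourier_integral (\<lambda>k. complex_of_real (u k)) x"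
proof -
  define v where "v k = character (- x) k * complex_of_real (u k)" for k
  define v' where "v' k = character (- x) k * complex_of_real (u' k) + (\<i> * real_of_int ((- x) $ j) * character (- x) k) * complex_of_real (u k)" for k
  have "(LINT k|torus_measure. v' k) = 0"
  proof (rule integral_pd_eq_0)
    show "has_pd j v v'"
      unfolding v_def v'_def by (intro has_pd_mult has_pd_character has_pd_of_real pd)
    show "torus_periodic v"
      unfolding v_def using torus_periodic_character[of "- x"] per by (simp add: torus_periodic_def)
  qed (auto simp: v_def v'_def intro!: continuous_intros cont cont')
  moreover have "integrable torus_measure (\<lambda>k. character (- x) k * complex_of_real (u' k))"
      "integrable torus_measure (\<lambda>k. character (- x) k * complex_of_real (u k))"
    by (intro integrable_torus_continuous continuous_intros cont cont')+
  ultimately have "(LINT k|torus_measure. character (- x) k * complex_of_real (u' k))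
      = \<i> * real_of_int (x $ j) * (LINT k|torus_measure. character (- x) k * complex_of_real (u k))"
    by (simp add: v'_def mult.assoc add_eq_0_iff)
  then show ?thesis
    by (simp add: fourier_integral_eq)
qed

section \<open>Monotone convergence for series and integrable powers of the norm\<close>

lemma integrals_summable:
  fixes f :: "nat \<Rightarrow> 'a \<Rightarrow> real"
  assumes int: "\<And>j. integrable M (f j)" and nn: "\<And>j x. 0 \<le> f j x"
    and sum: "summable (\<lambda>j. LINT x|M. f j x)"
  shows "AE x in M. summable (\<lambda>j. f j x)"
    and "integrable M (\<lambda>x. \<Sum>j. f j x)"
proof -
  have [measurable]: "f j \<in> borel_measurable M" for j using int by auto
  have "(\<integral>\<^sup>+x. (\<Sum>j. ennreal (f j x)) \<partial>M) = (\<Sum>j. \<integral>\<^sup>+x. ennreal (f j x) \<partial>M)"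
    by (rule nn_integral_suminf) measurable
  also have "\<dots> = (\<Sum>j. ennreal (LINT x|M. f j x))"
    using int nn by (simp add: nn_integral_eq_integral)
  also have "\<dots> \<noteq> \<infinity>"
    using sum nn by (subst suminf_ennreal2) (auto intro: integral_nonneg_AE)
  finally have "AE x in M. (\<Sum>j. ennreal (f j x)) \<noteq> \<infinity>"
    by (intro nn_integral_PInf_AE) auto
  then show ae: "AE x in M. summable (\<lambda>j. f j x)"
    by eventually_elim (use nn in \<open>auto intro: summable_suminf_not_top\<close>)
  show "integrable M (\<lambda>x. \<Sum>j. f j x)"
    using int ae sum nn by (intro integrable_suminf) auto
qed

lemma two_powr_power: "((2 :: real) powr a) ^ j = (2 ^ j) powr a"
proof -
  have "(2 :: real) ^ j = 2 powr real j" by (simp add: powr_realpow)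
  then show ?thesis by (simp only: powr_powr) (simp add: powr_power)
qed

text \<open>The singular function is dominated by a series of constants on balls of radius
  \<open>R / 2 ^ j\<close>. The \<open>j\<close>-th term has size of order
  \<open>2 ^ (D * j)\<close> on a set of measure of order \<open>2 ^ (- d * j)\<close>, so the
  integrals form a geometric series because \<open>D < d\<close>.\<close>

lemma integrable_norm_powr:
  assumes D: "D < real CARD('d)" "0 \<le> D"
  shows "integrable torus_measure (\<lambda>k :: real ^ 'd. norm k powr - D)"
proof -
  obtain b where b: "\<And>k :: real ^ 'd. k \<in> torus \<Longrightarrow> norm k \<le> b"
    using bounded_torus unfolding bounded_iff by blast
  define R where "R = max b 1"
  have R: "R > 0" "\<And>k :: real ^ 'd. k \<in> torus \<Longrightarrow> norm k \<le> R"
    using b by (auto simp: R_def le_max_iff_disj)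
  define f where "f j k = (R / 2 ^ Suc j) powr - D * indicator (cball 0 (R / 2 ^ j)) k" for j and k :: "real ^ 'd"
  define q where "q = (2 :: real) powr (D - real CARD('d))"
  have q: "0 < q" "q < 1" using D by (auto simp: q_def powr_less_one)
  have int: "integrable torus_measure (f j)" for j
  proof (rule integrable_torus_bounded[where B = "(R / 2 ^ Suc j) powr - D"])
    show "f j \<in> borel_measurable torus_measure"
      unfolding f_def by (intro measurable_torus_measure borel_measurable_times borel_measurable_indicator) auto
  qed (auto simp: f_def indicator_def)
  define C where "C = (R / 2) powr - D * (unit_ball_vol (real CARD('d)) * R ^ CARD('d))"
  have f_le: "(LINT k|torus_measure. f j k) \<le> C * q ^ j" for j
  proof -
    have "(LINT k|torus_measure. indicat_real (cball (0 :: real ^ 'd) (R / 2 ^ j)) k) \<le> measure lborel (cball (0 :: real ^ 'd) (R / 2 ^ j))"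
    proof -
      have "(LINT k|torus_measure. indicat_real (cball (0 :: real ^ 'd) (R / 2 ^ j)) k)
          = measure lborel (torus \<inter> cball (0 :: real ^ 'd) (R / 2 ^ j))"
      proof -
        have "(LINT k|torus_measure. indicat_real (cball (0 :: real ^ 'd) (R / 2 ^ j)) k)
            = measure torus_measure (cball (0 :: real ^ 'd) (R / 2 ^ j) \<inter> torus)"
          by simp
        also have "\<dots> = measure lborel (cball (0 :: real ^ 'd) (R / 2 ^ j) \<inter> torus)"
          unfolding torus_measure_def by (rule measure_restrict_space) auto
        finally show ?thesis by (simp only: Int_commute)
      qed
      also have "\<dots> \<le> measure lborel (cball (0 :: real ^ 'd) (R / 2 ^ j))"
        by (intro measure_mono_fmeasurable) (auto intro: fmeasurable_compact)
      finally show ?thesis .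
    qed
    also have "\<dots> = unit_ball_vol (real CARD('d)) * (R / 2 ^ j) ^ CARD('d)"
      using R by (subst content_cball) auto
    finally have "(LINT k|torus_measure. f j k) \<le> (R / 2 ^ Suc j) powr - D * (unit_ball_vol (real CARD('d)) * (R / 2 ^ j) ^ CARD('d))"
      unfolding f_def by (simp add: mult_left_mono)
    also have "(R / 2 ^ Suc j) powr - D = (R / 2) powr - D * (2 powr D) ^ j"
    proof -
      have "(R / 2 ^ Suc j) powr - D = (R / 2) powr - D / (2 ^ j) powr - D"
        using R by (simp add: powr_divide[symmetric] mult.commute)
      also have "(2 ^ j :: real) powr - D = inverse ((2 powr D) ^ j)"
        by (subst powr_minus) (simp only: two_powr_power)
      finally show ?thesis by (simp only: divide_inverse inverse_inverse_eq)
    qed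
    also have "(R / 2 ^ j) ^ CARD('d) = R ^ CARD('d) * (2 powr - real CARD('d)) ^ j"
      unfolding two_powr_power by (subst powr_minus) (simp add: power_divide powr_realpow inverse_eq_divide)
    also have "(R / 2) powr - D * (2 powr D) ^ j * (unit_ball_vol (real CARD('d)) * (R ^ CARD('d) * (2 powr - real CARD('d)) ^ j))
        = C * q ^ j"
      unfolding C_def q_def diff_conv_add_uminus powr_add power_mult_distrib by (simp only: mult_ac)
    finally show ?thesis .
  qed
  have f0: "0 \<le> f j k" for j k by (auto simp: f_def)
  have sum: "summable (\<lambda>j. LINT k|torus_measure. f j k)"
  proof (rule summable_comparison_test)
    show "summable (\<lambda>j. C * q ^ j)" using q by (intro summable_mult summable_geometric) auto
    show "\<exists>N. \<forall>j\<ge>N. norm (LINT k|torus_measure. f j k) \<le> C * q ^ j"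
      using f_le f0 by (auto simp: integral_nonneg_AE)
  qed
  have ae: "AE k in torus_measure. summable (\<lambda>j. f j k)"
    by (rule integrals_summable(1)[OF int f0 sum])
  show ?thesis
  proof (rule Bochner_Integration.integrable_bound[OF integrals_summable(2)[OF int f0 sum]])
    show "AE k in torus_measure. norm (norm k powr - D) \<le> norm (\<Sum>j. f j k)"
      using ae AE_space
    proof eventually_elim
      case (elim k)
      show ?case
      \<comment> \<open>At the origin the convention \<open>0 powr - D = 0\<close> makes the bound
        trivial.\<close>
      proof (cases "k = 0")
        case False
        define r where "r = norm k / R"
        have r: "0 < r" "r \<le> 1" using False R elim by (auto simp: r_def)
        \<comment> \<open>The predecessor \<open>m\<close> of this least index locates
          \<open>k\<close> in the dyadic annulus
          \<open>R / 2 ^ Suc m < norm k \<le> R / 2 ^ m\<close>, where the single term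
          \<open>f m k\<close> suffices.\<close>
        define n where "n = (LEAST n. (1 / 2 :: real) ^ n < r)"
        have ex: "\<exists>n. (1 / 2 :: real) ^ n < r" using real_arch_pow_inv[OF r(1), of "1 / 2"] by auto
        have n: "(1 / 2 :: real) ^ n < r" unfolding n_def by (rule LeastI_ex[OF ex])
        then obtain m where m: "n = Suc m" using r by (cases n) auto
        have "\<not> (1 / 2 :: real) ^ m < r"
          using not_less_Least[of m "\<lambda>n. (1 / 2 :: real) ^ n < r"] m unfolding n_def by simp
        then have "norm k \<le> R / 2 ^ m" "R / 2 ^ Suc m < norm k"
          using n R by (auto simp: m r_def field_simps power_divide)
        then have "norm k powr - D \<le> f m k"
          using D R by (auto simp: f_def intro!: powr_mono2')
        also have "\<dots> \<le> (\<Sum>j. f j k)"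
          using sum_le_suminf[OF elim(1), of "{m}"] f0 by auto
        finally show ?thesis by simp
      qed simp
    qed
  qed simp
qed

section \<open>Dyadic control of derivatives of the transform\<close>

text \<open>This is the \<open>i\<close>-th derivative in direction \<open>j\<close> of the cosine
  sum of \<open>f\<close> over \<open>B\<close>: each differentiation brings down a factor
  \<open>x $ j\<close> and advances the phase by a quarter turn. The phase gives one formula for all
  orders instead of four.\<close>

definition trig :: "'d \<Rightarrow> (int ^ 'd) set \<Rightarrow> (int ^ 'd \<Rightarrow> real) \<Rightarrow> nat \<Rightarrow> real ^ 'd \<Rightarrow> real" where
  "trig j B f i k = (\<Sum>x\<in>B. f x * real_of_int (x $ j) ^ i * cos (k \<bullet> lvec x + real i * (pi / 2)))"

lemma trig_eq_Re:
  "trig j B f i k = Re (cis (real i * (pi / 2)) * (\<Sum>x\<in>B. complex_of_real (f x * real_of_int (x $ j) ^ i) * character x k))"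
proof -
  have "Re (cis (real i * (pi / 2)) * (complex_of_real a * character x k)) = a * cos (k \<bullet> lvec x + real i * (pi / 2))" for a x
  proof -
    have "cis (real i * (pi / 2)) * (complex_of_real a * character x k)
        = complex_of_real a * cis (k \<bullet> lvec x + real i * (pi / 2))"
    proof -
      have "character x k = cis (k \<bullet> lvec x)" by (simp only: cis_conv_exp)
      then show ?thesis by (simp only: cis_mult[symmetric] mult_ac)
    qed
    then show ?thesis by (simp only: Re_complex_of_real Im_complex_of_real times_complex.sel cis.sel mult_zero_left diff_0_right)
  qed
  then show ?thesis
    unfolding trig_def sum_distrib_left Re_sum by simp
qed

lemma continuous_on_trig: "continuous_on A (trig j B f i)"
  unfolding trig_def by (intro continuous_intros)

lemma trig_periodic: "torus_periodic (trig j B f i)"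
  unfolding torus_periodic_def trig_eq_Re
  by (simp only: torus_periodic_character[unfolded torus_periodic_def, rule_format] simp_thms)

lemma has_pd_trig: "has_pd j (trig j B f i) (trig j B f (Suc i))"
  unfolding has_pd_def
proof (intro allI)
  fix k :: "real ^ 'a" and t :: real
  have ip: "(k + t *\<^sub>R axis j 1) \<bullet> lvec x = k \<bullet> lvec x + t * real_of_int (x $ j)" for x t
    by (simp add: inner_add_left inner_axis' lvec_def)
  have term_eq: "((\<lambda>t. f x * real_of_int (x $ j) ^ i * cos ((k + t *\<^sub>R axis j 1) \<bullet> lvec x + real i * (pi / 2))) has_real_derivative
      f x * real_of_int (x $ j) ^ Suc i * cos ((k + t *\<^sub>R axis j 1) \<bullet> lvec x + real (Suc i) * (pi / 2))) (at t)" for x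
  proof -
    have "cos (a + real (Suc i) * (pi / 2)) = - sin (a + real i * (pi / 2))" for a
    proof -
      have "a + real (Suc i) * (pi / 2) = (a + real i * (pi / 2)) + pi / 2"
        by (simp add: field_simps)
      then show ?thesis by (simp only: cos_add) simp
    qed
    then show ?thesis
      unfolding ip by (auto intro!: derivative_eq_intros)
  qed
  show "((\<lambda>t. trig j B f i (k + t *\<^sub>R axis j 1)) has_vector_derivative trig j B f (Suc i) (k + t *\<^sub>R axis j 1)) (at t)"
    unfolding trig_def has_real_derivative_iff_has_vector_derivative[symmetric]
    by (intro DERIV_sum term_eq)
qed

lemma trig_lball: "trig j (lball N) f i k = (\<Sum>J<N. trig j (lshell J) f i k)"
  unfolding trig_def by (rule sum_lball)

lemma abs_trig_le: "\<bar>trig j B f i k\<bar> \<le> (\<Sum>x\<in>B. \<bar>f x * real_of_int (x $ j) ^ i\<bar>)"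
  unfolding trig_def
  by (intro order_trans[OF sum_abs] sum_mono) (simp add: abs_mult mult_left_le)

text \<open>An inequality only, because \<open>trig\<close> is the real part of the exponential sum
  to which Parseval applies.\<close>

lemma integral_trig_square:
  assumes "finite B"
  shows "(LINT k|torus_measure. (trig j B f i (k :: real ^ 'd))\<^sup>2) \<le> (2 * pi) ^ CARD('d) * (\<Sum>x\<in>B. (f x * real_of_int (x $ j) ^ i)\<^sup>2)"
proof -
  define S where "S k = (\<Sum>x\<in>B. complex_of_real (f x * real_of_int (x $ j) ^ i) * character x k)" for k :: "real ^ 'd"
  have cont: "continuous_on UNIV S" unfolding S_def by (intro continuous_intros)
  have le: "(trig j B f i k)\<^sup>2 \<le> (cmod (S k))\<^sup>2" for k
  proof -
    have "\<bar>trig j B f i k\<bar> \<le> cmod (S k)"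
      unfolding trig_eq_Re S_def[symmetric]
      using abs_Re_le_cmod[of "cis (real i * (pi / 2)) * S k"] by (simp add: norm_mult)
    then show ?thesis by (metis abs_le_square_iff abs_norm_cancel)
  qed
  have "(LINT k|torus_measure. (trig j B f i k)\<^sup>2) \<le> (LINT k|torus_measure. (cmod (S k))\<^sup>2)"
    by (intro integral_mono integrable_torus_continuous continuous_intros continuous_on_trig cont le)
  also have "\<dots> = (2 * pi) ^ CARD('d) * (\<Sum>x\<in>B. (cmod (complex_of_real (f x * real_of_int (x $ j) ^ i)))\<^sup>2)"
    unfolding S_def by (rule integral_trig_poly_square[OF assms])
  finally show ?thesis by (simp only: norm_of_real power2_abs)
qed

text \<open>Normalise to \<open>z = y / (C * t powr b)\<close>, so that
  \<open>0 \<le> z \<le> 1\<close> and \<open>z^2 * t powr D \<le> U\<close>. With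
  \<open>e = max a 0\<close>, the condition \<open>2 * e \<le> D\<close> gives
  \<open>z \<le> z powr (2 * e / D)\<close>, hence
  \<open>z * t powr e \<le> (1 + U) powr (e / D)\<close>. It is applied with \<open>t\<close> a
  dyadic scale, \<open>b\<close> the exponent of the supremum bound on the shell and
  \<open>a\<close> slightly larger than \<open>b\<close>; the remaining factor
  \<open>t powr (b - a)\<close> is what makes the shells summable.\<close>

lemma interpolation_bound:
  fixes t C y U a b D :: real
  assumes t: "1 \<le> t" and C: "1 \<le> C" and y: "0 \<le> y" "y \<le> C * t powr b"
    and U: "t powr (D - 2 * b) * y\<^sup>2 \<le> U" and D: "0 < D" "2 * max a 0 \<le> D"
  shows "y \<le> C * (1 + U) powr (max a 0 / D) * t powr (b - a)"
proof -
  define e where "e = max a 0"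
  define z where "z = y / (C * t powr b)"
  have U0: "0 \<le> U" by (rule order_trans[OF _ U]) simp
  have pos: "0 < C * t powr b" using t C by simp
  have z: "0 \<le> z" "z \<le> 1" "y = C * t powr b * z"
    using y pos by (auto simp: z_def divide_simps)
  have zU: "z\<^sup>2 * t powr D \<le> U"
  proof -
    have "t powr (D - 2 * b) * y\<^sup>2 = C\<^sup>2 * (z\<^sup>2 * t powr D)"
    proof -
      have "t powr D = t powr (D - 2 * b) * (t powr b)\<^sup>2"
        using t by (simp add: power2_eq_square flip: powr_add)
      then show ?thesis unfolding z(3) by (simp add: power_mult_distrib mult_ac)
    qed
    moreover have "1 * (z\<^sup>2 * t powr D) \<le> C\<^sup>2 * (z\<^sup>2 * t powr D)"
      using C by (intro mult_right_mono) (auto simp: one_le_power)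
    ultimately show ?thesis using U by linarith
  qed
  have "z * t powr e \<le> (1 + U) powr (e / D)"
  proof (cases "e = 0 \<or> z = 0")
    case True
    then show ?thesis using z U0 t by auto
  next
    case False
    then have e: "0 < e" and z0: "0 < z" using z by (auto simp: e_def)
    have "z powr 1 \<le> z powr (2 * (e / D))"
      using z z0 D by (intro powr_mono') (auto simp: e_def field_simps)
    also have "\<dots> = (z\<^sup>2) powr (e / D)"
      using z0 by (simp add: powr_powr flip: powr_numeral)
    finally have "z * t powr e \<le> (z\<^sup>2) powr (e / D) * (t powr D) powr (e / D)"
      using z0 D by (simp add: powr_powr mult_right_mono)
    also have "\<dots> = (z\<^sup>2 * t powr D) powr (e / D)"
      by (simp add: powr_mult)
    also have "\<dots> \<le> (1 + U) powr (e / D)"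
      using zU U0 e D by (intro powr_mono2) auto
    finally show ?thesis .
  qed
  moreover have "t powr b * z \<le> t powr (b - a) * (z * t powr e)"
  proof -
    have "t powr b = t powr (b - a) * t powr a" using t by (simp flip: powr_add)
    also have "\<dots> \<le> t powr (b - a) * t powr e"
      using t by (intro mult_left_mono powr_mono) (auto simp: e_def)
    finally have "t powr b * z \<le> t powr (b - a) * t powr e * z" using z by (intro mult_right_mono)
    then show ?thesis by (simp only: mult_ac)
  qed
  ultimately have "t powr b * z \<le> t powr (b - a) * (1 + U) powr (e / D)"
    using mult_left_mono[of "z * t powr e" "(1 + U) powr (e / D)" "t powr (b - a)", OF _ powr_ge_zero]
    by (blast intro: order_trans)
  then have "C * (t powr b * z) \<le> C * (t powr (b - a) * (1 + U) powr (e / D))"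
    using C by (intro mult_left_mono) auto
  then show ?thesis unfolding e_def[symmetric] z(3) by (simp only: mult_ac)
qed

text \<open>Interpolating, scale by scale, between the supremum bound and the Parseval bound for a dyadic
  shell dominates every derivative of the transform by a power of a single integrable function;
  this replaces the Hausdorff--Young inequality.\<close>

lemma dyadic_control:
  fixes F :: "int ^ 'd \<Rightarrow> real" and j :: 'd
  assumes decay: "decays (real CARD('d) + 2 + \<rho>) F" and \<sigma>: "\<sigma> < \<rho>" and \<rho>: "0 \<le> \<rho>"
    and D: "0 < D" "D < real CARD('d)" "2 * (real n - 2 - \<sigma>) \<le> D"
  obtains U C where "integrable torus_measure U" "\<And>k. 0 \<le> U k"
    "AE k in torus_measure. \<forall>i\<le>n. convergent (\<lambda>N. trig j (lball N) F i k) \<and>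
       (\<forall>N. \<bar>trig j (lball N) F i k\<bar> \<le> C * (1 + U k) powr (max (real i - 2 - \<sigma>) 0 / D))"
proof -
  let ?d = "real CARD('d)"
  obtain K0 where K0: "\<And>x. \<bar>F x\<bar> \<le> K0 * lnorm x powr - (?d + 2 + \<rho>)"
    using decay unfolding decays_def by blast
  define K where "K = max K0 0"
  have K: "0 \<le> K" "\<And>x. \<bar>F x\<bar> \<le> K * lnorm x powr - (?d + 2 + \<rho>)"
  proof -
    show "0 \<le> K" by (simp add: K_def)
    show "\<bar>F x\<bar> \<le> K * lnorm x powr - (?d + 2 + \<rho>)" for x
      by (rule order_trans[OF K0 mult_right_mono]) (auto simp: K_def)
  qed
  have point: "\<bar>F x * real_of_int (x $ j) ^ i\<bar> \<le> K * 2 ^ n * (2 ^ J) powr (real i - ?d - 2 - \<rho>)"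
    if x: "x \<in> lshell J" and i: "i \<le> n" for x J i
  proof -
    have "\<bar>F x\<bar> \<le> K * (2 ^ J) powr - (?d + 2 + \<rho>)"
      using K(2)[of x] lnorm_lshell_powr[OF x, of "?d + 2 + \<rho>"] \<rho> K(1)
      by (meson add_nonneg_nonneg mult_left_mono of_nat_0_le_iff order_trans zero_le_numeral)
    moreover have "\<bar>real_of_int (x $ j)\<bar> ^ i \<le> (2 * 2 ^ J) ^ i"
      using abs_component_le_lnorm[of x j] x by (intro power_mono) (auto simp: lshell_def)
    ultimately have "\<bar>F x * real_of_int (x $ j) ^ i\<bar> \<le> K * (2 ^ J) powr - (?d + 2 + \<rho>) * (2 * 2 ^ J) ^ i"
      unfolding abs_mult power_abs by (intro mult_mono) (auto simp: K(1))
    also have "\<dots> = K * 2 ^ i * ((2 ^ J) powr - (?d + 2 + \<rho>) * (2 ^ J) powr real i)"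
      by (simp add: power_mult_distrib powr_realpow)
    also have "(2 ^ J) powr - (?d + 2 + \<rho>) * (2 ^ J) powr real i = ((2 :: real) ^ J) powr (real i - ?d - 2 - \<rho>)"
      unfolding powr_add[symmetric] by (simp add: algebra_simps)
    also have "K * 2 ^ i * (2 ^ J) powr (real i - ?d - 2 - \<rho>) \<le> K * 2 ^ n * (2 ^ J) powr (real i - ?d - 2 - \<rho>)"
      using K(1) i by (intro mult_right_mono mult_left_mono power_increasing) auto
    finally show ?thesis .
  qed
  \<comment> \<open>The maximum with 1 serves the hypothesis \<open>1 \<le> C\<close> of
    \<open>interpolation_bound\<close>.\<close>
  define C1 where "C1 = max (5 ^ CARD('d) * (K * 2 ^ n)) 1"
  have card: "real (card (lshell J :: (int ^ 'd) set)) \<le> 5 ^ CARD('d) * (2 ^ J) powr ?d" for J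
    using card_lshell[where 'd = 'd, of J] by (simp add: power_mult_distrib powr_realpow)
  have sup: "\<bar>trig j (lshell J) F i k\<bar> \<le> C1 * (2 ^ J) powr (real i - 2 - \<rho>)" if i: "i \<le> n" for J i k
  proof -
    have "\<bar>trig j (lshell J) F i k\<bar> \<le> real (card (lshell J :: (int ^ 'd) set)) * (K * 2 ^ n * (2 ^ J) powr (real i - ?d - 2 - \<rho>))"
      using point[OF _ i] by (intro order_trans[OF abs_trig_le] sum_bounded_above)
    also have "\<dots> \<le> 5 ^ CARD('d) * (2 ^ J) powr ?d * (K * 2 ^ n * (2 ^ J) powr (real i - ?d - 2 - \<rho>))"
      using K(1) by (intro mult_right_mono card) auto
    also have "\<dots> = 5 ^ CARD('d) * (K * 2 ^ n) * ((2 ^ J) powr ?d * (2 ^ J) powr (real i - ?d - 2 - \<rho>))"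
      by (simp only: mult_ac)
    also have "(2 ^ J) powr ?d * (2 ^ J) powr (real i - ?d - 2 - \<rho>) = ((2 :: real) ^ J) powr (real i - 2 - \<rho>)"
      unfolding powr_add[symmetric] by (simp add: algebra_simps)
    also have "5 ^ CARD('d) * (K * 2 ^ n) * (2 ^ J) powr (real i - 2 - \<rho>) \<le> C1 * (2 ^ J) powr (real i - 2 - \<rho>)"
      by (intro mult_right_mono) (auto simp: C1_def)
    finally show ?thesis .
  qed
  define C2 where "C2 = (2 * pi) ^ CARD('d) * (5 ^ CARD('d) * (K * 2 ^ n)\<^sup>2)"
  have parseval: "(LINT k|torus_measure. (trig j (lshell J) F i k)\<^sup>2) \<le> C2 * (2 ^ J) powr (2 * (real i - 2 - \<rho>) - ?d)"
    if i: "i \<le> n" for J i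
  proof -
    have "(\<Sum>x\<in>lshell J. (F x * real_of_int (x $ j) ^ i)\<^sup>2)
        \<le> real (card (lshell J :: (int ^ 'd) set)) * (K * 2 ^ n * (2 ^ J) powr (real i - ?d - 2 - \<rho>))\<^sup>2"
    proof (rule sum_bounded_above)
      fix x :: "int ^ 'd" assume "x \<in> lshell J"
      from power_mono[OF point[OF this i] abs_ge_zero, of 2]
      show "(F x * real_of_int (x $ j) ^ i)\<^sup>2 \<le> (K * 2 ^ n * (2 ^ J) powr (real i - ?d - 2 - \<rho>))\<^sup>2"
        by (simp only: power2_abs)
    qed
    also have "\<dots> \<le> 5 ^ CARD('d) * (2 ^ J) powr ?d * (K * 2 ^ n * (2 ^ J) powr (real i - ?d - 2 - \<rho>))\<^sup>2"
      by (intro mult_right_mono card) auto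
    also have "\<dots> = 5 ^ CARD('d) * (K * 2 ^ n)\<^sup>2 * ((2 ^ J) powr ?d * ((2 ^ J) powr (real i - ?d - 2 - \<rho>) * (2 ^ J) powr (real i - ?d - 2 - \<rho>)))"
      by (simp only: power2_eq_square mult_ac)
    also have "(2 ^ J) powr ?d * ((2 ^ J) powr (real i - ?d - 2 - \<rho>) * (2 ^ J) powr (real i - ?d - 2 - \<rho>))
        = ((2 :: real) ^ J) powr (2 * (real i - 2 - \<rho>) - ?d)"
      unfolding powr_add[symmetric] by (simp add: algebra_simps)
    finally have "(\<Sum>x\<in>lshell J. (F x * real_of_int (x $ j) ^ i)\<^sup>2)
        \<le> 5 ^ CARD('d) * (K * 2 ^ n)\<^sup>2 * (2 ^ J) powr (2 * (real i - 2 - \<rho>) - ?d)" .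
    then have "(2 * pi) ^ CARD('d) * (\<Sum>x\<in>lshell J. (F x * real_of_int (x $ j) ^ i)\<^sup>2)
        \<le> (2 * pi) ^ CARD('d) * (5 ^ CARD('d) * (K * 2 ^ n)\<^sup>2 * (2 ^ J) powr (2 * (real i - 2 - \<rho>) - ?d))"
      by (intro mult_left_mono) auto
    then show ?thesis
      using integral_trig_square[OF finite_lshell[of J], where j = j and f = F and i = i] unfolding C2_def by (simp only: mult.assoc)
  qed
  \<comment> \<open>The weights turn the Parseval bound of every order into the same
    \<open>(2 ^ J) powr (D - d)\<close>, which is summable over the shells since
    \<open>D < d\<close>. Summing over \<open>i \<le> n\<close> lets one function \<open>U\<close>
    serve all orders.\<close>
  define f where "f J k = (\<Sum>i\<le>n. (2 ^ J) powr (D - 2 * (real i - 2 - \<rho>)) * (trig j (lshell J) F i k)\<^sup>2)" for J k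
  have f0: "0 \<le> f J k" for J k
    unfolding f_def by (intro sum_nonneg) auto
  have trig_int: "integrable torus_measure (\<lambda>k. c * (trig j (lshell J) F i k)\<^sup>2)" for J i c
    by (intro integrable_torus_continuous continuous_intros continuous_on_trig)
  have int: "integrable torus_measure (f J)" for J
    unfolding f_def by (intro Bochner_Integration.integrable_sum trig_int)
  define q where "q = (2 :: real) powr (D - ?d)"
  have q: "0 < q" "q < 1" using D by (auto simp: q_def powr_less_one)
  have f_le: "(LINT k|torus_measure. f J k) \<le> (real n + 1) * C2 * q ^ J" for J
  proof -
    have "(LINT k|torus_measure. f J k) = (\<Sum>i\<le>n. (2 ^ J) powr (D - 2 * (real i - 2 - \<rho>)) * (LINT k|torus_measure. (trig j (lshell J) F i k)\<^sup>2))"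
      unfolding f_def by (simp only: Bochner_Integration.integral_sum[OF trig_int] integral_mult_right_zero)
    also have "\<dots> \<le> (\<Sum>i\<le>n. C2 * q ^ J)"
    proof (rule sum_mono)
      fix i assume "i \<in> {..n}"
      then have "(2 ^ J) powr (D - 2 * (real i - 2 - \<rho>)) * (LINT k|torus_measure. (trig j (lshell J) F i k)\<^sup>2)
          \<le> (2 ^ J) powr (D - 2 * (real i - 2 - \<rho>)) * (C2 * (2 ^ J) powr (2 * (real i - 2 - \<rho>) - ?d))"
        using parseval by (intro mult_left_mono) auto
      also have "\<dots> = C2 * ((2 ^ J) powr (D - 2 * (real i - 2 - \<rho>)) * (2 ^ J) powr (2 * (real i - 2 - \<rho>) - ?d))"
        by (simp only: mult_ac)
      also have "\<dots> = C2 * q ^ J"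
        unfolding powr_add[symmetric] q_def two_powr_power by simp
      finally show "(2 ^ J) powr (D - 2 * (real i - 2 - \<rho>)) * (LINT k|torus_measure. (trig j (lshell J) F i k)\<^sup>2) \<le> C2 * q ^ J" .
    qed
    also have "\<dots> = (real n + 1) * C2 * q ^ J" by simp
    finally show ?thesis .
  qed
  have summ: "summable (\<lambda>J. LINT k|torus_measure. f J k)"
  proof (rule summable_comparison_test)
    show "summable (\<lambda>J. (real n + 1) * C2 * q ^ J)" using q by (intro summable_mult summable_geometric) auto
    show "\<exists>N. \<forall>J\<ge>N. norm (LINT k|torus_measure. f J k) \<le> (real n + 1) * C2 * q ^ J"
      using f_le f0 by (auto simp: integral_nonneg_AE)
  qed
  \<comment> \<open>The absolute value makes \<open>U\<close> nonnegative everywhere, also on the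
    null set where the series may diverge and its value is unspecified.\<close>
  define U where "U k = \<bar>\<Sum>J. f J k\<bar>" for k
  \<comment> \<open>This ratio is the gain \<open>t powr (b - a)\<close> of the interpolation at
    \<open>t = 2\<close>: the gap between \<open>\<sigma>\<close> and \<open>\<rho>\<close> pays for
    the summation over shells.\<close>
  define q2 where "q2 = (2 :: real) powr (\<sigma> - \<rho>)"
  have q2: "0 < q2" "q2 < 1" using \<sigma> by (auto simp: q2_def powr_less_one)
  define C where "C = C1 * (1 / (1 - q2))"
  show ?thesis
  proof
    show "integrable torus_measure U"
      unfolding U_def by (intro integrable_abs integrals_summable(2)[OF int f0 summ])
    show "0 \<le> U k" for k by (simp add: U_def)
    show "AE k in torus_measure. \<forall>i\<le>n. convergent (\<lambda>N. trig j (lball N) F i k) \<and>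
       (\<forall>N. \<bar>trig j (lball N) F i k\<bar> \<le> C * (1 + U k) powr (max (real i - 2 - \<sigma>) 0 / D))"
      using integrals_summable(1)[OF int f0 summ]
    proof eventually_elim
      case (elim k)
      show ?case
      proof (intro allI impI)
        fix i assume i: "i \<le> n"
        define V where "V = (1 + U k) powr (max (real i - 2 - \<sigma>) 0 / D)"
        have bound: "\<bar>trig j (lshell J) F i k\<bar> \<le> C1 * V * q2 ^ J" for J
        proof -
          have "(2 ^ J) powr (D - 2 * (real i - 2 - \<rho>)) * (trig j (lshell J) F i k)\<^sup>2 \<le> f J k"
            unfolding f_def using i by (intro member_le_sum) auto
          also have "\<dots> \<le> U k"
            unfolding U_def using sum_le_suminf[OF elim, of "{J}"] f0 by auto
          finally have "\<bar>trig j (lshell J) F i k\<bar>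
              \<le> C1 * (1 + U k) powr (max (real i - 2 - \<sigma>) 0 / D) * (2 ^ J) powr ((real i - 2 - \<rho>) - (real i - 2 - \<sigma>))"
            using i D sup[OF i]
            by (intro interpolation_bound) (auto simp: C1_def max_def)
          then show ?thesis
            by (simp add: V_def q2_def two_powr_power)
        qed
        have geo: "summable (\<lambda>J. C1 * V * q2 ^ J)"
          using q2 by (intro summable_mult summable_geometric) auto
        have "summable (\<lambda>J. trig j (lshell J) F i k)"
          using bound by (intro summable_comparison_test[OF _ geo]) auto
        then have "convergent (\<lambda>N. trig j (lball N) F i k)"
          unfolding trig_lball summable_iff_convergent .
        moreover have "\<bar>trig j (lball N) F i k\<bar> \<le> C * V" for N
        proof -
          have "\<bar>trig j (lball N) F i k\<bar> \<le> (\<Sum>J<N. C1 * V * q2 ^ J)"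
            unfolding trig_lball by (intro order_trans[OF sum_abs] sum_mono bound)
          also have "\<dots> \<le> C1 * V * (1 / (1 - q2))"
            unfolding sum_distrib_left[symmetric]
            using q2 by (intro mult_left_mono) (auto simp: sum_gp_strict divide_right_mono C1_def V_def)
          finally show ?thesis by (simp only: C_def mult_ac)
        qed
        ultimately show "convergent (\<lambda>N. trig j (lball N) F i k) \<and>
            (\<forall>N. \<bar>trig j (lball N) F i k\<bar> \<le> C * (1 + U k) powr (max (real i - 2 - \<sigma>) 0 / D))"
          unfolding V_def by blast
      qed
    qed
  qed
qed

section \<open>Families with controlled derivatives\<close>

text \<open>Continuity and periodicity are global because integration by parts over the torus needs
  them. Size and convergence are asked on \<open>S\<close> only, which will be a set of full
  measure: the dyadic bounds hold merely almost everywhere.\<close>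

definition ctrl0 :: "(real ^ 'd) set \<Rightarrow> (real ^ 'd \<Rightarrow> real) \<Rightarrow> (nat \<Rightarrow> real ^ 'd \<Rightarrow> real) \<Rightarrow> bool" where
  "ctrl0 S w u \<longleftrightarrow> (\<forall>N. continuous_on UNIV (u N) \<and> torus_periodic (u N)) \<and>
     (\<exists>C. \<forall>N. \<forall>k\<in>S. \<bar>u N k\<bar> \<le> C * w k) \<and> (\<forall>k\<in>S. convergent (\<lambda>N. u N k))"

text \<open>\<open>u\<close> is a sequence of functions (indexed by the truncation level): uniformly in the sequence, the
  \<open>m\<close>-th derivative in direction \<open>j\<close> is \<open>O(V\<^sup>m w)\<close> on \<open>S\<close> for \<open>m \<le> n\<close>, and converges pointwise there.
  The recursive form makes products and reciprocals provable without the Leibniz formula.\<close>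

primrec ctrl :: "'d \<Rightarrow> (real ^ 'd) set \<Rightarrow> (real ^ 'd \<Rightarrow> real) \<Rightarrow> nat \<Rightarrow>
    (real ^ 'd \<Rightarrow> real) \<Rightarrow> (nat \<Rightarrow> real ^ 'd \<Rightarrow> real) \<Rightarrow> bool" where
  "ctrl j S V 0 w u = ctrl0 S w u"
| "ctrl j S V (Suc n) w u = (ctrl0 S w u \<and>
     (\<exists>u'. (\<forall>N. has_pd j (u N) (u' N)) \<and> ctrl j S V n (\<lambda>k. V k * w k) u'))"

lemma ctrl_imp_ctrl0: "ctrl j S V n w u \<Longrightarrow> ctrl0 S w u"
  by (cases n) auto

lemma ctrl_SucD: "ctrl j S V (Suc n) w u \<Longrightarrow> ctrl j S V n w u"
proof (induction n arbitrary: w u)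
  case (Suc n)
  obtain u' where "\<forall>N. has_pd j (u N) (u' N)" "ctrl j S V (Suc n) (\<lambda>k. V k * w k) u'"
    using Suc.prems by (auto simp del: ctrl.simps(2) simp: ctrl.simps(2)[of _ _ _ "Suc n"])
  then show ?case
    using Suc.IH ctrl_imp_ctrl0[OF Suc.prems] by (subst ctrl.simps(2)) blast
qed auto

lemma ctrl_antimono:
  assumes "ctrl j S V n w u" "m \<le> n"
  shows "ctrl j S V m w u"
proof -
  have "ctrl j S V (m + l) w u \<Longrightarrow> ctrl j S V m w u" for l
    by (induction l) (auto simp del: ctrl.simps dest: ctrl_SucD)
  then show ?thesis using assms le_Suc_ex by blast
qed

lemma ctrl_cong:
  assumes "ctrl j S V n w u" "\<And>k. k \<in> S \<Longrightarrow> w k = w' k"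
  shows "ctrl j S V n w' u"
  using assms
proof (induction n arbitrary: w w' u)
  case (Suc n)
  obtain u' where u': "\<forall>N. has_pd j (u N) (u' N)" "ctrl j S V n (\<lambda>k. V k * w k) u'"
    using Suc.prems(1) by auto
  have "ctrl j S V n (\<lambda>k. V k * w' k) u'"
    using Suc.IH[OF u'(2)] Suc.prems(2) by simp
  moreover have "ctrl0 S w' u"
    using ctrl_imp_ctrl0[OF Suc.prems(1)] Suc.prems(2) by (simp add: ctrl0_def)
  ultimately show ?case using u'(1) by auto
qed (auto simp: ctrl0_def)

section \<open>Closure of controlled families under sums, products and reciprocals\<close>

lemma ctrl0_add:
  assumes "ctrl0 S w u" "ctrl0 S w v"
  shows "ctrl0 S w (\<lambda>N k. u N k + v N k)"
proof -
  obtain C C' where C: "\<And>N k. k \<in> S \<Longrightarrow> \<bar>u N k\<bar> \<le> C * w k" "\<And>N k. k \<in> S \<Longrightarrow> \<bar>v N k\<bar> \<le> C' * w k"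
    using assms unfolding ctrl0_def by blast
  have "\<bar>u N k + v N k\<bar> \<le> (C + C') * w k" if "k \<in> S" for N k
    using C[OF that, of N] by (simp add: distrib_right)
  then show ?thesis
    using assms unfolding ctrl0_def
    by (auto intro!: continuous_on_add convergent_add simp: torus_periodic_def)
qed

lemma ctrl0_mult:
  assumes "ctrl0 S w u" "ctrl0 S z v"
  shows "ctrl0 S (\<lambda>k. w k * z k) (\<lambda>N k. u N k * v N k)"
proof -
  obtain C C' where C: "\<And>N k. k \<in> S \<Longrightarrow> \<bar>u N k\<bar> \<le> C * w k" "\<And>N k. k \<in> S \<Longrightarrow> \<bar>v N k\<bar> \<le> C' * z k"
    using assms unfolding ctrl0_def by blast
  have "\<bar>u N k * v N k\<bar> \<le> (C * C') * (w k * z k)" if k: "k \<in> S" for N k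
  proof -
    have "\<bar>u N k\<bar> * \<bar>v N k\<bar> \<le> (C * w k) * (C' * z k)"
      by (rule mult_mono'[OF C(1)[OF k] C(2)[OF k]]) auto
    then show ?thesis by (simp only: abs_mult mult_ac)
  qed
  then show ?thesis
    using assms unfolding ctrl0_def
    by (auto intro!: continuous_on_mult convergent_mult torus_periodic_mult)
qed

lemma has_pd_add:
  "has_pd j u u' \<Longrightarrow> has_pd j v v' \<Longrightarrow> has_pd j (\<lambda>k. u k + v k) (\<lambda>k. u' k + v' k)"
  unfolding has_pd_def by (auto intro: has_vector_derivative_add)

lemma ctrl_add:
  assumes "ctrl j S V n w u" "ctrl j S V n w v"
  shows "ctrl j S V n w (\<lambda>N k. u N k + v N k)"
  using assms
proof (induction n arbitrary: w u v)
  case (Suc n)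
  obtain u' v' where d: "\<forall>N. has_pd j (u N) (u' N)" "ctrl j S V n (\<lambda>k. V k * w k) u'"
      "\<forall>N. has_pd j (v N) (v' N)" "ctrl j S V n (\<lambda>k. V k * w k) v'"
    using Suc.prems by auto
  have "ctrl j S V n (\<lambda>k. V k * w k) (\<lambda>N k. u' N k + v' N k)"
    by (rule Suc.IH[OF d(2,4)])
  moreover have "\<forall>N. has_pd j (\<lambda>k. u N k + v N k) (\<lambda>k. u' N k + v' N k)"
    using d by (auto intro: has_pd_add)
  ultimately show ?case
    using ctrl0_add[OF Suc.prems[THEN ctrl_imp_ctrl0]] by auto
qed (auto intro: ctrl0_add)

text \<open>In each summand of the product rule exactly one of the two factors has been
  differentiated, so each carries exactly one extra \<open>V\<close> and the induction closes
  without binomial coefficients.\<close>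

lemma ctrl_mult:
  assumes "ctrl j S V n w u" "ctrl j S V n z v"
  shows "ctrl j S V n (\<lambda>k. w k * z k) (\<lambda>N k. u N k * v N k)"
  using assms
proof (induction n arbitrary: w z u v)
  case (Suc n)
  obtain u' v' where d: "\<forall>N. has_pd j (u N) (u' N)" "ctrl j S V n (\<lambda>k. V k * w k) u'"
      "\<forall>N. has_pd j (v N) (v' N)" "ctrl j S V n (\<lambda>k. V k * z k) v'"
    using Suc.prems by auto
  have "ctrl j S V n (\<lambda>k. V k * (w k * z k)) (\<lambda>N k. u N k * v' N k)"
    by (rule ctrl_cong[OF Suc.IH[OF Suc.prems(1)[THEN ctrl_SucD] d(4)]]) (simp only: mult_ac)
  moreover have "ctrl j S V n (\<lambda>k. V k * (w k * z k)) (\<lambda>N k. u' N k * v N k)"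
    by (rule ctrl_cong[OF Suc.IH[OF d(2) Suc.prems(2)[THEN ctrl_SucD]]]) (simp only: mult_ac)
  ultimately have "ctrl j S V n (\<lambda>k. V k * (w k * z k)) (\<lambda>N k. u N k * v' N k + u' N k * v N k)"
    by (rule ctrl_add)
  moreover have "\<forall>N. has_pd j (\<lambda>k. u N k * v N k) (\<lambda>k. u N k * v' N k + u' N k * v N k)"
    using d by (auto intro: has_pd_mult)
  ultimately show ?case
    using ctrl0_mult[OF Suc.prems[THEN ctrl_imp_ctrl0]]
    by (subst ctrl.simps(2)) (intro conjI exI[of _ "\<lambda>N k. u N k * v' N k + u' N k * v N k"])
qed (auto intro: ctrl0_mult)

lemma has_pd_reciprocal:
  fixes \<phi> :: "real ^ 'd \<Rightarrow> real"
  assumes "has_pd j \<phi> \<phi>'" "\<And>k. \<phi> k \<noteq> 0"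
  shows "has_pd j (\<lambda>k. 1 / \<phi> k) (\<lambda>k. - \<phi>' k * (1 / \<phi> k * (1 / \<phi> k)))"
  using assms unfolding has_pd_def has_real_derivative_iff_has_vector_derivative[symmetric]
  by (auto intro!: derivative_eq_intros)

text \<open>The derivative of \<open>1 / \<phi>\<close> is \<open>- \<phi>'\<close> times the square
  of \<open>1 / \<phi>\<close>, of weight \<open>V / w * (w * w) = V * w\<close>. Order
  \<open>m + 1\<close> thus follows from order \<open>m\<close> for the same reciprocal, by an inner
  induction. Control is asked of \<open>\<phi>'\<close> and not of \<open>\<phi>\<close>, because
  adding a positive mass keeps \<open>\<phi>\<close> from being \<open>O(1 / w)\<close> while
  leaving its derivative unchanged.\<close>

lemma ctrl_reciprocal:
  assumes \<phi>': "ctrl j S V n (\<lambda>k. V k / w k) (\<lambda>N k. - \<phi>' N k)"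
    and pd: "\<And>N. has_pd j (\<phi> N) (\<phi>' N)" and nz: "\<And>N k. \<phi> N k \<noteq> 0"
    and base: "ctrl0 S w (\<lambda>N k. 1 / \<phi> N k)" and w: "\<And>k. k \<in> S \<Longrightarrow> w k \<noteq> 0"
  shows "ctrl j S V (Suc n) w (\<lambda>N k. 1 / \<phi> N k)"
proof -
  have "m \<le> Suc n \<Longrightarrow> ctrl j S V m w (\<lambda>N k. 1 / \<phi> N k)" for m
  proof (induction m)
    case (Suc m)
    then have r: "ctrl j S V m w (\<lambda>N k. 1 / \<phi> N k)" by simp
    have "ctrl j S V m (\<lambda>k. V k / w k * (w k * w k)) (\<lambda>N k. - \<phi>' N k * (1 / \<phi> N k * (1 / \<phi> N k)))"
      using Suc.prems by (intro ctrl_mult r ctrl_antimono[OF \<phi>']) simp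
    then have "ctrl j S V m (\<lambda>k. V k * w k) (\<lambda>N k. - \<phi>' N k * (1 / \<phi> N k * (1 / \<phi> N k)))"
      by (rule ctrl_cong) (use w in simp)
    moreover have "\<forall>N. has_pd j (\<lambda>k. 1 / \<phi> N k) (\<lambda>k. - \<phi>' N k * (1 / \<phi> N k * (1 / \<phi> N k)))"
      using has_pd_reciprocal[OF pd nz] by blast
    ultimately show ?case
      using base by (subst ctrl.simps(2)) (intro conjI exI[of _ "\<lambda>N k. - \<phi>' N k * (1 / \<phi> N k * (1 / \<phi> N k))"])
  qed (simp add: base)
  then show ?thesis by blast
qed

text \<open>The way into the recursive notion for families whose successive derivatives are known by
  formula, such as \<open>trig\<close>.\<close>

lemma ctrl_of_derivatives:
  assumes "\<And>m N. continuous_on UNIV (u m N)" "\<And>m N. torus_periodic (u m N)"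
    and "\<And>m N. has_pd j (u m N) (u (Suc m) N)"
    and "\<And>m. m \<le> n \<Longrightarrow> \<exists>C. \<forall>N. \<forall>k\<in>S. \<bar>u m N k\<bar> \<le> C * (V k ^ m * w k)"
    and "\<And>m k. m \<le> n \<Longrightarrow> k \<in> S \<Longrightarrow> convergent (\<lambda>N. u m N k)"
  shows "ctrl j S V n w (u 0)"
  using assms
proof (induction n arbitrary: u w)
  case 0
  then show ?case using 0(4)[of 0] by (auto simp: ctrl0_def)
next
  case (Suc n)
  have "ctrl j S V n (\<lambda>k. V k * w k) (u (Suc 0))"
  proof (rule Suc.IH[of "\<lambda>m. u (Suc m)"])
    show "\<exists>C. \<forall>N. \<forall>k\<in>S. \<bar>u (Suc m) N k\<bar> \<le> C * (V k ^ m * (V k * w k))" if "m \<le> n" for m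
      using Suc.prems(4)[of "Suc m"] that by (simp add: mult_ac)
  qed (use Suc.prems in auto)
  moreover have "ctrl0 S w (u 0)"
    using Suc.prems(1,2) Suc.prems(4)[of 0] Suc.prems(5)[of 0] by (auto simp: ctrl0_def)
  ultimately show ?case using Suc.prems(3)[of 0] by auto
qed

text \<open>Integration by parts \<open>n\<close> times. Of the \<open>n\<close>-th derivative
  \<open>h\<close> only the control of order 0 is retained, which is all that the passage to the
  limit uses.\<close>

lemma ctrl_fourier_integral:
  assumes "ctrl j S V n w u"
  shows "\<exists>h. ctrl0 S (\<lambda>k. V k ^ n * w k) h \<and> (\<forall>N x.
    fourier_integral (\<lambda>k. complex_of_real (h N k)) x
      = (\<i> * real_of_int (x $ j)) ^ n * fourier_integral (\<lambda>k. complex_of_real (u N k)) x)"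
  using assms
proof (induction n arbitrary: w u)
  case 0
  then show ?case by auto
next
  case (Suc n)
  obtain u' where u': "\<forall>N. has_pd j (u N) (u' N)" "ctrl j S V n (\<lambda>k. V k * w k) u'"
    using Suc.prems by auto
  obtain h where h: "ctrl0 S (\<lambda>k. V k ^ n * (V k * w k)) h" "\<forall>N x.
    fourier_integral (\<lambda>k. complex_of_real (h N k)) x
      = (\<i> * real_of_int (x $ j)) ^ n * fourier_integral (\<lambda>k. complex_of_real (u' N k)) x"
    using Suc.IH[OF u'(2)] by blast
  have "fourier_integral (\<lambda>k. complex_of_real (u' N k)) x
      = \<i> * real_of_int (x $ j) * fourier_integral (\<lambda>k. complex_of_real (u N k)) x" for N x
    using ctrl_imp_ctrl0[OF Suc.prems] ctrl_imp_ctrl0[OF u'(2)] u'(1)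
    by (intro fourier_integral_pd) (auto simp: ctrl0_def)
  then have "\<forall>N x. fourier_integral (\<lambda>k. complex_of_real (h N k)) x
      = (\<i> * real_of_int (x $ j)) ^ Suc n * fourier_integral (\<lambda>k. complex_of_real (u N k)) x"
    using h(2) by (simp add: mult_ac)
  moreover have "ctrl0 S (\<lambda>k. V k ^ Suc n * w k) h"
    using h(1) by (simp add: mult_ac)
  ultimately show ?case by blast
qed

text \<open>Dominated convergence with the dominating function \<open>C * w\<close>. Where the
  sequence diverges \<open>lim\<close> has no meaning, but this can happen only off
  \<open>S\<close>, hence on a null set.\<close>

lemma ctrl0_limit:
  fixes u :: "nat \<Rightarrow> real ^ 'd \<Rightarrow> real"
  assumes u: "ctrl0 S w u" and S: "AE k in torus_measure. k \<in> S" and w: "integrable torus_measure w"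
  shows "integrable torus_measure (\<lambda>k. lim (\<lambda>N. u N k))"
    and "(\<lambda>N. fourier_integral (\<lambda>k. complex_of_real (u N k)) x)
      \<longlonglongrightarrow> fourier_integral (\<lambda>k. complex_of_real (lim (\<lambda>N. u N k))) x"
proof -
  obtain C where C: "\<And>N k. k \<in> S \<Longrightarrow> \<bar>u N k\<bar> \<le> C * w k"
    and conv: "\<And>k. k \<in> S \<Longrightarrow> convergent (\<lambda>N. u N k)"
    and cont: "\<And>N. continuous_on UNIV (u N)"
    using u unfolding ctrl0_def by blast
  have [measurable]: "u N \<in> borel_measurable borel" for N
    by (rule borel_measurable_continuous_onI[OF cont])
  have lim: "AE k in torus_measure. (\<lambda>N. u N k) \<longlonglongrightarrow> lim (\<lambda>N. u N k)"
    using S by eventually_elim (use conv in \<open>simp add: convergent_LIMSEQ_iff\<close>)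
  have lm [measurable]: "(\<lambda>k. lim (\<lambda>N. u N k)) \<in> borel_measurable borel"
    by (rule borel_measurable_lim_metric) measurable
  have Cw: "integrable torus_measure (\<lambda>k. C * w k)" using w by simp
  have bd: "AE k in torus_measure. norm (u N k) \<le> C * w k" for N
    using S by eventually_elim (use C in auto)
  show "integrable torus_measure (\<lambda>k. lim (\<lambda>N. u N k))"
    by (rule integrable_dominated_convergence[OF _ _ Cw lim bd]) auto
  have "(\<lambda>N. LINT k|torus_measure. character (- x) k * complex_of_real (u N k))
      \<longlonglongrightarrow> (LINT k|torus_measure. character (- x) k * complex_of_real (lim (\<lambda>N. u N k)))"
  proof (rule integral_dominated_convergence[OF _ _ Cw])
    show "AE k in torus_measure. (\<lambda>N. character (- x) k * complex_of_real (u N k))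
        \<longlonglongrightarrow> character (- x) k * complex_of_real (lim (\<lambda>N. u N k))"
      using lim by eventually_elim (intro tendsto_intros)
    show "AE k in torus_measure. norm (character (- x) k * complex_of_real (u N k)) \<le> C * w k" for N
      using bd[of N] by eventually_elim (simp add: norm_mult)
  qed (intro measurable_torus_measure borel_measurable_times character_measurable; measurable)+
  then show "(\<lambda>N. fourier_integral (\<lambda>k. complex_of_real (u N k)) x)
      \<longlonglongrightarrow> fourier_integral (\<lambda>k. complex_of_real (lim (\<lambda>N. u N k))) x"
    unfolding fourier_integral_eq by (intro tendsto_divide tendsto_const) auto
qed

text \<open>The limit of \<open>u\<close> need not be differentiable. Differentiation is done for
  each \<open>N\<close>, and both sides of the coefficient identity converge by
  \<open>ctrl0_limit\<close>; the integrable limit of the \<open>h N\<close> then acts as a weak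
  \<open>n\<close>-th derivative, to which Riemann-Lebesgue applies.\<close>

lemma ctrl_coordinate_decay:
  fixes u :: "nat \<Rightarrow> real ^ 'd \<Rightarrow> real"
  assumes u: "ctrl j S V n w u" and S: "AE k in torus_measure. k \<in> S"
    and w: "integrable torus_measure w" and Vw: "integrable torus_measure (\<lambda>k. V k ^ n * w k)"
  shows "((\<lambda>x. real_of_int (x $ j) ^ n * fourier_integral (\<lambda>k. complex_of_real (lim (\<lambda>N. u N k))) x) \<longlongrightarrow> 0) lattice_at_infinity"
proof -
  obtain h where h: "ctrl0 S (\<lambda>k. V k ^ n * w k) h" and hu: "\<And>N x.
    fourier_integral (\<lambda>k. complex_of_real (h N k)) x
      = (\<i> * real_of_int (x $ j)) ^ n * fourier_integral (\<lambda>k. complex_of_real (u N k)) x"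
    using ctrl_fourier_integral[OF u] by blast
  have eq: "fourier_integral (\<lambda>k. complex_of_real (lim (\<lambda>N. h N k))) x
      = (\<i> * real_of_int (x $ j)) ^ n * fourier_integral (\<lambda>k. complex_of_real (lim (\<lambda>N. u N k))) x" for x
  proof (rule LIMSEQ_unique)
    show "(\<lambda>N. fourier_integral (\<lambda>k. complex_of_real (h N k)) x)
        \<longlonglongrightarrow> fourier_integral (\<lambda>k. complex_of_real (lim (\<lambda>N. h N k))) x"
      by (rule ctrl0_limit(2)[OF h S Vw])
    show "(\<lambda>N. fourier_integral (\<lambda>k. complex_of_real (h N k)) x)
        \<longlonglongrightarrow> (\<i> * real_of_int (x $ j)) ^ n * fourier_integral (\<lambda>k. complex_of_real (lim (\<lambda>N. u N k))) x"
      unfolding hu by (intro tendsto_mult tendsto_const ctrl0_limit(2)[OF ctrl_imp_ctrl0[OF u] S w])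
  qed
  have "(fourier_integral (\<lambda>k. complex_of_real (lim (\<lambda>N. h N k))) \<longlongrightarrow> 0) lattice_at_infinity"
    by (rule Riemann_Lebesgue[OF ctrl0_limit(1)[OF h S Vw]])
  then have "((\<lambda>x. norm (fourier_integral (\<lambda>k. complex_of_real (lim (\<lambda>N. h N k))) x)) \<longlongrightarrow> 0) lattice_at_infinity"
    by (rule tendsto_norm_zero)
  then have "((\<lambda>x. norm (real_of_int (x $ j) ^ n * fourier_integral (\<lambda>k. complex_of_real (lim (\<lambda>N. u N k))) x)) \<longlongrightarrow> 0) lattice_at_infinity"
    unfolding eq by (simp add: norm_mult norm_power)
  then show ?thesis by (rule tendsto_norm_zero_cancel)
qed

text \<open>At each lattice point the largest coordinate is comparable to the norm, so pure powers
  of single coordinates suffice and mixed derivatives never enter.\<close>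

lemma smallo_of_coordinate_decay:
  fixes f :: "int ^ 'd \<Rightarrow> complex"
  assumes "\<And>j. ((\<lambda>x. real_of_int (x $ j) ^ n * f x) \<longlongrightarrow> 0) lattice_at_infinity"
  shows "f \<in> o[lattice_at_infinity](\<lambda>x. complex_of_real (1 / norm (lvec x) ^ n))"
proof (rule landau_o.smallI)
  fix c :: real assume c: "c > 0"
  \<comment> \<open>Replacing the norm by the largest coordinate costs a factor
    \<open>real CARD('d) ^ n\<close>, for which this choice leaves room.\<close>
  define e where "e = c / real CARD('d) ^ Suc n"
  have e: "e > 0" using c by (simp add: e_def)
  have "\<forall>\<^sub>F x in lattice_at_infinity. \<forall>j. norm (real_of_int (x $ j) ^ n * f x) < e"
    using tendstoD[OF assms e] by (intro eventually_all_finite) simp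
  moreover have "\<forall>\<^sub>F x in lattice_at_infinity. norm (lvec (x :: int ^ 'd)) \<ge> 1"
    unfolding eventually_lattice_at_infinity by blast
  ultimately show "\<forall>\<^sub>F x in lattice_at_infinity. norm (f x) \<le> c * norm (complex_of_real (1 / norm (lvec x) ^ n))"
  proof eventually_elim
    case (elim x)
    define m where "m = Max (range (\<lambda>j. \<bar>real_of_int (x $ j)\<bar>))"
    have m: "\<bar>real_of_int (x $ j)\<bar> \<le> m" for j
      unfolding m_def by (intro Max_ge) auto
    have "m \<in> range (\<lambda>j. \<bar>real_of_int (x $ j)\<bar>)"
      unfolding m_def by (intro Max_in) auto
    then obtain j where j: "m = \<bar>real_of_int (x $ j)\<bar>" by auto
    have "norm (lvec x) \<le> (\<Sum>i\<in>UNIV. \<bar>real_of_int (x $ i)\<bar>)"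
      using norm_le_l1_cart[of "lvec x"] by (simp add: lvec_def)
    also have "\<dots> \<le> real CARD('d) * m"
      using m by (intro order_trans[OF sum_bounded_above]) auto
    finally have "norm (lvec x) ^ n \<le> (real CARD('d) * m) ^ n"
      by (intro power_mono) auto
    then have "norm (f x) * norm (lvec x) ^ n \<le> norm (f x) * (real CARD('d) * m) ^ n"
      by (intro mult_left_mono) auto
    also have "\<dots> = real CARD('d) ^ n * norm (real_of_int (x $ j) ^ n * f x)"
      by (simp add: j norm_mult norm_power power_mult_distrib)
    also have "\<dots> \<le> real CARD('d) ^ n * e"
      using elim(1) by (intro mult_left_mono) (auto intro: less_imp_le)
    also have "\<dots> \<le> c"
      using c by (simp add: e_def divide_simps)
    finally have "norm (f x) * norm (lvec x) ^ n \<le> c" .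
    moreover have "0 < norm (lvec x) ^ n"
      using elim(2) by (intro zero_less_power) linarith
    ultimately show ?case
      by (simp add: norm_divide norm_power divide_simps)
  qed
qed

section \<open>Taylor expansion of symmetric kernels\<close>

text \<open>For \<open>0 < \<tau> \<le> 2\<close> the power \<open>s powr \<tau>\<close> is at least
  the minimum of 1 and \<open>s^2\<close>. It turns a pair of integer-order bounds into one of
  fractional order.\<close>

lemma powr_interpolate:
  fixes u s A \<tau> :: real
  assumes "u \<le> A" "u \<le> A * s\<^sup>2" "0 \<le> s" "0 < \<tau>" "\<tau> \<le> 2" "0 \<le> A"
  shows "u \<le> A * s powr \<tau>"
proof (cases "s \<le> 1")
  case True
  have "s\<^sup>2 \<le> s powr \<tau>"
  proof (cases "s = 0")
    case False
    then have "s powr 2 \<le> s powr \<tau>" using assms True by (intro powr_mono') auto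
    then show ?thesis using False assms(3) by simp
  qed simp
  then have "A * s\<^sup>2 \<le> A * s powr \<tau>" using assms by (intro mult_left_mono)
  then show ?thesis using assms by linarith
next
  case False
  then have "1 \<le> s powr \<tau>" using assms by (intro ge_one_powr_ge_zero) auto
  then have "A * 1 \<le> A * s powr \<tau>" using assms by (intro mult_left_mono)
  then show ?thesis using assms by linarith
qed

lemma abs_sin_minus_id_le: "\<bar>sin x - x\<bar> \<le> \<bar>x\<bar> ^ 3 / 6" for x :: real
proof -
  have "(\<Sum>m<3. sin_coeff m * x ^ m) = x"
    by (simp add: eval_nat_numeral sin_coeff_def)
  then show ?thesis
    using Maclaurin_sin_bound[of x 3] by (simp add: fact_numeral)
qed

lemma abs_cos_minus_1_le: "\<bar>cos x - 1\<bar> \<le> x\<^sup>2 / 2" for x :: real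
proof -
  have "cos x = 1 - 2 * (sin (x / 2))\<^sup>2"
    using cos_double_sin[of "x / 2"] by simp
  moreover have "(sin (x / 2))\<^sup>2 \<le> (x / 2)\<^sup>2"
    using abs_sin_x_le_abs_x[of "x / 2"] by (simp only: abs_le_square_iff)
  ultimately show ?thesis by (simp add: power_divide)
qed

text \<open>Through the half angle \<open>u\<close> the remainder factors as
  \<open>2 * ((u - sin u) * (u + sin u))\<close>, so the cubic bound for the sine gives the quartic
  one.\<close>

lemma abs_cos_taylor_le: "\<bar>cos x - 1 + x\<^sup>2 / 2\<bar> \<le> \<bar>x\<bar> ^ 4 / 24" for x :: real
proof -
  define u where "u = x / 2"
  have "cos x - 1 + x\<^sup>2 / 2 = 2 * ((u - sin u) * (u + sin u))"
    using cos_double_sin[of u] by (simp add: u_def power2_eq_square algebra_simps)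
  also have "\<bar>\<dots>\<bar> = 2 * (\<bar>sin u - u\<bar> * \<bar>u + sin u\<bar>)"
    by (simp add: abs_mult abs_minus_commute)
  also have "\<dots> \<le> 2 * (\<bar>u\<bar> ^ 3 / 6 * (2 * \<bar>u\<bar>))"
  proof -
    have "\<bar>u + sin u\<bar> \<le> 2 * \<bar>u\<bar>" using abs_sin_x_le_abs_x[of u] by linarith
    then show ?thesis using abs_sin_minus_id_le[of u] by (intro mult_left_mono mult_mono) auto
  qed
  also have "\<dots> = \<bar>x\<bar> ^ 4 / 24"
    by (simp add: u_def eval_nat_numeral)
  finally show ?thesis .
qed

text \<open>Up to sign these are the derivatives of order 0 to 3 of the cosine minus its quadratic
  Taylor polynomial, each derivative lowering the exponent \<open>2 + \<tau>\<close> by 1. The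
  exponents are fractional because the kernels have few moments beyond the second. The third
  derivative needs \<open>\<tau> > 1\<close> to keep a positive exponent.\<close>

lemma taylor_remainders:
  fixes t \<tau> :: real
  assumes \<tau>: "0 < \<tau>" "\<tau> \<le> 2"
  shows "\<bar>cos t - 1 + t\<^sup>2 / 2\<bar> \<le> 2 * \<bar>t\<bar> powr (2 + \<tau>)"
    and "\<bar>sin t - t\<bar> \<le> 2 * \<bar>t\<bar> powr (1 + \<tau>)"
    and "\<bar>cos t - 1\<bar> \<le> 2 * \<bar>t\<bar> powr \<tau>"
    and "1 < \<tau> \<Longrightarrow> \<bar>sin t\<bar> \<le> 2 * \<bar>t\<bar> powr (\<tau> - 1)"
proof -
  have f: "\<bar>cos s - 1\<bar> \<le> 2" for s :: real
    using cos_ge_minus_one[of s] cos_le_one[of s] by linarith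
  show "\<bar>cos t - 1\<bar> \<le> 2 * \<bar>t\<bar> powr \<tau>"
  proof (rule powr_interpolate[OF f])
    show "\<bar>cos t - 1\<bar> \<le> 2 * \<bar>t\<bar>\<^sup>2"
      using abs_cos_minus_1_le[of t] zero_le_power2[of t] unfolding power2_abs by linarith
  qed (use \<tau> in auto)
  show "\<bar>cos t - 1 + t\<^sup>2 / 2\<bar> \<le> 2 * \<bar>t\<bar> powr (2 + \<tau>)"
  proof (cases "t = 0")
    case False
    have "\<bar>cos t - 1 + t\<^sup>2 / 2\<bar> / t\<^sup>2 \<le> 2 * \<bar>t\<bar> powr \<tau>"
    proof (rule powr_interpolate)
      have "\<bar>cos t - 1 + t\<^sup>2 / 2\<bar> \<le> 2 * t\<^sup>2"
        using abs_cos_minus_1_le[of t] zero_le_power2[of t] by linarith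
      then show "\<bar>cos t - 1 + t\<^sup>2 / 2\<bar> / t\<^sup>2 \<le> 2" using False by (simp add: divide_simps)
      have "\<bar>t\<bar> ^ 4 / 24 \<le> 2 * (t\<^sup>2 * t\<^sup>2)"
        by (simp add: power_mult_distrib flip: power_add)
      then have "\<bar>cos t - 1 + t\<^sup>2 / 2\<bar> \<le> 2 * (t\<^sup>2 * t\<^sup>2)"
        using abs_cos_taylor_le[of t] by linarith
      then show "\<bar>cos t - 1 + t\<^sup>2 / 2\<bar> / t\<^sup>2 \<le> 2 * \<bar>t\<bar>\<^sup>2"
        using False by (simp add: divide_simps)
    qed (use \<tau> in auto)
    then show ?thesis
      using False by (simp add: powr_add divide_simps mult_ac)
  qed simp
  show "\<bar>sin t - t\<bar> \<le> 2 * \<bar>t\<bar> powr (1 + \<tau>)"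
  proof (cases "t = 0")
    case False
    have "\<bar>sin t - t\<bar> / \<bar>t\<bar> \<le> 2 * \<bar>t\<bar> powr \<tau>"
    proof (rule powr_interpolate)
      have "\<bar>sin t - t\<bar> \<le> 2 * \<bar>t\<bar>" using abs_sin_x_le_abs_x[of t] by linarith
      then show "\<bar>sin t - t\<bar> / \<bar>t\<bar> \<le> 2" using False by (simp add: divide_simps)
      have "\<bar>sin t - t\<bar> \<le> 2 * (\<bar>t\<bar> * \<bar>t\<bar>\<^sup>2)"
      proof -
        have "\<bar>t\<bar> ^ 3 = \<bar>t\<bar> * \<bar>t\<bar>\<^sup>2"
          by (simp only: power3_eq_cube power2_eq_square mult.assoc)
        then show ?thesis
          using abs_sin_minus_id_le[of t] zero_le_power[OF abs_ge_zero, of t 3] by linarith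
      qed
      then show "\<bar>sin t - t\<bar> / \<bar>t\<bar> \<le> 2 * \<bar>t\<bar>\<^sup>2"
        using False by (simp add: divide_simps mult_ac)
    qed (use \<tau> in auto)
    then show ?thesis
      using False by (simp add: powr_add divide_simps mult_ac)
  qed simp
  assume \<tau>1: "1 < \<tau>"
  show "\<bar>sin t\<bar> \<le> 2 * \<bar>t\<bar> powr (\<tau> - 1)"
  proof -
    \<comment> \<open>After squaring, the linear bound on the sine has the quadratic form that
      \<open>powr_interpolate\<close> asks for.\<close>
    have "(sin t)\<^sup>2 \<le> 1 * \<bar>t\<bar> powr (2 * (\<tau> - 1))"
      using \<tau> \<tau>1 abs_sin_x_le_abs_x[of t]
      by (intro powr_interpolate) (auto simp: abs_square_le_1 abs_le_square_iff)
    also have "\<dots> = (\<bar>t\<bar> powr (\<tau> - 1))\<^sup>2"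
      by (simp add: power2_eq_square flip: powr_add)
    finally have "\<bar>sin t\<bar> \<le> \<bar>t\<bar> powr (\<tau> - 1)"
      by (metis abs_le_square_iff abs_of_nonneg powr_ge_zero)
    then show ?thesis by (rule order_trans) simp
  qed
qed

section \<open>Consequences of lattice symmetry\<close>

lemma norm_lvec_permute: "bij p \<Longrightarrow> norm (lvec (\<chi> i. x $ p i)) = norm (lvec x)"
  and norm_lvec_reflect: "norm (lvec (\<chi> i. if i = j then - (x $ i) else x $ i)) = norm (lvec x)"
proof -
  show "norm (lvec (\<chi> i. x $ p i)) = norm (lvec x)" if "bij p"
    using sum.reindex_bij_betw[OF that, of "\<lambda>i. (real_of_int (x $ i))\<^sup>2"]
    by (simp add: norm_vec_def L2_set_def lvec_def)
  have "(\<Sum>i\<in>UNIV. (real_of_int (if i = j then - (x $ i) else x $ i))\<^sup>2) = (\<Sum>i\<in>UNIV. (real_of_int (x $ i))\<^sup>2)"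
    by (intro sum.cong) auto
  then show "norm (lvec (\<chi> i. if i = j then - (x $ i) else x $ i)) = norm (lvec x)"
    by (simp add: norm_vec_def L2_set_def lvec_def)
qed

lemma lnorm_permute: "bij p \<Longrightarrow> lnorm (\<chi> i. x $ p i) = lnorm x"
  and lnorm_reflect: "lnorm (\<chi> i. if i = j then - (x $ i) else x $ i) = lnorm x"
  by (simp_all add: lnorm_def norm_lvec_permute norm_lvec_reflect)

lemma norm_lvec_square: "(norm (lvec x))\<^sup>2 = (\<Sum>i\<in>UNIV. (real_of_int (x $ i))\<^sup>2)"
  by (simp add: norm_vec_def L2_set_def lvec_def sum_nonneg)

definition moment2 :: "(int ^ 'd \<Rightarrow> real) \<Rightarrow> nat \<Rightarrow> real" where
  "moment2 F N = (\<Sum>x\<in>lball N. (norm (lvec x))\<^sup>2 * F x)"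

text \<open>Reflecting one coordinate kills the mixed moments, transposing two coordinates equates
  the diagonal ones, and the trace is \<open>moment2\<close>. As balls are invariant under these
  maps, this is exact at every truncation level.\<close>

lemma symmetric_second_moments:
  fixes F :: "int ^ 'd \<Rightarrow> real"
  assumes "lattice_symmetric F"
  shows "(\<Sum>x\<in>lball N. F x * (real_of_int (x $ i) * real_of_int (x $ l))) = (if i = l then moment2 F N / real CARD('d) else 0)"
proof -
  have perm: "F (\<chi> i. x $ p i) = F x" if "bij p" for p x
    using assms that unfolding lattice_symmetric_def by blast
  have rfl: "F (\<chi> i. if i = j then - (x $ i) else x $ i) = F x" for j x
    using assms unfolding lattice_symmetric_def by blast
  define s where "s i l = (\<Sum>x\<in>lball N. F x * (real_of_int (x $ i) * real_of_int (x $ l)))" for i l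
  have off: "s i l = 0" if "i \<noteq> l" for i l
  proof -
    have "s i l = (\<Sum>x\<in>lball N. - (F x * (real_of_int (x $ i) * real_of_int (x $ l))))"
      unfolding s_def
      by (rule sum.reindex_bij_witness[of _ "\<lambda>x. \<chi> m. if m = i then - (x $ m) else x $ m" "\<lambda>x. \<chi> m. if m = i then - (x $ m) else x $ m"])
         (use that in \<open>auto simp: lball_def lnorm_reflect rfl vec_eq_iff\<close>)
    also have "\<dots> = - s i l" by (simp add: s_def sum_negf)
    finally show ?thesis by simp
  qed
  have diag: "s l l = s i i" for i l
  proof -
    define p where "p = (\<lambda>m. if m = i then l else if m = l then i else m)"
    have pp: "p (p m) = m" for m by (simp add: p_def)
    then have "bij p" by (intro o_bij[of p]) auto
    then show ?thesis
      unfolding s_def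
      by (intro sum.reindex_bij_witness[of _ "\<lambda>x. \<chi> m. x $ p m" "\<lambda>x. \<chi> m. x $ p m"])
         (auto simp: lball_def lnorm_permute perm vec_eq_iff pp, simp_all add: p_def)
  qed
  have "moment2 F N = (\<Sum>l\<in>UNIV. s l l)"
    unfolding moment2_def s_def norm_lvec_square
    by (subst sum.swap) (simp add: sum_distrib_left sum_distrib_right power2_eq_square mult_ac)
  also have "\<dots> = (\<Sum>l\<in>(UNIV :: 'd set). s i i)"
    by (intro sum.cong refl diag)
  also have "\<dots> = real CARD('d) * s i i" by simp
  finally show ?thesis
    using off unfolding s_def[symmetric] by auto
qed

lemma symmetric_quadratic_form:
  fixes F :: "int ^ 'd \<Rightarrow> real"
  assumes "lattice_symmetric F"
  shows "(\<Sum>x\<in>lball N. F x * (real_of_int (x $ j) * (k \<bullet> lvec x))) = k $ j * (moment2 F N / real CARD('d))"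
    and "(\<Sum>x\<in>lball N. F x * (k \<bullet> lvec x)\<^sup>2) = (norm k)\<^sup>2 * (moment2 F N / real CARD('d))"
proof -
  let ?M = "moment2 F N / real CARD('d)"
  have 1: "(\<Sum>x\<in>lball N. F x * (real_of_int (x $ j) * (k \<bullet> lvec x))) = k $ j * ?M" for j
  proof -
    have "(\<Sum>x\<in>lball N. F x * (real_of_int (x $ j) * (k \<bullet> lvec x)))
        = (\<Sum>i\<in>UNIV. k $ i * (\<Sum>x\<in>lball N. F x * (real_of_int (x $ j) * real_of_int (x $ i))))"
      by (simp add: inner_vec_def lvec_def sum_distrib_left mult_ac) (rule sum.swap)
    also have "\<dots> = k $ j * ?M"
      by (simp add: symmetric_second_moments[OF assms] if_distrib[of "(*) _"] cong: if_cong)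
    finally show ?thesis .
  qed
  show "(\<Sum>x\<in>lball N. F x * (real_of_int (x $ j) * (k \<bullet> lvec x))) = k $ j * ?M" by (rule 1)
  have "(\<Sum>x\<in>lball N. F x * (k \<bullet> lvec x)\<^sup>2)
      = (\<Sum>x\<in>lball N. \<Sum>j\<in>UNIV. k $ j * (F x * (real_of_int (x $ j) * (k \<bullet> lvec x))))"
  proof (rule sum.cong)
    fix x :: "int ^ 'd"
    have "F x * (k \<bullet> lvec x)\<^sup>2 = F x * (k \<bullet> lvec x) * (\<Sum>j\<in>UNIV. k $ j * real_of_int (x $ j))"
      by (simp add: power2_eq_square inner_vec_def lvec_def)
    then show "F x * (k \<bullet> lvec x)\<^sup>2 = (\<Sum>j\<in>UNIV. k $ j * (F x * (real_of_int (x $ j) * (k \<bullet> lvec x))))"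
      by (simp only: sum_distrib_left mult_ac)
  qed simp
  also have "\<dots> = (\<Sum>j\<in>UNIV. k $ j * (k $ j * ?M))"
    by (subst sum.swap) (simp only: sum_distrib_left[symmetric] 1)
  also have "\<dots> = (norm k)\<^sup>2 * ?M"
    by (simp only: power2_norm_eq_inner inner_vec_def sum_distrib_right mult.assoc inner_real_def)
  finally show "(\<Sum>x\<in>lball N. F x * (k \<bullet> lvec x)\<^sup>2) = (norm k)\<^sup>2 * ?M" .
qed

text \<open>For a decaying kernel this is the real part of the transform minus its value at 0. The
  value at 0 is handled separately as a mass, so that the truncated symbols vanish at the origin
  exactly and the mass can be replaced by a shifted one.\<close>

definition symbol :: "(int ^ 'd \<Rightarrow> real) \<Rightarrow> real ^ 'd \<Rightarrow> real" where
  "symbol F k = (\<Sum>\<^sub>\<infinity>x\<in>UNIV. F x * (cos (k \<bullet> lvec x) - 1))"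

definition partial_symbol :: "(int ^ 'd \<Rightarrow> real) \<Rightarrow> nat \<Rightarrow> real ^ 'd \<Rightarrow> real" where
  "partial_symbol F N k = (\<Sum>x\<in>lball N. F x * (cos (k \<bullet> lvec x) - 1))"

definition abs_moment :: "real \<Rightarrow> (int ^ 'd \<Rightarrow> real) \<Rightarrow> real" where
  "abs_moment p F = (\<Sum>\<^sub>\<infinity>x\<in>UNIV. \<bar>F x\<bar> * lnorm x powr p)"

lemma inner_lvec_le: "\<bar>k \<bullet> lvec x\<bar> \<le> norm k * lnorm x"
  using Cauchy_Schwarz_ineq2[of k "lvec x"] norm_lvec_le_lnorm[of x]
  by (meson mult_left_mono norm_ge_zero order_trans)

lemma abs_moment_nonneg: "0 \<le> abs_moment p F"
  unfolding abs_moment_def by (intro infsum_nonneg) auto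

lemma partial_abs_moment_le:
  fixes F :: "int ^ 'd \<Rightarrow> real"
  assumes "decays s F" "s > real CARD('d) + p"
  shows "(\<Sum>x\<in>lball N. \<bar>F x\<bar> * lnorm x powr p) \<le> abs_moment p F"
  unfolding abs_moment_def
  by (intro finite_sum_le_infsum decays_moment_summable[OF assms]) auto

lemma weighted_sum_le:
  fixes F :: "int ^ 'd \<Rightarrow> real"
  assumes "decays s F" "s > real CARD('d) + p"
    and g: "\<And>x. \<bar>g x\<bar> \<le> C * lnorm x powr p" and C: "0 \<le> C"
  shows "\<bar>\<Sum>x\<in>lball N. F x * g x\<bar> \<le> C * abs_moment p F"
proof -
  have "\<bar>\<Sum>x\<in>lball N. F x * g x\<bar> \<le> (\<Sum>x\<in>lball N. C * (\<bar>F x\<bar> * lnorm x powr p))"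
  proof (intro order_trans[OF sum_abs] sum_mono)
    fix x
    show "\<bar>F x * g x\<bar> \<le> C * (\<bar>F x\<bar> * lnorm x powr p)"
      using mult_left_mono[OF g[of x], of "\<bar>F x\<bar>"] by (simp add: abs_mult mult_ac)
  qed
  also have "\<dots> = C * (\<Sum>x\<in>lball N. \<bar>F x\<bar> * lnorm x powr p)"
    by (simp only: sum_distrib_left)
  also have "\<dots> \<le> C * abs_moment p F"
    by (rule mult_left_mono[OF partial_abs_moment_le[OF assms(1,2)] C])
  finally show ?thesis .
qed

lemma partial_symbol_eq_trig: "partial_symbol F N k = trig j (lball N) F 0 k - trig j (lball N) F 0 0"
  by (simp add: partial_symbol_def trig_def sum_subtractf[symmetric] right_diff_distrib)

lemma partial_symbol_tendsto:
  fixes F :: "int ^ 'd \<Rightarrow> real"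
  assumes "decays s F" "s > real CARD('d)"
  shows "(\<lambda>N. partial_symbol F N k) \<longlonglongrightarrow> symbol F k"
proof -
  have "(\<lambda>x. F x * (cos (k \<bullet> lvec x) - 1)) summable_on UNIV"
  proof (rule summable_weighted_le[where p = 0 and C = 2])
    show "(\<lambda>x. \<bar>F x\<bar> * lnorm x powr 0) summable_on UNIV"
      using assms by (intro decays_moment_summable) auto
    show "\<bar>cos (k \<bullet> lvec x) - 1\<bar> \<le> 2 * lnorm x powr 0" for x
      using lnorm_ge_1[of x] cos_ge_minus_one[of "k \<bullet> lvec x"] cos_le_one[of "k \<bullet> lvec x"] by (simp add: abs_le_iff)
  qed
  from sum_lball_tendsto_infsum[OF this] show ?thesis
    unfolding partial_symbol_def symbol_def .
qed

lemma symbol_measurable [measurable]: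
  fixes F :: "int ^ 'd \<Rightarrow> real"
  assumes "decays s F" "s > real CARD('d)"
  shows "symbol F \<in> borel_measurable borel"
proof (rule borel_measurable_LIMSEQ_real[OF partial_symbol_tendsto[OF assms]])
  show "partial_symbol F N \<in> borel_measurable borel" for N
    unfolding partial_symbol_def by (intro borel_measurable_continuous_onI continuous_intros)
qed

lemma moment2_tendsto:
  fixes F :: "int ^ 'd \<Rightarrow> real"
  assumes "decays s F" "s > real CARD('d) + 2"
  shows "moment2 F \<longlonglongrightarrow> (\<Sum>\<^sub>\<infinity>x\<in>UNIV. (norm (lvec x))\<^sup>2 * F x)"
proof -
  have "(\<lambda>x. F x * (norm (lvec x))\<^sup>2) summable_on UNIV"
  proof (rule summable_weighted_le[where p = 2 and C = 1])
    show "(\<lambda>x. \<bar>F x\<bar> * lnorm x powr 2) summable_on UNIV"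
      using assms by (intro decays_moment_summable) auto
    show "\<bar>(norm (lvec x))\<^sup>2\<bar> \<le> 1 * lnorm x powr 2" for x :: "int ^ 'd"
      using power_mono[OF norm_lvec_le_lnorm[of x], of 2] lnorm_ge_1[of x] by simp
  qed
  then have "(\<lambda>x. (norm (lvec x))\<^sup>2 * F x) summable_on UNIV"
    by (simp only: mult.commute)
  from sum_lball_tendsto_infsum[OF this] show ?thesis
    unfolding moment2_def .
qed

lemma lnorm_mult_powr:
  "0 \<le> a \<Longrightarrow> \<bar>k \<bullet> lvec x\<bar> powr a \<le> norm k powr a * lnorm x powr a"
  using powr_mono2[OF _ abs_ge_zero inner_lvec_le, of a k x] lnorm_ge_1[of x] by (simp add: powr_mult)

lemma partial_symbol_taylor:
  fixes F :: "int ^ 'd \<Rightarrow> real"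
  assumes sym: "lattice_symmetric F" and dec: "decays s F" "s > real CARD('d) + 2 + \<tau>" and \<tau>: "0 < \<tau>" "\<tau> \<le> 2"
  shows "\<bar>partial_symbol F N k + (norm k)\<^sup>2 * (moment2 F N / real CARD('d)) / 2\<bar> \<le> 2 * norm k powr (2 + \<tau>) * abs_moment (2 + \<tau>) F"
proof -
  have "partial_symbol F N k + (norm k)\<^sup>2 * (moment2 F N / real CARD('d)) / 2
      = (\<Sum>x\<in>lball N. F x * (cos (k \<bullet> lvec x) - 1 + (k \<bullet> lvec x)\<^sup>2 / 2))"
    unfolding symmetric_quadratic_form(2)[OF sym, symmetric] partial_symbol_def
    by (simp add: sum_divide_distrib sum.distrib[symmetric] distrib_left)
  also have "\<bar>\<dots>\<bar> \<le> 2 * norm k powr (2 + \<tau>) * abs_moment (2 + \<tau>) F"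
  proof (rule weighted_sum_le[OF dec(1)])
    fix x
    show "\<bar>cos (k \<bullet> lvec x) - 1 + (k \<bullet> lvec x)\<^sup>2 / 2\<bar> \<le> 2 * norm k powr (2 + \<tau>) * lnorm x powr (2 + \<tau>)"
      using taylor_remainders(1)[OF \<tau>, of "k \<bullet> lvec x"] lnorm_mult_powr[of "2 + \<tau>" k x] \<tau> by simp
  qed (use dec in auto)
  finally show ?thesis .
qed

text \<open>The common class of the rescaled \<open>F\<close> and the walk kernel. The comparison
  treats its two members alike and knows nothing of the random walk.\<close>

definition kernel :: "real \<Rightarrow> real \<Rightarrow> (int ^ 'd \<Rightarrow> real) \<Rightarrow> bool" where
  "kernel s c F \<longleftrightarrow> lattice_symmetric F \<and> decays s F \<and> 0 < c \<and> (\<forall>k\<in>torus. c * (norm k)\<^sup>2 \<le> symbol F k)"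

text \<open>Along a coordinate axis the infrared bound and the Taylor expansion give
  \<open>c * t^2 \<le> - t^2 * M / (2 * d) + O(t powr (2 + \<tau>))\<close>. Dividing by
  \<open>t^2\<close> and letting \<open>t\<close> tend to 0 bounds \<open>M\<close> away from
  0.\<close>

lemma kernel_moment2_neg:
  fixes F :: "int ^ 'd \<Rightarrow> real"
  assumes F: "kernel s c F" and s: "s > real CARD('d) + 2"
  shows "(\<Sum>\<^sub>\<infinity>x\<in>UNIV. (norm (lvec x))\<^sup>2 * F x) < 0"
proof -
  define M where "M = (\<Sum>\<^sub>\<infinity>x\<in>UNIV. (norm (lvec x))\<^sup>2 * F x)"
  \<comment> \<open>Half of the decay beyond the second moment is spent on \<open>\<tau>\<close>, so
    that the moment of order \<open>2 + \<tau>\<close> still converges.\<close>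
  define \<tau> where "\<tau> = min ((s - real CARD('d) - 2) / 2) 2"
  have \<tau>: "0 < \<tau>" "\<tau> \<le> 2" "s > real CARD('d) + 2 + \<tau>"
    using s by (auto simp: \<tau>_def min_def field_simps)
  have K: "lattice_symmetric F" "decays s F" "0 < c" "\<And>k. k \<in> torus \<Longrightarrow> c * (norm k)\<^sup>2 \<le> symbol F k"
    using F by (auto simp: kernel_def)
  define B where "B = 2 * abs_moment (2 + \<tau>) F"
  have B: "0 \<le> B" using abs_moment_nonneg by (simp add: B_def)
  have bound: "\<bar>symbol F k + (norm k)\<^sup>2 * (M / real CARD('d)) / 2\<bar> \<le> norm k powr (2 + \<tau>) * B" for k
  proof (rule LIMSEQ_le_const2)
    show "(\<lambda>N. \<bar>partial_symbol F N k + (norm k)\<^sup>2 * (moment2 F N / real CARD('d)) / 2\<bar>)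
        \<longlonglongrightarrow> \<bar>symbol F k + (norm k)\<^sup>2 * (M / real CARD('d)) / 2\<bar>"
      unfolding M_def using K(2) s
      by (intro tendsto_intros partial_symbol_tendsto moment2_tendsto) auto
    show "\<exists>N. \<forall>n\<ge>N. \<bar>partial_symbol F n k + (norm k)\<^sup>2 * (moment2 F n / real CARD('d)) / 2\<bar> \<le> norm k powr (2 + \<tau>) * B"
      using partial_symbol_taylor[OF K(1,2) \<tau>(3,1,2), of _ k] by (auto simp: B_def mult_ac)
  qed
  obtain j :: 'd where True by blast
  have "\<forall>\<^sub>F t in at_right 0. c \<le> - (M / real CARD('d)) / 2 + t powr \<tau> * B"
  proof -
    have "\<forall>\<^sub>F t in at_right (0 :: real). 0 < t \<and> t < 1"
      by (simp add: eventually_at_right[of 0 1] exI[of _ 1])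
    then show ?thesis
    proof eventually_elim
      case (elim t)
      define k where "k = t *\<^sub>R (axis j 1 :: real ^ 'd)"
      have nk: "norm k = t" using elim by (simp add: k_def norm_axis_real)
      have kt: "k \<in> torus"
        using elim pi_gt3 by (auto simp: torus_def k_def axis_def)
      have "c * t\<^sup>2 \<le> - (t\<^sup>2 * (M / real CARD('d)) / 2) + t powr (2 + \<tau>) * B"
      proof -
        have "symbol F k + X \<le> P \<Longrightarrow> c * t\<^sup>2 \<le> symbol F k \<Longrightarrow> c * t\<^sup>2 \<le> - X + P" for X P :: real
          by linarith
        from this[OF abs_le_D1[OF bound[of k, unfolded nk]]] show ?thesis
          using K(4)[OF kt] unfolding nk .
      qed
      also have "\<dots> = t\<^sup>2 * (- (M / real CARD('d)) / 2 + t powr \<tau> * B)"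
        using elim by (simp add: powr_add algebra_simps)
      finally have "t\<^sup>2 * c \<le> t\<^sup>2 * (- (M / real CARD('d)) / 2 + t powr \<tau> * B)" by (simp add: mult.commute)
      then show ?case using elim by simp
    qed
  qed
  moreover have "((\<lambda>t. - (M / real CARD('d)) / 2 + t powr \<tau> * B) \<longlongrightarrow> - (M / real CARD('d)) / 2 + 0 powr \<tau> * B) (at_right 0)"
  proof (rule tendsto_add[OF tendsto_const tendsto_mult[OF tendsto_powr2[OF tendsto_ident_at tendsto_const] tendsto_const]])
    show "\<forall>\<^sub>F t in at_right (0 :: real). 0 \<le> t"
      by (rule eventually_mono[OF eventually_at_right_less]) simp
  qed (use \<tau> in simp)
  ultimately have "c \<le> - (M / real CARD('d)) / 2 + 0 powr \<tau> * B"
    by (intro tendsto_lowerbound) auto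
  then have "M / real CARD('d) < 0" using K(3) \<tau> by simp
  then show ?thesis unfolding M_def by (simp add: divide_less_0_iff)
qed

lemma torus_representative:
  fixes k :: "real ^ 'd"
  shows "\<exists>k'\<in>torus. \<forall>x. character x k' = character x k"
proof -
  \<comment> \<open>The ceiling matches the half-open cube, which contains \<open>pi\<close> but not
    \<open>- pi\<close>.\<close>
  define z where "z i = \<lceil>(k $ i - pi) / (2 * pi)\<rceil>" for i
  define k' where "k' = (\<chi> i. k $ i - 2 * pi * real_of_int (z i))"
  have "k' \<in> torus"
  proof -
    have "- pi < k $ i - 2 * pi * real_of_int (z i) \<and> k $ i - 2 * pi * real_of_int (z i) \<le> pi" for i
    proof -
      define w where "w = (k $ i - pi) / (2 * pi)"
      have k: "k $ i = 2 * pi * w + pi" by (simp add: w_def)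
      have "real_of_int (z i) - 1 < w" "w \<le> real_of_int (z i)"
        using ceiling_correct[of w] by (auto simp: z_def w_def)
      then have "2 * pi * (real_of_int (z i) - 1) < 2 * pi * w" "2 * pi * w \<le> 2 * pi * real_of_int (z i)"
        by (auto intro!: mult_strict_left_mono mult_left_mono)
      then show ?thesis unfolding k by (simp add: algebra_simps)
    qed
    then show ?thesis by (simp add: torus_def k'_def)
  qed
  moreover have "character x k' = character x k" for x
  proof -
    define m where "m = (\<Sum>i\<in>UNIV. z i * x $ i)"
    have "k \<bullet> lvec x = k' \<bullet> lvec x + 2 * pi * real_of_int m"
      by (simp add: k'_def m_def inner_vec_def lvec_def sum_distrib_left sum.distrib[symmetric] algebra_simps)
    then show ?thesis
      unfolding cis_conv_exp[symmetric] by (simp add: cis_mult[symmetric] cis_multiple_2pi)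
  qed
  ultimately show ?thesis by blast
qed

lemma partial_symbol_torus:
  "\<exists>k'\<in>torus. partial_symbol F N k' = partial_symbol F N k"
proof -
  obtain k' where k': "k' \<in> torus" "\<And>x. character x k' = character x k"
    using torus_representative by blast
  have "cos (k' \<bullet> lvec x) = cos (k \<bullet> lvec x)" for x
    using k'(2)[of x] by (metis cis.sel(1) cis_conv_exp)
  then show ?thesis unfolding partial_symbol_def by (intro bexI[OF _ k'(1)]) simp
qed

text \<open>Since \<open>1 - cos t \<le> t^2\<close>, truncation changes the symbol by at most
  \<open>(norm k)^2\<close> times a tail of the absolute second moment. The error thus scales like
  the bound itself and can be absorbed uniformly in \<open>k\<close>, even near the origin.\<close>

lemma kernel_partial_lower_bound:
  fixes F :: "int ^ 'd \<Rightarrow> real"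
  assumes F: "kernel s c F" and s: "s > real CARD('d) + 2"
  shows "\<exists>N0. \<forall>N\<ge>N0. \<forall>k\<in>torus. c / 2 * (norm k)\<^sup>2 \<le> partial_symbol F N k"
proof -
  have K: "decays s F" "0 < c" "\<And>k. k \<in> torus \<Longrightarrow> c * (norm k)\<^sup>2 \<le> symbol F k"
    using F by (auto simp: kernel_def)
  define g where "g x = \<bar>F x\<bar> * lnorm x powr 2" for x
  have lim: "(\<lambda>N. sum g (lball N)) \<longlonglongrightarrow> infsum g UNIV"
    unfolding g_def using K s by (intro sum_lball_tendsto_infsum decays_moment_summable) auto
  have "\<forall>\<^sub>F N in sequentially. infsum g UNIV - c / 2 < sum g (lball N)"
    using K(2) by (intro order_tendstoD(1)[OF lim]) simp
  then obtain N0 where N0: "\<And>N. N \<ge> N0 \<Longrightarrow> infsum g UNIV - sum g (lball N) \<le> c / 2"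
    unfolding eventually_sequentially by (force intro: less_imp_le)
  have diff: "\<bar>symbol F k - partial_symbol F N k\<bar> \<le> (norm k)\<^sup>2 * (infsum g UNIV - sum g (lball N))" for N k
  proof (rule LIMSEQ_le)
    show "(\<lambda>M. \<bar>partial_symbol F M k - partial_symbol F N k\<bar>) \<longlonglongrightarrow> \<bar>symbol F k - partial_symbol F N k\<bar>"
      using K s by (intro tendsto_intros partial_symbol_tendsto) auto
    show "(\<lambda>M. (norm k)\<^sup>2 * (sum g (lball M) - sum g (lball N))) \<longlonglongrightarrow> (norm k)\<^sup>2 * (infsum g UNIV - sum g (lball N))"
      by (intro tendsto_intros lim)
    show "\<exists>N'. \<forall>M\<ge>N'. \<bar>partial_symbol F M k - partial_symbol F N k\<bar> \<le> (norm k)\<^sup>2 * (sum g (lball M) - sum g (lball N))"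
    proof (intro exI allI impI)
      fix M assume "N \<le> M"
      then have sub: "lball N \<subseteq> (lball M :: (int ^ 'd) set)" by (rule lball_mono)
      have "\<bar>partial_symbol F M k - partial_symbol F N k\<bar> = \<bar>\<Sum>x\<in>lball M - lball N. F x * (cos (k \<bullet> lvec x) - 1)\<bar>"
        unfolding partial_symbol_def by (simp add: sum_diff[OF finite_lball sub])
      also have "\<dots> \<le> (\<Sum>x\<in>lball M - lball N. (norm k)\<^sup>2 * g x)"
      proof (intro order_trans[OF sum_abs] sum_mono)
        fix x
        have "\<bar>cos (k \<bullet> lvec x) - 1\<bar> \<le> (k \<bullet> lvec x)\<^sup>2"
          using abs_cos_minus_1_le[of "k \<bullet> lvec x"] zero_le_power2[of "k \<bullet> lvec x"] by linarith
        also have "\<dots> \<le> (norm k * lnorm x)\<^sup>2"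
          using power_mono[OF inner_lvec_le[of k x] abs_ge_zero, of 2] by simp
        also have "\<dots> = (norm k)\<^sup>2 * lnorm x powr 2"
          using lnorm_ge_1[of x] by (simp add: power_mult_distrib)
        finally have "\<bar>F x\<bar> * \<bar>cos (k \<bullet> lvec x) - 1\<bar> \<le> \<bar>F x\<bar> * ((norm k)\<^sup>2 * lnorm x powr 2)"
          by (intro mult_left_mono) auto
        then show "\<bar>F x * (cos (k \<bullet> lvec x) - 1)\<bar> \<le> (norm k)\<^sup>2 * g x"
          by (simp add: g_def abs_mult mult_ac)
      qed
      also have "\<dots> = (norm k)\<^sup>2 * (sum g (lball M) - sum g (lball N))"
        by (simp only: sum_distrib_left[symmetric] sum_diff[OF finite_lball sub])
      finally show "\<bar>partial_symbol F M k - partial_symbol F N k\<bar> \<le> (norm k)\<^sup>2 * (sum g (lball M) - sum g (lball N))" .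
    qed
  qed
  have "c / 2 * (norm k)\<^sup>2 \<le> partial_symbol F N k" if "N \<ge> N0" "k \<in> torus" for N k
  proof -
    have "(norm k)\<^sup>2 * (infsum g UNIV - sum g (lball N)) \<le> (norm k)\<^sup>2 * (c / 2)"
      using N0[OF that(1)] by (intro mult_left_mono) auto
    then have "\<bar>symbol F k - partial_symbol F N k\<bar> \<le> c / 2 * (norm k)\<^sup>2"
      using diff[of k N] by (simp only: mult.commute)
    then show ?thesis
      using K(3)[OF that(2)] unfolding abs_le_iff by linarith
  qed
  then show ?thesis by blast
qed

text \<open>Reason: \<open>V powr - a \<le> r powr a\<close>, as \<open>V * r \<ge> 1\<close>. It
  converts the dyadic bounds, which are powers of \<open>V\<close> alone, into the format of
  \<open>ctrl\<close>, an integer power of \<open>V\<close> times a power of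
  \<open>norm k\<close>.\<close>

lemma powr_le_power_mult_powr:
  fixes V r a :: real
  assumes "1 \<le> V" "0 < r" "1 \<le> V * r" "0 \<le> a"
  shows "V powr (real i - a) \<le> V ^ i * r powr a"
proof -
  have "1 \<le> (V * r) powr a" using assms by (intro ge_one_powr_ge_zero) auto
  then have "1 \<le> V powr a * r powr a" using assms by (simp add: powr_mult)
  then have "inverse (V powr a) \<le> r powr a"
    using assms by (simp add: inverse_eq_divide divide_simps mult.commute)
  then have "V ^ i * inverse (V powr a) \<le> V ^ i * r powr a"
    using assms by (intro mult_left_mono) auto
  then show ?thesis
    using assms by (simp add: powr_diff powr_realpow divide_inverse)
qed

text \<open>The order of the quantifiers is the point: \<open>Q\<close>, a derivative of the
  quadratic Taylor term, depends on \<open>i\<close>, \<open>j\<close> and \<open>k\<close> but not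
  on the kernel or the truncation. For two kernels whose second moments are matched the terms with
  \<open>Q\<close> therefore cancel.\<close>

lemma trig_low_order:
  assumes \<tau>: "0 < \<tau>" "\<tau> \<le> 2" and i: "i \<le> 2 \<or> i = 3 \<and> 1 < \<tau>"
  shows "\<exists>Q. \<forall>(F :: int ^ 'd \<Rightarrow> real) N. lattice_symmetric F \<and> decays s F \<and> s > real CARD('d) + 2 + \<tau> \<longrightarrow>
    \<bar>trig j (lball N) F i k - (if i = 0 then trig j (lball N) F 0 0 else 0) - Q * moment2 F N\<bar>
      \<le> 2 * norm k powr (2 + \<tau> - real i) * abs_moment (2 + \<tau>) F"
proof -
  have xp: "\<bar>real_of_int (x $ j) ^ i * g\<bar> \<le> 2 * norm k powr (2 + \<tau> - real i) * lnorm x powr (2 + \<tau>)"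
    if g: "\<bar>g\<bar> \<le> 2 * \<bar>k \<bullet> lvec x\<bar> powr (2 + \<tau> - real i)" and i': "real i \<le> 2 + \<tau>" for x :: "int ^ 'd" and g
  proof -
    have "\<bar>real_of_int (x $ j) ^ i\<bar> \<le> lnorm x ^ i"
      unfolding power_abs by (intro power_mono abs_component_le_lnorm) auto
    moreover have "\<bar>g\<bar> \<le> 2 * (norm k powr (2 + \<tau> - real i) * lnorm x powr (2 + \<tau> - real i))"
      using g lnorm_mult_powr[of "2 + \<tau> - real i" k x] i' by linarith
    ultimately have "\<bar>real_of_int (x $ j) ^ i\<bar> * \<bar>g\<bar> \<le> lnorm x ^ i * (2 * (norm k powr (2 + \<tau> - real i) * lnorm x powr (2 + \<tau> - real i)))"
      by (intro mult_mono) auto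
    also have "\<dots> = 2 * norm k powr (2 + \<tau> - real i) * (lnorm x powr real i * lnorm x powr (2 + \<tau> - real i))"
      using lnorm_ge_1[of x] by (simp add: powr_realpow)
    also have "lnorm x powr real i * lnorm x powr (2 + \<tau> - real i) = lnorm x powr (2 + \<tau>)"
      by (simp flip: powr_add)
    finally show ?thesis by (simp only: abs_mult)
  qed
  have le: "\<bar>\<Sum>x\<in>lball N. F x * (real_of_int (x $ j) ^ i * g (k \<bullet> lvec x))\<bar> \<le> 2 * norm k powr (2 + \<tau> - real i) * abs_moment (2 + \<tau>) F"
    if g: "\<And>t. \<bar>g t\<bar> \<le> 2 * \<bar>t\<bar> powr (2 + \<tau> - real i)" and i': "real i \<le> 2 + \<tau>"
      and F: "decays s F" "s > real CARD('d) + 2 + \<tau>" for g N and F :: "int ^ 'd \<Rightarrow> real"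
    using F by (intro weighted_sum_le[OF F(1)] xp g i') auto
  consider "i = 0" | "i = 1" | "i = 2" | "i = 3" "1 < \<tau>" using i by fastforce
  then show ?thesis
  proof cases
    case 1
    show ?thesis
    proof (intro exI[of _ "- (norm k)\<^sup>2 / real CARD('d) / 2"] allI impI)
      fix F :: "int ^ 'd \<Rightarrow> real" and N
      assume F: "lattice_symmetric F \<and> decays s F \<and> s > real CARD('d) + 2 + \<tau>"
      then show "\<bar>trig j (lball N) F i k - (if i = 0 then trig j (lball N) F 0 0 else 0) - - (norm k)\<^sup>2 / real CARD('d) / 2 * moment2 F N\<bar>
          \<le> 2 * norm k powr (2 + \<tau> - real i) * abs_moment (2 + \<tau>) F"
        using partial_symbol_taylor[of F s \<tau> N k] \<tau> 1 by (simp add: partial_symbol_eq_trig[of F N k j])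
    qed
  next
    case 2
    show ?thesis
    proof (intro exI[of _ "- (k $ j) / real CARD('d)"] allI impI)
      fix F :: "int ^ 'd \<Rightarrow> real" and N
      assume F: "lattice_symmetric F \<and> decays s F \<and> s > real CARD('d) + 2 + \<tau>"
      have "trig j (lball N) F i k - (if i = 0 then trig j (lball N) F 0 0 else 0) - - (k $ j) / real CARD('d) * moment2 F N
          = trig j (lball N) F 1 k + k $ j * (moment2 F N / real CARD('d))"
        using 2 by simp
      also have "\<dots> = (\<Sum>x\<in>lball N. F x * (real_of_int (x $ j) ^ i * (- (sin (k \<bullet> lvec x) - k \<bullet> lvec x))))"
        unfolding trig_def symmetric_quadratic_form(1)[OF conjunct1[OF F], symmetric] sum.distrib[symmetric]
        using 2 by (intro sum.cong) (auto simp: cos_add algebra_simps)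
      finally show "\<bar>trig j (lball N) F i k - (if i = 0 then trig j (lball N) F 0 0 else 0) - - (k $ j) / real CARD('d) * moment2 F N\<bar>
          \<le> 2 * norm k powr (2 + \<tau> - real i) * abs_moment (2 + \<tau>) F"
        using le[of "\<lambda>t. - (sin t - t)" F N] taylor_remainders(2)[OF \<tau>] F \<tau> 2
        by (simp add: abs_minus_commute)
    qed
  next
    case 3
    show ?thesis
    proof (intro exI[of _ "- 1 / real CARD('d)"] allI impI)
      fix F :: "int ^ 'd \<Rightarrow> real" and N
      assume F: "lattice_symmetric F \<and> decays s F \<and> s > real CARD('d) + 2 + \<tau>"
      have "trig j (lball N) F i k - (if i = 0 then trig j (lball N) F 0 0 else 0) - - 1 / real CARD('d) * moment2 F N
          = trig j (lball N) F 2 k + moment2 F N / real CARD('d)"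
        using 3 by simp
      also have "\<dots> = trig j (lball N) F 2 k + (\<Sum>x\<in>lball N. F x * (real_of_int (x $ j) * real_of_int (x $ j)))"
        using symmetric_second_moments[OF conjunct1[OF F], where N = N and i = j and l = j] by simp
      also have "\<dots> = (\<Sum>x\<in>lball N. F x * (real_of_int (x $ j) ^ i * (- (cos (k \<bullet> lvec x) - 1))))"
        unfolding trig_def sum.distrib[symmetric]
        using 3 by (intro sum.cong) (auto simp: cos_add power2_eq_square algebra_simps)
      finally show "\<bar>trig j (lball N) F i k - (if i = 0 then trig j (lball N) F 0 0 else 0) - - 1 / real CARD('d) * moment2 F N\<bar>
          \<le> 2 * norm k powr (2 + \<tau> - real i) * abs_moment (2 + \<tau>) F"
        using le[of "\<lambda>t. - (cos t - 1)" F N] taylor_remainders(3)[OF \<tau>] F \<tau> 3 by simp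
    qed
  next
    case 4
    show ?thesis
    \<comment> \<open>The third derivative of the quadratic Taylor term vanishes.\<close>
    proof (intro exI[of _ 0] allI impI)
      fix F :: "int ^ 'd \<Rightarrow> real" and N
      assume F: "lattice_symmetric F \<and> decays s F \<and> s > real CARD('d) + 2 + \<tau>"
      have "cos (t + 3 * (pi / 2)) = sin t" for t :: real
        using cos_add[of "t + pi" "pi / 2"] by (simp add: field_simps)
      then have "trig j (lball N) F i k = (\<Sum>x\<in>lball N. F x * (real_of_int (x $ j) ^ i * sin (k \<bullet> lvec x)))"
        unfolding trig_def using 4 by (intro sum.cong) (auto simp: mult.assoc)
      then show "\<bar>trig j (lball N) F i k - (if i = 0 then trig j (lball N) F 0 0 else 0) - 0 * moment2 F N\<bar>
          \<le> 2 * norm k powr (2 + \<tau> - real i) * abs_moment (2 + \<tau>) F"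
        using le[of sin F N] taylor_remainders(4)[OF \<tau> 4(2)] F \<tau> 4 by simp
    qed
  qed
qed

text \<open>The lower bound gives order 0. By \<open>ctrl_reciprocal\<close> it then suffices that
  the derivative of order \<open>i \<ge> 1\<close> of the symbol is
  \<open>O(V^i * (norm k)^2)\<close>, which follows from the dyadic bounds for
  \<open>i \<ge> 2\<close>.\<close>

lemma ctrl_reciprocal_symbol:
  fixes F :: "int ^ 'd \<Rightarrow> real"
  assumes dec: "decays s F" "s > real CARD('d) + 2"
    and b: "\<And>N. 0 < b N" "convergent b" and c: "0 < c"
    and lower: "\<And>N k. k \<in> torus \<Longrightarrow> c * (norm k)\<^sup>2 \<le> partial_symbol F (N + N0) k"
    and S: "\<And>k. k \<in> S \<Longrightarrow> k \<in> torus \<and> k \<noteq> 0 \<and> 1 \<le> V k \<and> 1 \<le> V k * norm k"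
    and bound: "\<And>i N k. i \<le> n \<Longrightarrow> k \<in> S \<Longrightarrow> \<bar>trig j (lball N) F i k\<bar> \<le> C * V k powr (max (real i - 2 - \<sigma>) 0)"
    and conv: "\<And>i k. i \<le> n \<Longrightarrow> k \<in> S \<Longrightarrow> convergent (\<lambda>N. trig j (lball N) F i k)"
    and n: "1 \<le> n" and \<sigma>: "0 \<le> \<sigma>"
  shows "ctrl j S V n (\<lambda>k. norm k powr - 2) (\<lambda>N k. 1 / (b N + partial_symbol F (N + N0) k))"
proof -
  obtain n' where n': "n = Suc n'" using n by (cases n) auto
  define \<phi> where "\<phi> N k = b N + partial_symbol F (N + N0) k" for N k
  \<comment> \<open>The lower bound is available on the torus only. Periodicity makes the
    denominators positive on all of space, where \<open>ctrl\<close> demands continuity and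
    derivatives of the reciprocal.\<close>
  have nonneg: "0 \<le> partial_symbol F (N + N0) k" for N k
  proof -
    obtain k' where k': "k' \<in> torus" "partial_symbol F (N + N0) k' = partial_symbol F (N + N0) k"
      using partial_symbol_torus by blast
    have "0 \<le> c * (norm k')\<^sup>2" using c by simp
    then show ?thesis using lower[OF k'(1), of N] k'(2) by linarith
  qed
  have pos: "0 < \<phi> N k" for N k
    unfolding \<phi>_def using b(1)[of N] nonneg[of N k] by linarith
  have cont: "continuous_on UNIV (\<phi> N)" and per: "torus_periodic (\<phi> N)" for N
    using trig_periodic[of j "lball (N + N0)" F 0]
    unfolding \<phi>_def partial_symbol_eq_trig[of F _ _ j] torus_periodic_def
    by (auto intro!: continuous_intros continuous_on_trig)
  have pd: "has_pd j (\<phi> N) (trig j (lball (N + N0)) F 1)" for N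
  proof -
    have "has_pd j (\<lambda>k. trig j (lball (N + N0)) F 0 k + (b N - trig j (lball (N + N0)) F 0 0)) (\<lambda>k. trig j (lball (N + N0)) F (Suc 0) k + 0)"
      by (rule has_pd_add[OF has_pd_trig]) (simp add: has_pd_def)
    moreover have "\<phi> N k = trig j (lball (N + N0)) F 0 k + (b N - trig j (lball (N + N0)) F 0 0)" for k
      by (simp add: \<phi>_def partial_symbol_eq_trig[of F _ _ j])
    ultimately show ?thesis by (simp add: has_pd_def)
  qed
  have Vr: "V k powr (real i - 2) \<le> V k ^ i * norm k powr 2" if "k \<in> S" for i k
    using S[OF that] by (intro powr_le_power_mult_powr) auto
  have base: "ctrl0 S (\<lambda>k. norm k powr - 2) (\<lambda>N k. 1 / \<phi> N k)"
    unfolding ctrl0_def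
  proof (intro conjI allI ballI exI)
    show "continuous_on UNIV (\<lambda>k. 1 / \<phi> N k)" for N
      by (intro continuous_intros cont) (metis pos less_irrefl)
    show "torus_periodic (\<lambda>k. 1 / \<phi> N k)" for N
      using per[of N] by (simp add: torus_periodic_def)
    fix k assume k: "k \<in> S"
    have low: "c * (norm k)\<^sup>2 \<le> \<phi> N k" for N
      using lower[of k N] S[OF k] b(1)[of N] by (simp add: \<phi>_def)
    have p: "0 < c * (norm k)\<^sup>2" using c S[OF k] by simp
    show "\<bar>1 / \<phi> N k\<bar> \<le> 1 / c * norm k powr - 2" for N
    proof -
      have "\<bar>1 / \<phi> N k\<bar> = 1 / \<phi> N k" using pos[of N k] by simp
      also have "\<dots> \<le> 1 / (c * (norm k)\<^sup>2)" by (rule divide_left_mono[OF low]) (use p pos in auto)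
      also have "\<dots> = 1 / c * norm k powr - 2"
        using S[OF k] by (simp add: powr_minus divide_inverse)
      finally show ?thesis .
    qed
    obtain l where l: "(\<lambda>N. \<phi> N k) \<longlonglongrightarrow> l"
    proof -
      have "(\<lambda>N. partial_symbol F (N + N0) k) \<longlonglongrightarrow> symbol F k"
        using dec by (intro LIMSEQ_ignore_initial_segment partial_symbol_tendsto) auto
      then have "convergent (\<lambda>N. \<phi> N k)"
        unfolding \<phi>_def by (intro convergent_add b) (auto simp: convergent_def)
      then show ?thesis using that unfolding convergent_def by blast
    qed
    have "c * (norm k)\<^sup>2 \<le> l" using low by (intro LIMSEQ_le_const[OF l]) auto
    then have "(\<lambda>N. 1 / \<phi> N k) \<longlonglongrightarrow> 1 / l"
      using p by (intro tendsto_intros l) auto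
    then show "convergent (\<lambda>N. 1 / \<phi> N k)" by (auto simp: convergent_def)
  qed
  have "ctrl j S V n' (\<lambda>k. V k / norm k powr - 2) (\<lambda>N k. - trig j (lball (N + N0)) F (Suc 0) k)"
  proof (rule ctrl_of_derivatives[where u = "\<lambda>m N k. - trig j (lball (N + N0)) F (Suc m) k"])
    show "continuous_on UNIV (\<lambda>k. - trig j (lball (N + N0)) F (Suc m) k)" for m N
      by (intro continuous_intros continuous_on_trig)
    show "torus_periodic (\<lambda>k. - trig j (lball (N + N0)) F (Suc m) k)" for m N
      using trig_periodic[of j "lball (N + N0)" F "Suc m"] by (simp add: torus_periodic_def)
    show "has_pd j (\<lambda>k. - trig j (lball (N + N0)) F (Suc m) k) (\<lambda>k. - trig j (lball (N + N0)) F (Suc (Suc m)) k)" for m N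
      using has_pd_trig[of j "lball (N + N0)" F "Suc m"] unfolding has_pd_def
      by (auto intro: has_vector_derivative_minus)
    fix m assume m: "m \<le> n'"
    show "convergent (\<lambda>N. - trig j (lball (N + N0)) F (Suc m) k)" if "k \<in> S" for k
      using conv[of "Suc m" k] m that
      by (simp add: n' convergent_minus_iff[symmetric] convergent_ignore_initial_segment[of "\<lambda>N. trig j (lball N) F (Suc m) k"])
    show "\<exists>C. \<forall>N. \<forall>k\<in>S. \<bar>- trig j (lball (N + N0)) F (Suc m) k\<bar> \<le> C * (V k ^ m * (V k / norm k powr - 2))"
    proof (cases "m = 0")
      case True
      \<comment> \<open>For the first derivative the dyadic bound is a mere constant, whereas a
        factor \<open>norm k\<close> is needed near the origin; it comes from the sine at the cost
        of one more moment.\<close>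
      have "\<bar>- trig j (lball (N + N0)) F (Suc m) k\<bar> \<le> abs_moment 2 F * (V k ^ m * (V k / norm k powr - 2))" if k: "k \<in> S" for N k
      proof -
        have "trig j (lball (N + N0)) F (Suc m) k = (\<Sum>x\<in>lball (N + N0). F x * (real_of_int (x $ j) * (- sin (k \<bullet> lvec x))))"
          unfolding trig_def True by (intro sum.cong) (auto simp: cos_add)
        also have "\<bar>\<dots>\<bar> \<le> norm k * abs_moment 2 F"
        proof (rule weighted_sum_le[OF dec])
          fix x :: "int ^ 'd"
          have "\<bar>real_of_int (x $ j)\<bar> * \<bar>sin (k \<bullet> lvec x)\<bar> \<le> lnorm x * (norm k * lnorm x)"
            using order_trans[OF abs_sin_x_le_abs_x inner_lvec_le]
            by (intro mult_mono abs_component_le_lnorm) (use lnorm_ge_1[of x] in auto)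
          also have "\<dots> = norm k * lnorm x powr 2"
            using lnorm_ge_1[of x] by (simp add: power2_eq_square)
          finally show "\<bar>real_of_int (x $ j) * - sin (k \<bullet> lvec x)\<bar> \<le> norm k * lnorm x powr 2"
            by (simp add: abs_mult)
        qed simp
        also have "norm k * abs_moment 2 F \<le> (V k * norm k * norm k) * abs_moment 2 F"
          using S[OF k] mult_right_mono[of 1 "V k * norm k" "norm k"]
          by (intro mult_right_mono abs_moment_nonneg) simp
        also have "\<dots> = abs_moment 2 F * (V k ^ m * (V k / norm k powr - 2))"
          using True S[OF k] by (simp add: powr_minus power2_eq_square divide_inverse)
        finally show ?thesis by simp
      qed
      then show ?thesis by blast
    next
      case False
      have "\<bar>- trig j (lball (N + N0)) F (Suc m) k\<bar> \<le> max C 0 * (V k ^ m * (V k / norm k powr - 2))" if k: "k \<in> S" for N k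
      proof -
        have "\<bar>- trig j (lball (N + N0)) F (Suc m) k\<bar> \<le> C * V k powr (max (real (Suc m) - 2 - \<sigma>) 0)"
          using bound[of "Suc m" k "N + N0"] m k n' by simp
        also have "\<dots> \<le> max C 0 * V k powr (real (Suc m) - 2)"
          using False \<sigma> S[OF k] by (intro mult_mono powr_mono) auto
        also have "\<dots> \<le> max C 0 * (V k ^ Suc m * norm k powr 2)"
          by (intro mult_left_mono Vr k) auto
        also have "\<dots> = max C 0 * (V k ^ m * (V k / norm k powr - 2))"
          using S[OF k] by (simp add: powr_minus divide_inverse)
        finally show ?thesis .
      qed
      then show ?thesis by blast
    qed
  qed
  then have "ctrl j S V (Suc n') (\<lambda>k. norm k powr - 2) (\<lambda>N k. 1 / \<phi> N k)"
    using pos[THEN less_imp_neq] S pd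
    by (intro ctrl_reciprocal[where \<phi>' = "\<lambda>N. trig j (lball (N + N0)) F 1"] base) (auto dest: not_sym)
  then show ?thesis unfolding \<phi>_def n' .
qed

text \<open>Low orders use the cancellation of the quadratic terms, which \<open>lam N\<close> makes
  exact at each truncation level. Once the order reaches \<open>2 + \<tau>\<close> no cancellation
  is required, and the dyadic bounds of the two kernels are simply added.\<close>

lemma ctrl_symbol_difference:
  fixes F A :: "int ^ 'd \<Rightarrow> real"
  assumes F: "lattice_symmetric F" "decays s F" and A: "lattice_symmetric A" "decays s A"
    and \<tau>: "0 < \<tau>" "\<tau> \<le> 2" "\<tau> \<le> \<sigma>" and s: "s > real CARD('d) + 2 + \<tau>"
    and mom: "\<And>N. lam N * moment2 F (N + N0) = moment2 A (N + N0)"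
    and lam: "\<And>N. \<bar>lam N\<bar> \<le> L" "convergent lam"
    and S: "\<And>k. k \<in> S \<Longrightarrow> k \<noteq> 0 \<and> 1 \<le> V k \<and> 1 \<le> V k * norm k"
    and boundF: "\<And>i N k. i \<le> n \<Longrightarrow> k \<in> S \<Longrightarrow> \<bar>trig j (lball N) F i k\<bar> \<le> C * V k powr (max (real i - 2 - \<sigma>) 0)"
    and convF: "\<And>i k. i \<le> n \<Longrightarrow> k \<in> S \<Longrightarrow> convergent (\<lambda>N. trig j (lball N) F i k)"
    and boundA: "\<And>i N k. i \<le> n \<Longrightarrow> k \<in> S \<Longrightarrow> \<bar>trig j (lball N) A i k\<bar> \<le> C * V k powr (max (real i - 2 - \<sigma>) 0)"
    and convA: "\<And>i k. i \<le> n \<Longrightarrow> k \<in> S \<Longrightarrow> convergent (\<lambda>N. trig j (lball N) A i k)"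
  shows "ctrl j S V n (\<lambda>k. norm k powr (2 + \<tau>))
    (\<lambda>N k. partial_symbol A (N + N0) k - lam N * partial_symbol F (N + N0) k)"
proof -
  define T where "T f m N k = trig j (lball (N + N0)) f m k - (if m = 0 then trig j (lball (N + N0)) f 0 0 else 0)"
    for f :: "int ^ 'd \<Rightarrow> real" and m N k
  have L0: "0 \<le> L" using order_trans[OF abs_ge_zero lam(1)] .
  have cont: "continuous_on UNIV (T f m N)" for f m N
    unfolding T_def by (intro continuous_intros continuous_on_trig)
  have per: "torus_periodic (T f m N)" for f m N
    using trig_periodic[of j "lball (N + N0)" f m] unfolding T_def torus_periodic_def by simp
  have pd: "has_pd j (T f m N) (T f (Suc m) N)" for f m N
  proof -
    have "has_pd j (\<lambda>k. trig j (lball (N + N0)) f m k + - (if m = 0 then trig j (lball (N + N0)) f 0 0 else 0)) (\<lambda>k. trig j (lball (N + N0)) f (Suc m) k + 0)"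
      by (rule has_pd_add[OF has_pd_trig]) (simp add: has_pd_def)
    then show ?thesis by (simp add: has_pd_def T_def)
  qed
  have convT: "convergent (\<lambda>N. T f m N k)"
    if "decays s f" "m \<le> n" "convergent (\<lambda>N. trig j (lball N) f m k)" for f m k
  proof (cases "m = 0")
    case True
    have "(\<lambda>N. partial_symbol f (N + N0) k) \<longlonglongrightarrow> symbol f k"
      using that s \<tau> by (intro LIMSEQ_ignore_initial_segment partial_symbol_tendsto) auto
    then show ?thesis using True by (auto simp: T_def partial_symbol_eq_trig[of f _ _ j] convergent_def)
  next
    case False
    then show ?thesis
      using that(3) by (simp add: T_def convergent_ignore_initial_segment[of "\<lambda>N. trig j (lball N) f m k"])
  qed
  have "ctrl j S V n (\<lambda>k. norm k powr (2 + \<tau>)) (\<lambda>N k. T A 0 N k + (- lam N) * T F 0 N k)"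
  proof (rule ctrl_of_derivatives[where u = "\<lambda>m N k. T A m N k + (- lam N) * T F m N k"])
    show "continuous_on UNIV (\<lambda>k. T A m N k + (- lam N) * T F m N k)" for m N
      by (intro continuous_intros cont)
    show "torus_periodic (\<lambda>k. T A m N k + (- lam N) * T F m N k)" for m N
      using per[of A m N] per[of F m N] by (simp add: torus_periodic_def)
    show "has_pd j (\<lambda>k. T A m N k + (- lam N) * T F m N k) (\<lambda>k. T A (Suc m) N k + (- lam N) * T F (Suc m) N k)" for m N
    proof (rule has_pd_add[OF pd])
      show "has_pd j (\<lambda>k. (- lam N) * T F m N k) (\<lambda>k. (- lam N) * T F (Suc m) N k)"
        using has_pd_mult[of j "\<lambda>_. - lam N" "\<lambda>_. 0", OF _ pd[of F m N]] by (simp add: has_pd_def)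
    qed
    fix m assume m: "m \<le> n"
    show "convergent (\<lambda>N. T A m N k + (- lam N) * T F m N k)" if k: "k \<in> S" for k
      using lam(2) unfolding convergent_minus_iff[of lam]
      by (intro convergent_add convergent_mult convT F A m convF convA k)
    show "\<exists>C. \<forall>N. \<forall>k\<in>S. \<bar>T A m N k + (- lam N) * T F m N k\<bar> \<le> C * (V k ^ m * norm k powr (2 + \<tau>))"
    proof (cases "m \<le> 2 \<or> m = 3 \<and> 1 < \<tau>")
      case True
      define B where "B = 2 * abs_moment (2 + \<tau>) A + L * (2 * abs_moment (2 + \<tau>) F)"
      have B0: "0 \<le> B" using L0 by (auto simp: B_def intro!: add_nonneg_nonneg mult_nonneg_nonneg abs_moment_nonneg)
      have "\<bar>T A m N k + (- lam N) * T F m N k\<bar> \<le> B * (V k ^ m * norm k powr (2 + \<tau>))" if k: "k \<in> S" for N k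
      proof -
        obtain Q where Q: "\<And>(f :: int ^ 'd \<Rightarrow> real) N. lattice_symmetric f \<Longrightarrow> decays s f \<Longrightarrow>
            \<bar>trig j (lball N) f m k - (if m = 0 then trig j (lball N) f 0 0 else 0) - Q * moment2 f N\<bar>
              \<le> 2 * norm k powr (2 + \<tau> - real m) * abs_moment (2 + \<tau>) f"
          using trig_low_order[OF \<tau>(1,2) True, where s = s and j = j and k = k] s by blast
        define a where "a = T A m N k - Q * moment2 A (N + N0)"
        define f where "f = T F m N k - Q * moment2 F (N + N0)"
        have a: "\<bar>a\<bar> \<le> 2 * norm k powr (2 + \<tau> - real m) * abs_moment (2 + \<tau>) A"
          unfolding a_def T_def by (rule Q[OF A])
        have f: "\<bar>f\<bar> \<le> 2 * norm k powr (2 + \<tau> - real m) * abs_moment (2 + \<tau>) F"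
          unfolding f_def T_def by (rule Q[OF F])
        have "T A m N k + (- lam N) * T F m N k = a - lam N * f"
          using mom[of N] by (simp add: a_def f_def algebra_simps)
        also have "\<bar>\<dots>\<bar> \<le> \<bar>a\<bar> + \<bar>lam N\<bar> * \<bar>f\<bar>"
          using abs_triangle_ineq4[of a "lam N * f"] by (simp add: abs_mult)
        also have "\<dots> \<le> 2 * norm k powr (2 + \<tau> - real m) * abs_moment (2 + \<tau>) A + L * (2 * norm k powr (2 + \<tau> - real m) * abs_moment (2 + \<tau>) F)"
          using L0 by (intro add_mono mult_mono a f lam) auto
        also have "\<dots> = B * norm k powr (2 + \<tau> - real m)"
          by (simp add: B_def algebra_simps)
        also have "\<dots> \<le> B * (V k ^ m * norm k powr (2 + \<tau>))"
        proof (rule mult_left_mono[OF _ B0])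
          have "1 \<le> (V k * norm k) ^ m" using S[OF k] by (intro one_le_power) auto
          then have "1 * norm k powr (2 + \<tau> - real m) \<le> (V k * norm k) ^ m * norm k powr (2 + \<tau> - real m)"
            by (intro mult_right_mono) auto
          also have "\<dots> = V k ^ m * (norm k powr real m * norm k powr (2 + \<tau> - real m))"
            using S[OF k] by (simp add: power_mult_distrib powr_realpow)
          also have "norm k powr real m * norm k powr (2 + \<tau> - real m) = norm k powr (2 + \<tau>)"
            by (simp flip: powr_add)
          finally show "norm k powr (2 + \<tau> - real m) \<le> V k ^ m * norm k powr (2 + \<tau>)" by simp
        qed
        finally show ?thesis .
      qed
      then show ?thesis by blast
    next
      case False
      \<comment> \<open>Outside the Taylor range either \<open>m \<ge> 4\<close>, and
        \<open>\<tau> \<le> 2\<close> suffices, or \<open>m = 3\<close> and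
        \<open>\<tau> \<le> 1\<close>.\<close>
      then have m3: "2 + \<tau> \<le> real m" and m0: "m \<noteq> 0"
        using \<tau> by (cases "m = 3"; auto)+
      define B where "B = max C 0 + L * max C 0"
      have "\<bar>T A m N k + (- lam N) * T F m N k\<bar> \<le> B * (V k ^ m * norm k powr (2 + \<tau>))" if k: "k \<in> S" for N k
      proof -
        let ?W = "V k ^ m * norm k powr (2 + \<tau>)"
        have *: "C * V k powr (max (real m - 2 - \<sigma>) 0) \<le> max C 0 * ?W"
        proof -
          have "V k powr (max (real m - 2 - \<sigma>) 0) \<le> V k powr (real m - (2 + \<tau>))"
            using S[OF k] m3 \<tau> by (intro powr_mono) auto
          also have "\<dots> \<le> ?W"
            using S[OF k] \<tau> by (intro powr_le_power_mult_powr) auto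
          finally show ?thesis by (intro mult_mono) auto
        qed
        have "\<bar>T A m N k\<bar> \<le> max C 0 * ?W" "\<bar>T F m N k\<bar> \<le> max C 0 * ?W"
          using order_trans[OF boundA[OF m k] *, of "N + N0"] order_trans[OF boundF[OF m k] *, of "N + N0"] m0
          by (simp_all add: T_def)
        then have "\<bar>T A m N k\<bar> + \<bar>lam N\<bar> * \<bar>T F m N k\<bar> \<le> max C 0 * ?W + L * (max C 0 * ?W)"
          using L0 by (intro add_mono mult_mono lam) auto
        moreover have "\<bar>T A m N k + (- lam N) * T F m N k\<bar> \<le> \<bar>T A m N k\<bar> + \<bar>lam N\<bar> * \<bar>T F m N k\<bar>"
          using abs_triangle_ineq4[of "T A m N k" "lam N * T F m N k"] by (simp add: abs_mult)
        ultimately show ?thesis by (simp add: B_def algebra_simps)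
      qed
      then show ?thesis by blast
    qed
  qed
  then show ?thesis
    by (simp add: T_def partial_symbol_eq_trig[of _ _ _ j])
qed

section \<open>Comparison of two kernels\<close>

text \<open>Equal masses and equal second moments make the difference of the reciprocals less
  singular than the bound \<open>O((norm k) powr - 2)\<close> for each of them, by a factor
  \<open>norm k powr \<tau>\<close>. The reciprocals alone would allow integrable derivatives only
  for \<open>n + 2 < d\<close>; the difference allows \<open>n + 2 - \<tau> < d\<close>.\<close>

lemma kernel_difference_coordinate_decay:
  fixes F A :: "int ^ 'd \<Rightarrow> real" and j :: 'd
  assumes KF: "kernel s c F" and KA: "kernel s c' A" and s: "s = real CARD('d) + 2 + \<rho>" and m: "0 \<le> m"
    and mom: "(\<Sum>\<^sub>\<infinity>x\<in>UNIV. (norm (lvec x))\<^sup>2 * F x) = (\<Sum>\<^sub>\<infinity>x\<in>UNIV. (norm (lvec x))\<^sup>2 * A x)"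
    and \<tau>: "0 < \<tau>" "\<tau> \<le> 2" "\<tau> \<le> \<sigma>" and \<sigma>: "\<sigma> < \<rho>"
    and D: "0 < D" "D < real CARD('d)" "2 * (real n - 2 - \<sigma>) \<le> D" "real n + 2 - \<tau> \<le> D" and n: "1 \<le> n"
  shows "((\<lambda>x. real_of_int (x $ j) ^ n * fourier_integral (\<lambda>k. complex_of_real (1 / (m + symbol F k) - 1 / (m + symbol A k))) x) \<longlongrightarrow> 0) lattice_at_infinity"
proof -
  have F: "lattice_symmetric F" "decays s F" "0 < c" and A: "lattice_symmetric A" "decays s A" "0 < c'"
    using KF KA by (auto simp: kernel_def)
  have s2: "s > real CARD('d) + 2" "s > real CARD('d)" "s > real CARD('d) + 2 + \<tau>" using s \<tau> \<sigma> by auto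
  define e where "e i = max (real i - 2 - \<sigma>) 0" for i
  have \<rho>0: "0 \<le> \<rho>" using \<tau> \<sigma> by linarith
  obtain UF CF where UF: "integrable torus_measure UF" "\<And>k. 0 \<le> UF k"
    "AE k in torus_measure. \<forall>i\<le>n. convergent (\<lambda>N. trig j (lball N) F i k) \<and>
       (\<forall>N. \<bar>trig j (lball N) F i k\<bar> \<le> CF * (1 + UF k) powr (e i / D))"
    using dyadic_control[OF F(2)[unfolded s] \<sigma> \<rho>0 D(1-3)] unfolding e_def by blast
  obtain UA CA where UA: "integrable torus_measure UA" "\<And>k. 0 \<le> UA k"
    "AE k in torus_measure. \<forall>i\<le>n. convergent (\<lambda>N. trig j (lball N) A i k) \<and>
       (\<forall>N. \<bar>trig j (lball N) A i k\<bar> \<le> CA * (1 + UA k) powr (e i / D))"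
    using dyadic_control[OF A(2)[unfolded s] \<sigma> \<rho>0 D(1-3)] unfolding e_def by blast
  \<comment> \<open>One integrable weight for both kernels. The constant makes its root
    \<open>V\<close> at least 1, the dyadic functions bound the derivatives, and the last term makes
    \<open>V\<close> at least \<open>1 / norm k\<close>.\<close>
  define W where "W k = 1 + UF k + UA k + norm k powr - D" for k
  define V where "V k = W k powr (1 / D)" for k
  define S where "S = {k \<in> torus. k \<noteq> 0 \<and>
    (\<forall>i\<le>n. convergent (\<lambda>N. trig j (lball N) F i k) \<and> (\<forall>N. \<bar>trig j (lball N) F i k\<bar> \<le> CF * (1 + UF k) powr (e i / D))) \<and>
    (\<forall>i\<le>n. convergent (\<lambda>N. trig j (lball N) A i k) \<and> (\<forall>N. \<bar>trig j (lball N) A i k\<bar> \<le> CA * (1 + UA k) powr (e i / D)))}"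
  have AE_S: "AE k in torus_measure. k \<in> S"
    using AE_torus_nonzero UF(3) UA(3) AE_space by eventually_elim (simp add: S_def)
  have W1: "1 \<le> W k" for k using UF(2)[of k] UA(2)[of k] by (simp add: W_def add_nonneg_nonneg)
  have Wint: "integrable torus_measure W"
    unfolding W_def using UF(1) UA(1) D by (intro Bochner_Integration.integrable_add integrable_norm_powr) auto
  have [measurable]: "W \<in> borel_measurable torus_measure" using Wint by auto
  have Vpow: "V k powr a = W k powr (a / D)" for k a
    by (simp add: V_def powr_powr)
  have V1: "1 \<le> V k" for k
    unfolding V_def using W1[of k] D by (intro ge_one_powr_ge_zero) auto
  have Vr: "1 \<le> V k * norm k" if "k \<noteq> 0" for k
  proof -
    have "(norm k powr - D) powr (1 / D) \<le> V k"
      unfolding V_def using UF(2)[of k] UA(2)[of k] D by (intro powr_mono2) (auto simp: W_def)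
    moreover have "(norm k powr - D) powr (1 / D) = inverse (norm k)"
      using that D by (simp only: powr_powr) (simp add: powr_minus)
    ultimately have "inverse (norm k) \<le> V k" by simp
    then show ?thesis using that by (simp add: field_simps)
  qed
  have SV: "k \<in> torus \<and> k \<noteq> 0 \<and> 1 \<le> V k \<and> 1 \<le> V k * norm k" if "k \<in> S" for k
    using that V1 Vr by (auto simp: S_def)
  define C where "C = max (max CF CA) 0"
  have convF: "convergent (\<lambda>N. trig j (lball N) F i k)" and convA: "convergent (\<lambda>N. trig j (lball N) A i k)"
    if "i \<le> n" "k \<in> S" for i k
    using that by (auto simp: S_def)
  have pw: "B * (1 + U) powr (e i / D) \<le> C * V k powr (max (real i - 2 - \<sigma>) 0)" if "1 + U \<le> W k" "0 \<le> U" "B \<le> C" for B U i k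
    unfolding Vpow e_def using that D by (intro mult_mono powr_mono2) (auto simp: C_def)
  have boundF: "\<bar>trig j (lball N) F i k\<bar> \<le> C * V k powr (max (real i - 2 - \<sigma>) 0)"
    if "i \<le> n" "k \<in> S" for i N k
  proof -
    have "\<bar>trig j (lball N) F i k\<bar> \<le> CF * (1 + UF k) powr (e i / D)" using that by (auto simp: S_def)
    also have "\<dots> \<le> C * V k powr (max (real i - 2 - \<sigma>) 0)"
      using UF(2)[of k] UA(2)[of k] by (intro pw) (auto simp: W_def C_def)
    finally show ?thesis .
  qed
  have boundA: "\<bar>trig j (lball N) A i k\<bar> \<le> C * V k powr (max (real i - 2 - \<sigma>) 0)"
    if "i \<le> n" "k \<in> S" for i N k
  proof -
    have "\<bar>trig j (lball N) A i k\<bar> \<le> CA * (1 + UA k) powr (e i / D)" using that by (auto simp: S_def)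
    also have "\<dots> \<le> C * V k powr (max (real i - 2 - \<sigma>) 0)"
      using UF(2)[of k] UA(2)[of k] by (intro pw) (auto simp: W_def C_def)
    finally show ?thesis .
  qed
  define M where "M = (\<Sum>\<^sub>\<infinity>x\<in>UNIV. (norm (lvec x))\<^sup>2 * F x)"
  have M: "M < 0" unfolding M_def by (rule kernel_moment2_neg[OF KF s2(1)])
  have MF: "moment2 F \<longlonglongrightarrow> M" unfolding M_def by (rule moment2_tendsto[OF F(2) s2(1)])
  have MA: "moment2 A \<longlonglongrightarrow> M" unfolding M_def mom by (rule moment2_tendsto[OF A(2) s2(1)])
  obtain N1 where N1: "\<And>N k. N \<ge> N1 \<Longrightarrow> k \<in> torus \<Longrightarrow> c / 2 * (norm k)\<^sup>2 \<le> partial_symbol F N k"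
    using kernel_partial_lower_bound[OF KF s2(1)] by blast
  obtain N2 where N2: "\<And>N k. N \<ge> N2 \<Longrightarrow> k \<in> torus \<Longrightarrow> c' / 2 * (norm k)\<^sup>2 \<le> partial_symbol A N k"
    using kernel_partial_lower_bound[OF KA s2(1)] by blast
  obtain N3 where N3: "\<And>N. N \<ge> N3 \<Longrightarrow> moment2 F N < 0"
    using order_tendstoD(2)[OF MF M] unfolding eventually_sequentially by blast
  obtain N4 where N4: "\<And>N. N \<ge> N4 \<Longrightarrow> moment2 A N < 0"
    using order_tendstoD(2)[OF MA M] unfolding eventually_sequentially by blast
  define N0 where "N0 = N1 + N2 + N3 + N4"
  \<comment> \<open>restores the equality of second moments, which truncation destroys\<close>
  define lam where "lam N = moment2 A (N + N0) / moment2 F (N + N0)" for N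
  have MF0: "moment2 F (N + N0) < 0" and MA0: "moment2 A (N + N0) < 0" for N
    using N3[of "N + N0"] N4[of "N + N0"] by (auto simp: N0_def)
  have lam_pos: "0 < lam N" for N
    using MF0[of N] MA0[of N] by (simp add: lam_def divide_neg_neg)
  have lam_mom: "lam N * moment2 F (N + N0) = moment2 A (N + N0)" for N
    using MF0[of N] by (simp add: lam_def)
  have "lam \<longlonglongrightarrow> M / M"
    unfolding lam_def using M by (intro tendsto_divide LIMSEQ_ignore_initial_segment MF MA) auto
  then have lam1: "lam \<longlonglongrightarrow> 1" using M by simp
  then have lam_conv: "convergent lam" by (auto simp: convergent_def)
  obtain L where L: "\<And>N. \<bar>lam N\<bar> \<le> L"
    using convergent_imp_Bseq[OF lam_conv] by (auto simp: Bseq_def)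
  \<comment> \<open>The added term matters for \<open>m = 0\<close>, where the unshifted truncated
    denominators vanish at the origin.\<close>
  define b where "b N = m + 1 / real (Suc N)" for N
  have b0: "0 < b N" for N using m by (simp add: b_def add_nonneg_pos)
  have "(\<lambda>N. 1 / real (Suc N)) \<longlonglongrightarrow> 0"
    using LIMSEQ_inverse_real_of_nat by (simp only: inverse_eq_divide)
  then have "b \<longlonglongrightarrow> m + 0" unfolding b_def by (intro tendsto_add tendsto_const)
  then have bm: "b \<longlonglongrightarrow> m" by simp
  have lbm: "(\<lambda>N. lam N * b N) \<longlonglongrightarrow> m" using tendsto_mult[OF lam1 bm] by simp
  define \<phi> where "\<phi> N k = b N + partial_symbol F (N + N0) k" for N k
  \<comment> \<open>The shift of the second kernel carries the factor \<open>lam N\<close> so that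
    it drops out of \<open>\<alpha> N k - lam N * \<phi> N k\<close>, leaving
    \<open>\<eta> N k\<close> without a constant term at the origin.\<close>
  define \<alpha> where "\<alpha> N k = lam N * b N + partial_symbol A (N + N0) k" for N k
  define \<eta> where "\<eta> N k = partial_symbol A (N + N0) k - lam N * partial_symbol F (N + N0) k" for N k
  have \<sigma>0: "0 \<le> \<sigma>" using \<tau> by linarith
  have c\<phi>: "ctrl j S V n (\<lambda>k. norm k powr - 2) (\<lambda>N k. 1 / \<phi> N k)"
    unfolding \<phi>_def
  proof (rule ctrl_reciprocal_symbol[OF F(2) s2(1) b0 _ _ _ SV boundF convF n \<sigma>0, where c = "c / 2"])
    show "c / 2 * (norm k)\<^sup>2 \<le> partial_symbol F (N + N0) k" if "k \<in> torus" for N k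
      using N1[OF _ that] by (simp add: N0_def)
  qed (use bm F in \<open>auto simp: convergent_def\<close>)
  have c\<alpha>: "ctrl j S V n (\<lambda>k. norm k powr - 2) (\<lambda>N k. 1 / \<alpha> N k)"
    unfolding \<alpha>_def
  proof (rule ctrl_reciprocal_symbol[OF A(2) s2(1) _ _ _ _ SV boundA convA n \<sigma>0, where c = "c' / 2"])
    show "c' / 2 * (norm k)\<^sup>2 \<le> partial_symbol A (N + N0) k" if "k \<in> torus" for N k
      using N2[OF _ that] by (simp add: N0_def)
    show "0 < lam N * b N" for N using lam_pos b0 by simp
  qed (use lbm A in \<open>auto simp: convergent_def\<close>)
  have c\<eta>: "ctrl j S V n (\<lambda>k. norm k powr (2 + \<tau>)) \<eta>"
    unfolding \<eta>_def
    by (rule ctrl_symbol_difference[OF F(1,2) A(1,2) \<tau> s2(3) lam_mom L lam_conv _ boundF convF boundA convA])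
       (use SV in auto)
  have cont_nz: "\<phi> N k \<noteq> 0" "\<alpha> N k \<noteq> 0" if "k \<in> torus" for N k
  proof -
    have "0 \<le> c / 2 * (norm k)\<^sup>2" "0 \<le> c' / 2 * (norm k)\<^sup>2" using F A by auto
    then have "0 \<le> partial_symbol F (N + N0) k" "0 \<le> partial_symbol A (N + N0) k"
      using N1[of "N + N0" k] N2[of "N + N0" k] that by (auto simp: N0_def)
    moreover have "0 < lam N * b N" using lam_pos b0 by simp
    ultimately show "\<phi> N k \<noteq> 0" "\<alpha> N k \<noteq> 0"
      using b0[of N] unfolding \<phi>_def \<alpha>_def by linarith+
  qed
  \<comment> \<open>On the torus this is \<open>1 / \<phi> N k - lam N / \<alpha> N k\<close>. As a
    product it falls under the closure lemmas, with the exponents \<open>2 + \<tau>\<close>,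
    \<open>- 2\<close> and \<open>- 2\<close> adding up to \<open>\<tau> - 2\<close>.\<close>
  define g where "g N k = \<eta> N k * (1 / \<phi> N k * (1 / \<alpha> N k))" for N k
  have cg: "ctrl j S V n (\<lambda>k. norm k powr (\<tau> - 2)) g"
    unfolding g_def
  proof (rule ctrl_cong[OF ctrl_mult[OF c\<eta> ctrl_mult[OF c\<phi> c\<alpha>]]])
    show "norm k powr (2 + \<tau>) * (norm k powr - 2 * norm k powr - 2) = norm k powr (\<tau> - 2)" for k :: "real ^ 'd"
      unfolding powr_add[symmetric] by (simp add: algebra_simps)
  qed
  have lim_g: "lim (\<lambda>N. g N k) = 1 / (m + symbol F k) - 1 / (m + symbol A k)" if k: "k \<in> S" for k
  proof (rule limI)
    have kt: "k \<in> torus" "k \<noteq> 0" using SV[OF k] by auto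
    have sF: "(\<lambda>N. partial_symbol F (N + N0) k) \<longlonglongrightarrow> symbol F k"
      by (intro LIMSEQ_ignore_initial_segment partial_symbol_tendsto[OF F(2) s2(2)])
    have sA: "(\<lambda>N. partial_symbol A (N + N0) k) \<longlonglongrightarrow> symbol A k"
      by (intro LIMSEQ_ignore_initial_segment partial_symbol_tendsto[OF A(2) s2(2)])
    have "0 < c * (norm k)\<^sup>2" "0 < c' * (norm k)\<^sup>2" using F A kt by auto
    moreover have "c * (norm k)\<^sup>2 \<le> symbol F k" "c' * (norm k)\<^sup>2 \<le> symbol A k"
      using KF KA kt by (auto simp: kernel_def)
    ultimately have nz: "m + symbol F k \<noteq> 0" "m + symbol A k \<noteq> 0" using m by linarith+
    have "g N k = 1 / \<phi> N k - lam N * (1 / \<alpha> N k)" for N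
    proof -
      have "\<eta> N k = \<alpha> N k - lam N * \<phi> N k"
        by (simp add: \<eta>_def \<alpha>_def \<phi>_def algebra_simps)
      then show ?thesis
        using cont_nz[OF kt(1), of N] by (simp add: g_def field_simps)
    qed
    moreover have "(\<lambda>N. 1 / \<phi> N k - lam N * (1 / \<alpha> N k)) \<longlonglongrightarrow> 1 / (m + symbol F k) - 1 * (1 / (m + symbol A k))"
      unfolding \<phi>_def \<alpha>_def by (intro tendsto_intros bm lbm lam1 sF sA nz)
    ultimately show "(\<lambda>N. g N k) \<longlonglongrightarrow> 1 / (m + symbol F k) - 1 / (m + symbol A k)" by simp
  qed
  have wint: "integrable torus_measure (\<lambda>k :: real ^ 'd. norm k powr (\<tau> - 2))"
    using integrable_norm_powr[where 'd = 'd, of "2 - \<tau>"] D n \<tau> by simp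
  have Vint: "integrable torus_measure (\<lambda>k. V k ^ n * norm k powr (\<tau> - 2))"
  proof (rule Bochner_Integration.integrable_bound[OF Wint])
    show "(\<lambda>k. V k ^ n * norm k powr (\<tau> - 2)) \<in> borel_measurable torus_measure"
      using borel_measurable_integrable[OF wint] unfolding V_def by measurable
    show "AE k in torus_measure. norm (V k ^ n * norm k powr (\<tau> - 2)) \<le> norm (W k)"
      using AE_S
    proof eventually_elim
      case (elim k)
      have nk: "0 < norm k" "1 \<le> V k * norm k" using SV[OF elim] by auto
      have "1 \<le> (V k * norm k) powr (2 - \<tau>)" using nk \<tau> by (intro ge_one_powr_ge_zero) auto
      then have "norm k powr (\<tau> - 2) * 1 \<le> norm k powr (\<tau> - 2) * (V k powr (2 - \<tau>) * norm k powr (2 - \<tau>))"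
        using V1[of k] nk by (intro mult_left_mono) (auto simp: powr_mult)
      also have "\<dots> = V k powr (2 - \<tau>) * (norm k powr (\<tau> - 2) * norm k powr (2 - \<tau>))"
        by (simp only: mult_ac)
      also have "norm k powr (\<tau> - 2) * norm k powr (2 - \<tau>) = 1"
        unfolding powr_add[symmetric] using nk by simp
      finally have "V k ^ n * norm k powr (\<tau> - 2) \<le> V k ^ n * V k powr (2 - \<tau>)"
        using V1[of k] by (intro mult_left_mono) auto
      also have "\<dots> = V k powr (real n + 2 - \<tau>)"
        using V1[of k] by (simp add: powr_realpow[symmetric] powr_add[symmetric] algebra_simps)
      also have "\<dots> \<le> V k powr D" using V1[of k] D by (intro powr_mono) auto
      also have "\<dots> = W k" using D W1[of k] by (simp add: Vpow)
      finally show ?case using V1[of k] W1[of k] by simp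
    qed
  qed
  have dec: "((\<lambda>x. real_of_int (x $ j) ^ n * fourier_integral (\<lambda>k. complex_of_real (lim (\<lambda>N. g N k))) x) \<longlongrightarrow> 0) lattice_at_infinity"
    by (rule ctrl_coordinate_decay[OF cg AE_S wint Vint])
  have "fourier_integral (\<lambda>k. complex_of_real (lim (\<lambda>N. g N k))) x
      = fourier_integral (\<lambda>k. complex_of_real (1 / (m + symbol F k) - 1 / (m + symbol A k))) x" for x
    unfolding fourier_integral_eq
  proof (intro arg_cong2[where f = "(/)"] refl integral_cong_AE)
    have [measurable]: "symbol F \<in> borel_measurable borel" "symbol A \<in> borel_measurable borel"
      using symbol_measurable F(2) A(2) s2(2) by blast+
    have "(\<lambda>k. complex_of_real (lim (\<lambda>N. g N k))) \<in> borel_measurable torus_measure"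
      using ctrl0_limit(1)[OF ctrl_imp_ctrl0[OF cg] AE_S wint] by auto
    then show "(\<lambda>k. character (- x) k * complex_of_real (lim (\<lambda>N. g N k))) \<in> borel_measurable torus_measure"
      by (intro borel_measurable_times measurable_torus_measure[OF character_measurable])
    show "(\<lambda>k. character (- x) k * complex_of_real (1 / (m + symbol F k) - 1 / (m + symbol A k))) \<in> borel_measurable torus_measure"
      by (intro measurable_torus_measure borel_measurable_times character_measurable) measurable
    show "AE k in torus_measure. character (- x) k * complex_of_real (lim (\<lambda>N. g N k))
        = character (- x) k * complex_of_real (1 / (m + symbol F k) - 1 / (m + symbol A k))"
      using AE_S by eventually_elim (simp only: lim_g)
  qed
  then show ?thesis using dec by simp
qed

lemma kernel_difference_decay:
  fixes F A :: "int ^ 'd \<Rightarrow> real"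
  assumes dim: "CARD('d) > 2" and KF: "kernel (real CARD('d) + 2 + \<rho>) c F" and KA: "kernel (real CARD('d) + 2 + \<rho>) c' A"
    and m: "0 \<le> m"
    and mom: "(\<Sum>\<^sub>\<infinity>x\<in>UNIV. (norm (lvec x))\<^sup>2 * F x) = (\<Sum>\<^sub>\<infinity>x\<in>UNIV. (norm (lvec x))\<^sup>2 * A x)"
    and s0: "s0 \<le> 1" and \<rho>: "\<rho> > real s0 + max ((real CARD('d) - 8) / 2) 0"
  shows "fourier_integral (\<lambda>k. complex_of_real (1 / (m + symbol F k) - 1 / (m + symbol A k)))
    \<in> o[lattice_at_infinity](\<lambda>x. complex_of_real (1 / norm (lvec x) ^ (CARD('d) - 2 + s0)))"
proof (rule smallo_of_coordinate_decay)
  fix j :: 'd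
  let ?d = "real CARD('d)"
  let ?n = "CARD('d) - 2 + s0"
  have n: "real ?n = ?d - 2 + real s0" using dim by simp
  \<comment> \<open>Both \<open>\<sigma>\<close> and, below, \<open>D\<close> are midpoints, which
    makes the required inequalities strict on both sides. The cap in \<open>\<tau>\<close> reflects
    that the remainder of the cosine after the quadratic term is of order 4.\<close>
  define \<sigma> where "\<sigma> = (real s0 + max ((?d - 8) / 2) 0 + \<rho>) / 2"
  define \<tau> where "\<tau> = min \<sigma> 2"
  define D where "D = (max (max (real ?n + 2 - \<tau>) (2 * (real ?n - 2 - \<sigma>))) 0 + ?d) / 2"
  have \<sigma>: "real s0 + max ((?d - 8) / 2) 0 < \<sigma>" "\<sigma> < \<rho>"
    using \<rho> by (auto simp: \<sigma>_def)
  have \<tau>: "real s0 < \<tau>" "\<tau> \<le> 2" "\<tau> \<le> \<sigma>"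
    using \<sigma> s0 by (auto simp: \<tau>_def)
  have d0: "0 < ?d" using dim by simp
  \<comment> \<open>With \<open>n = d - 2 + s0\<close> these read \<open>s0 < \<tau>\<close> and
    \<open>d - 8 + 2 * s0 < 2 * \<sigma>\<close>.\<close>
  have "real ?n + 2 - \<tau> < ?d" "2 * (real ?n - 2 - \<sigma>) < ?d"
    using \<tau> \<sigma> unfolding n by (auto simp: max_def field_simps split: if_splits)
  then have D: "0 < D" "D < ?d" "2 * (real ?n - 2 - \<sigma>) \<le> D" "real ?n + 2 - \<tau> \<le> D"
    using d0 unfolding D_def by (auto simp: max_def)
  show "((\<lambda>x. real_of_int (x $ j) ^ ?n * fourier_integral (\<lambda>k. complex_of_real (1 / (m + symbol F k) - 1 / (m + symbol A k))) x) \<longlongrightarrow> 0) lattice_at_infinity"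
    using dim \<tau> by (intro kernel_difference_coordinate_decay[OF KF KA refl m mom _ \<tau>(2,3) \<sigma>(2) D]) auto
qed

section \<open>Convolution equation and the random walk kernel\<close>

lemma summable_bounded_multiple:
  fixes F :: "int ^ 'd \<Rightarrow> real"
  assumes "decays s F" "s > real CARD('d)" and u: "\<And>x. cmod (u x) \<le> B"
  shows "(\<lambda>x. complex_of_real (F x) * u x) summable_on UNIV"
proof (rule abs_summable_summable)
  have "(\<lambda>x. \<bar>F x\<bar> * lnorm x powr 0 * B) summable_on UNIV"
    using assms by (intro summable_on_cmult_left decays_moment_summable) auto
  then show "(\<lambda>x. norm (complex_of_real (F x) * u x)) summable_on UNIV"
  proof (rule summable_on_comparison_test)
    show "norm (complex_of_real (F x) * u x) \<le> \<bar>F x\<bar> * lnorm x powr 0 * B" for x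
      using u[of x] lnorm_ge_1[of x] by (simp add: norm_mult mult_left_mono)
  qed auto
qed

lemma fourier_partial_sums:
  fixes F :: "int ^ 'd \<Rightarrow> real"
  assumes "decays s F" "s > real CARD('d)"
  shows "(\<lambda>N. \<Sum>x\<in>lball N. complex_of_real (F x) * character x k) \<longlonglongrightarrow> fourier F k"
  unfolding fourier_def
  by (intro sum_lball_tendsto_infsum summable_bounded_multiple[OF assms, where B = 1]) simp

lemma symbol_eq_fourier:
  fixes F :: "int ^ 'd \<Rightarrow> real"
  assumes "decays s F" "s > real CARD('d)"
  shows "symbol F k = Re (fourier F k) - Re (fourier F 0)"
proof (rule LIMSEQ_unique[OF partial_symbol_tendsto[OF assms]])
  have re: "Re (\<Sum>x\<in>lball N. complex_of_real (F x) * character x k) = (\<Sum>x\<in>lball N. F x * cos (k \<bullet> lvec x))" for N k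
    by (simp add: cis_conv_exp[symmetric])
  have "(\<lambda>N. Re (\<Sum>x\<in>lball N. complex_of_real (F x) * character x k) - Re (\<Sum>x\<in>lball N. complex_of_real (F x) * character x 0))
      \<longlonglongrightarrow> Re (fourier F k) - Re (fourier F 0)"
    by (intro tendsto_intros fourier_partial_sums[OF assms])
  then show "(\<lambda>N. partial_symbol F N k) \<longlonglongrightarrow> Re (fourier F k) - Re (fourier F 0)"
    unfolding re partial_symbol_def by (simp add: sum_subtractf[symmetric] right_diff_distrib)
qed

text \<open>The infrared bound dominates the reciprocal by a multiple of
  \<open>norm k powr - 2\<close>, which is integrable since \<open>d > 2\<close>.\<close>

lemma kernel_reciprocal_integrable:
  fixes F :: "int ^ 'd \<Rightarrow> real"
  assumes F: "kernel s c F" and s: "s > real CARD('d)" and dim: "CARD('d) > 2" and m: "0 \<le> m"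
  shows "integrable torus_measure (\<lambda>k. 1 / (m + symbol F k))"
proof (rule Bochner_Integration.integrable_bound)
  have K: "decays s F" "0 < c" "\<And>k. k \<in> torus \<Longrightarrow> c * (norm k)\<^sup>2 \<le> symbol F k"
    using F by (auto simp: kernel_def)
  show "integrable torus_measure (\<lambda>k :: real ^ 'd. 1 / c * norm k powr - 2)"
    using dim by (intro integrable_mult_right integrable_norm_powr) auto
  have [measurable]: "symbol F \<in> borel_measurable borel"
    by (rule symbol_measurable[OF K(1) s])
  show "(\<lambda>k. 1 / (m + symbol F k)) \<in> borel_measurable torus_measure" by measurable
  show "AE k in torus_measure. norm (1 / (m + symbol F k)) \<le> norm (1 / c * norm k powr - 2)"
    using AE_torus_nonzero AE_space
  proof eventually_elim
    case (elim k)
    have p: "0 < c * (norm k)\<^sup>2" using K(2) elim by simp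
    have le: "c * (norm k)\<^sup>2 \<le> m + symbol F k" using K(3)[of k] elim m by simp
    have "norm (1 / (m + symbol F k)) = 1 / (m + symbol F k)" using p le by simp
    also have "\<dots> \<le> 1 / (c * (norm k)\<^sup>2)" using p le by (intro divide_left_mono) auto
    also have "\<dots> = norm (1 / c * norm k powr - 2)"
      using elim K(2) by (simp add: powr_minus divide_inverse)
    finally show ?case .
  qed
qed

lemma fourier_integral_linear:
  fixes g h :: "real ^ 'd \<Rightarrow> complex"
  assumes "integrable torus_measure g" "integrable torus_measure h"
  shows "fourier_integral (\<lambda>k. a * (g k - h k)) x = a * (fourier_integral g x - fourier_integral h x)"
proof -
  have "(LINT k|torus_measure. character (- x) k * (a * (g k - h k)))
      = (LINT k|torus_measure. a * (character (- x) k * g k - character (- x) k * h k))"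
    by (intro Bochner_Integration.integral_cong refl) (simp add: algebra_simps)
  also have "\<dots> = a * ((LINT k|torus_measure. character (- x) k * g k) - (LINT k|torus_measure. character (- x) k * h k))"
    by (simp only: integral_mult_right_zero Bochner_Integration.integral_diff[OF integrable_character_mult[OF assms(1)] integrable_character_mult[OF assms(2)]])
  finally show ?thesis
    by (simp only: fourier_integral_eq diff_divide_distrib right_diff_distrib times_divide_eq_right)
qed

text \<open>A partial sum of the convolution is one integral, of a truncated transform divided by
  the full one. The truncated transforms are bounded by the sum of the
  \<open>\<bar>F y\<bar>\<close>, so dominated convergence replaces the quotient by 1 and
  orthogonality of characters finishes.\<close>

lemma convolution_fourier_integral:
  fixes F :: "int ^ 'd \<Rightarrow> real"
  assumes dec: "decays s F" "s > real CARD('d)"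
    and int: "integrable torus_measure (\<lambda>k. 1 / fourier F k)"
    and nz: "AE k in torus_measure. fourier F k \<noteq> 0"
  shows "convolution (\<lambda>x. complex_of_real (F x)) (fourier_integral (\<lambda>k. 1 / fourier F k)) = lattice_delta"
proof
  fix x :: "int ^ 'd"
  let ?G = "fourier_integral (\<lambda>k. 1 / fourier F k)"
  let ?c = "(2 * complex_of_real pi) ^ CARD('d)"
  define P where "P N k = (\<Sum>y\<in>lball N. complex_of_real (F y) * character y k)" for N k
  have P: "(\<lambda>N. P N k) \<longlonglongrightarrow> fourier F k" for k
    unfolding P_def by (rule fourier_partial_sums[OF dec])
  have "(\<lambda>y. complex_of_real (F y) * ?G (x - y)) summable_on UNIV"
    using norm_fourier_integral_le[OF int] by (intro summable_bounded_multiple[OF dec])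
  then have lim1: "(\<lambda>N. \<Sum>y\<in>lball N. complex_of_real (F y) * ?G (x - y)) \<longlonglongrightarrow> convolution (\<lambda>x. complex_of_real (F x)) ?G x"
    unfolding convolution_def by (rule sum_lball_tendsto_infsum)
  have eq: "(\<Sum>y\<in>lball N. complex_of_real (F y) * ?G (x - y))
      = (LINT k|torus_measure. character (- x) k * (P N k * (1 / fourier F k))) / ?c" for N
  proof -
    have ch: "character (- (x - y)) k = character (- x) k * character y k" for y k
      unfolding character_add[symmetric] by simp
    have i: "integrable torus_measure (\<lambda>k. complex_of_real (F y) * (character (- (x - y)) k * (1 / fourier F k)))" for y
      by (intro integrable_mult_right integrable_character_mult int)
    have "(\<Sum>y\<in>lball N. complex_of_real (F y) * ?G (x - y))
        = (\<Sum>y\<in>lball N. (LINT k|torus_measure. complex_of_real (F y) * (character (- (x - y)) k * (1 / fourier F k)))) / ?c"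
      unfolding fourier_integral_eq sum_divide_distrib integral_mult_right_zero by simp
    also have "\<dots> = (LINT k|torus_measure. (\<Sum>y\<in>lball N. complex_of_real (F y) * (character (- (x - y)) k * (1 / fourier F k)))) / ?c"
      by (simp only: Bochner_Integration.integral_sum[OF i])
    also have "(\<lambda>k. \<Sum>y\<in>lball N. complex_of_real (F y) * (character (- (x - y)) k * (1 / fourier F k)))
        = (\<lambda>k. character (- x) k * (P N k * (1 / fourier F k)))"
      unfolding ch P_def sum_distrib_left sum_distrib_right by (simp only: mult_ac)
    finally show ?thesis .
  qed
  define B where "B = abs_moment 0 F"
  have PB: "cmod (P N k) \<le> B" for N k
  proof -
    have "cmod (P N k) \<le> (\<Sum>y\<in>lball N. \<bar>F y\<bar> * lnorm y powr 0)"
    proof (unfold P_def, intro order_trans[OF norm_sum] sum_mono)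
      show "norm (complex_of_real (F y) * character y k) \<le> \<bar>F y\<bar> * lnorm y powr 0" for y
        using lnorm_ge_1[of y] by (simp add: norm_mult)
    qed
    also have "\<dots> \<le> B"
      unfolding B_def using dec by (intro partial_abs_moment_le) auto
    finally show ?thesis .
  qed
  have [measurable]: "P N \<in> borel_measurable borel" for N
    unfolding P_def by (intro borel_measurable_continuous_onI continuous_intros)
  have im: "(\<lambda>k. 1 / fourier F k) \<in> borel_measurable torus_measure" using int by auto
  have "(\<lambda>N. LINT k|torus_measure. character (- x) k * (P N k * (1 / fourier F k)))
      \<longlonglongrightarrow> (LINT k|torus_measure. character (- x) k)"
  proof (rule integral_dominated_convergence[where w = "\<lambda>k. B * cmod (1 / fourier F k)"])
    show "integrable torus_measure (\<lambda>k. B * cmod (1 / fourier F k))"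
      using integrable_norm[OF int] by (rule integrable_mult_right)
    show "(\<lambda>k. character (- x) k * (P N k * (1 / fourier F k))) \<in> borel_measurable torus_measure" for N
      by (intro borel_measurable_times im measurable_torus_measure[OF character_measurable]) measurable
    show "(character (- x) :: real ^ 'd \<Rightarrow> complex) \<in> borel_measurable torus_measure"
      by (rule measurable_torus_measure[OF character_measurable])
    show "AE k in torus_measure. (\<lambda>N. character (- x) k * (P N k * (1 / fourier F k))) \<longlonglongrightarrow> character (- x) k"
      using nz
    proof eventually_elim
      case (elim k)
      have "(\<lambda>N. character (- x) k * (P N k * (1 / fourier F k))) \<longlonglongrightarrow> character (- x) k * (fourier F k * (1 / fourier F k))"
        by (intro tendsto_mult tendsto_const P)
      then show ?case using elim by simp
    qed
    show "AE k in torus_measure. norm (character (- x) k * (P N k * (1 / fourier F k))) \<le> B * cmod (1 / fourier F k)" for N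
    proof (rule AE_I2)
      fix k
      show "norm (character (- x) k * (P N k * (1 / fourier F k))) \<le> B * cmod (1 / fourier F k)"
        using mult_right_mono[OF PB[of N k], of "cmod (1 / fourier F k)"] by (simp only: norm_mult norm_character mult_1) simp
    qed
  qed
  then have lim2: "(\<lambda>N. \<Sum>y\<in>lball N. complex_of_real (F y) * ?G (x - y)) \<longlonglongrightarrow> (LINT k|torus_measure. character (- x) k) / ?c"
    unfolding eq by (intro tendsto_divide tendsto_const) auto
  have "convolution (\<lambda>x. complex_of_real (F x)) ?G x = (LINT k|torus_measure. character (- x) k) / ?c"
    by (rule LIMSEQ_unique[OF lim1 lim2])
  also have "\<dots> = lattice_delta x"
    by (simp add: torus_integral_eq[symmetric] integral_character lattice_delta_def)
  finally show "convolution (\<lambda>x. complex_of_real (F x)) ?G x = lattice_delta x" .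
qed

text \<open>With \<open>u = t / 2\<close>, of modulus at most 2 as \<open>pi < 4\<close>, the cubic
  bound gives \<open>\<bar>sin u\<bar> \<ge> \<bar>u\<bar> - \<bar>u\<bar>^3 / 6 \<ge> \<bar>u\<bar>
  / 3\<close>. Then \<open>1 - cos t = 2 * (sin u)^2\<close> is at least \<open>2 * u^2 / 9\<close>,
  whence the 18.\<close>

lemma one_minus_cos_ge:
  fixes t :: real
  assumes "\<bar>t\<bar> \<le> pi"
  shows "t\<^sup>2 / 18 \<le> 1 - cos t"
proof -
  define u where "u = t / 2"
  have u: "\<bar>u\<bar> \<le> 2" using assms pi_less_4 by (simp add: u_def)
  have "\<bar>u\<bar> ^ 3 = \<bar>u\<bar> * u\<^sup>2" by (simp add: power3_eq_cube power2_eq_square)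
  also have "\<dots> \<le> \<bar>u\<bar> * 4"
    using power_mono[OF u abs_ge_zero, of 2] by (intro mult_left_mono) auto
  finally have "\<bar>u\<bar> / 3 \<le> \<bar>sin u\<bar>"
    using abs_sin_minus_id_le[of u] by linarith
  then have "(\<bar>u\<bar> / 3)\<^sup>2 \<le> (sin u)\<^sup>2"
    using power_mono[of "\<bar>u\<bar> / 3" "\<bar>sin u\<bar>" 2] by simp
  moreover have "cos t = 1 - 2 * (sin u)\<^sup>2"
    using cos_double_sin[of u] by (simp add: u_def)
  ultimately show ?thesis by (simp add: u_def power_divide)
qed

section \<open>The kernel of the random walk\<close>

lemma step_distribution_symmetric: "lattice_symmetric (step_distribution :: int ^ 'd \<Rightarrow> real)"
  unfolding lattice_symmetric_def step_distribution_def by (simp add: norm_lvec_permute norm_lvec_reflect)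

lemma step_distribution_decays: "decays s (step_distribution :: int ^ 'd \<Rightarrow> real)"
  unfolding decays_def
proof (intro exI allI)
  fix x :: "int ^ 'd"
  show "\<bar>step_distribution x\<bar> \<le> 1 / (2 * real CARD('d)) * lnorm x powr - s"
    by (auto simp: step_distribution_def lnorm_def)
qed

text \<open>The weight \<open>(norm (lvec x))^2\<close> equals 1 on the support, so the second
  moment is the total mass, that is, the transform at 0.\<close>

lemma step_distribution_second_moment: "(\<Sum>\<^sub>\<infinity>x\<in>UNIV. (norm (lvec x))\<^sup>2 * step_distribution (x :: int ^ 'd)) = 1"
proof -
  have "(\<lambda>N. \<Sum>x\<in>lball N. complex_of_real (step_distribution (x :: int ^ 'd)) * character x 0) \<longlonglongrightarrow> fourier (step_distribution :: int ^ 'd \<Rightarrow> real) 0"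
    by (rule fourier_partial_sums[OF step_distribution_decays, of "real CARD('d) + 1"]) simp
  then have "(\<lambda>N. Re (\<Sum>x\<in>lball N. complex_of_real (step_distribution (x :: int ^ 'd)) * character x 0)) \<longlonglongrightarrow> Re (fourier (step_distribution :: int ^ 'd \<Rightarrow> real) 0)"
    by (rule tendsto_Re)
  moreover have "Re (\<Sum>x\<in>lball N. complex_of_real (step_distribution (x :: int ^ 'd)) * character x 0) = moment2 (step_distribution :: int ^ 'd \<Rightarrow> real) N" for N
    unfolding moment2_def Re_sum by (intro sum.cong) (auto simp: step_distribution_def)
  moreover have "Re (fourier (step_distribution :: int ^ 'd \<Rightarrow> real) 0) = 1"
    by (simp add: fourier_step_distribution)
  ultimately have "moment2 (step_distribution :: int ^ 'd \<Rightarrow> real) \<longlonglongrightarrow> 1" by simp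
  moreover have "moment2 (step_distribution :: int ^ 'd \<Rightarrow> real) \<longlonglongrightarrow> (\<Sum>\<^sub>\<infinity>x\<in>UNIV. (norm (lvec x))\<^sup>2 * step_distribution (x :: int ^ 'd))"
    by (rule moment2_tendsto[OF step_distribution_decays, of "real CARD('d) + 3"]) simp
  ultimately show ?thesis by (rule LIMSEQ_unique[symmetric])
qed

definition walk_kernel :: "real \<Rightarrow> int ^ 'd \<Rightarrow> real" where
  "walk_kernel \<mu> x = (if x = 0 then 1 else 0) - \<mu> * step_distribution x"

text \<open>The point mass at the origin does not enter the symbol, as \<open>cos 0 - 1 = 0\<close>;
  it reappears in the mass \<open>1 - \<mu>\<close>.\<close>

lemma symbol_walk_kernel:
  fixes k :: "real ^ 'd"
  shows "complex_of_real (1 - \<mu> + symbol (walk_kernel \<mu>) k) = 1 - complex_of_real \<mu> * fourier step_distribution k"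
proof -
  have l0: "lvec (0 :: int ^ 'd) = 0" by (simp add: lvec_def vec_eq_iff)
  have "symbol (walk_kernel \<mu>) k = (\<Sum>\<^sub>\<infinity>x\<in>UNIV. (- \<mu>) * (step_distribution x * (cos (k \<bullet> lvec x) - 1)))"
    unfolding symbol_def by (intro infsum_cong) (auto simp: walk_kernel_def l0)
  also have "\<dots> = (- \<mu>) * symbol step_distribution k"
    unfolding symbol_def by (rule infsum_cmult_right')
  also have "symbol step_distribution k = Re (fourier step_distribution k) - 1"
    using symbol_eq_fourier[OF step_distribution_decays, of "real CARD('d) + 1" k]
    by (simp add: fourier_step_distribution)
  finally have eq: "1 - \<mu> + symbol (walk_kernel \<mu>) k = 1 - \<mu> * Re (fourier step_distribution k)"
    by (simp add: algebra_simps)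
  show ?thesis
    unfolding eq by (subst (2) fourier_symmetric_real[OF step_distribution_symmetric])
      (simp only: of_real_diff of_real_mult of_real_1)
qed

text \<open>The constant is \<open>1 / 18\<close> from \<open>one_minus_cos_ge\<close> in each
  coordinate, with \<open>\<mu> / d\<close> from the average of the cosines. Bounded support gives
  decay of every order \<open>s\<close>.\<close>

lemma kernel_walk_kernel:
  assumes "0 < \<mu>"
  shows "kernel s (\<mu> / (18 * real CARD('d))) (walk_kernel \<mu> :: int ^ 'd \<Rightarrow> real)"
  unfolding kernel_def
proof (intro conjI ballI)
  have sym: "step_distribution (\<chi> i. x $ p i) = (step_distribution x :: real)" if "bij p" for p :: "'d \<Rightarrow> 'd" and x :: "int ^ 'd"
    using step_distribution_symmetric[where 'd = 'd] that unfolding lattice_symmetric_def by blast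
  have sym': "step_distribution (\<chi> i. if i = j then - (x $ i) else x $ i) = (step_distribution x :: real)" for j and x :: "int ^ 'd"
    using step_distribution_symmetric[where 'd = 'd] unfolding lattice_symmetric_def by blast
  have z: "(\<chi> i. x $ p i) = 0 \<longleftrightarrow> x = 0" if "bij p" for p :: "'d \<Rightarrow> 'd" and x :: "int ^ 'd"
    using that by (auto simp: vec_eq_iff) (metis bij_pointE)
  have z': "(\<chi> i. if i = j then - (x $ i) else x $ i) = 0 \<longleftrightarrow> x = 0" for j and x :: "int ^ 'd"
    by (auto simp: vec_eq_iff)
  show "lattice_symmetric (walk_kernel \<mu> :: int ^ 'd \<Rightarrow> real)"
    unfolding lattice_symmetric_def walk_kernel_def by (simp add: sym sym' z z')
  have "decays s (step_distribution :: int ^ 'd \<Rightarrow> real)" by (rule step_distribution_decays)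
  then obtain K where K: "\<And>x :: int ^ 'd. \<bar>step_distribution x\<bar> \<le> K * lnorm x powr - s"
    unfolding decays_def by blast
  have "\<bar>walk_kernel \<mu> x\<bar> \<le> (1 + \<mu> * K) * lnorm x powr - s" for x :: "int ^ 'd"
  proof -
    have "\<bar>(if x = 0 then 1 else 0) :: real\<bar> \<le> lnorm x powr - s"
      by (auto simp: lnorm_def lvec_def zero_vec_def[symmetric])
    moreover have "\<bar>\<mu> * step_distribution x\<bar> \<le> \<mu> * (K * lnorm x powr - s)"
      using assms mult_left_mono[OF K[of x], of \<mu>] by (simp add: abs_mult)
    ultimately have "\<bar>walk_kernel \<mu> x\<bar> \<le> lnorm x powr - s + \<mu> * (K * lnorm x powr - s)"
      unfolding walk_kernel_def by linarith
    then show ?thesis by (simp add: algebra_simps)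
  qed
  then show "decays s (walk_kernel \<mu> :: int ^ 'd \<Rightarrow> real)" unfolding decays_def by blast
  show "0 < \<mu> / (18 * real CARD('d))" using assms by simp
  fix k :: "real ^ 'd" assume k: "k \<in> torus"
  have "(norm k)\<^sup>2 = (\<Sum>j\<in>UNIV. (k $ j)\<^sup>2)"
    by (simp add: norm_vec_def L2_set_def sum_nonneg)
  also have "\<dots> \<le> (\<Sum>j\<in>UNIV. 18 * (1 - cos (k $ j)))"
  proof (rule sum_mono)
    fix j
    have "\<bar>k $ j\<bar> \<le> pi" using k by (auto simp: torus_def abs_le_iff less_imp_le) (smt (verit))
    from one_minus_cos_ge[OF this] show "(k $ j)\<^sup>2 \<le> 18 * (1 - cos (k $ j))" by simp
  qed
  also have "\<dots> = 18 * (real CARD('d) - (\<Sum>j\<in>UNIV. cos (k $ j)))"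
    by (simp add: sum_distrib_left[symmetric] sum_subtractf)
  finally have le: "(norm k)\<^sup>2 \<le> 18 * (real CARD('d) - (\<Sum>j\<in>UNIV. cos (k $ j)))" .
  have "complex_of_real (1 - \<mu> + symbol (walk_kernel \<mu>) k) = complex_of_real (1 - \<mu> * ((\<Sum>j\<in>UNIV. cos (k $ j)) / real CARD('d)))"
    unfolding symbol_walk_kernel fourier_step_distribution by simp
  then have "1 - \<mu> + symbol (walk_kernel \<mu>) k = 1 - \<mu> * ((\<Sum>j\<in>UNIV. cos (k $ j)) / real CARD('d))"
    by (simp only: of_real_eq_iff)
  then have "symbol (walk_kernel \<mu>) k = \<mu> / (18 * real CARD('d)) * (18 * (real CARD('d) - (\<Sum>j\<in>UNIV. cos (k $ j))))"
    by (simp add: field_simps)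
  then show "\<mu> / (18 * real CARD('d)) * (norm k)\<^sup>2 \<le> symbol (walk_kernel \<mu>) k"
    using assms mult_left_mono[OF le, of "\<mu> / (18 * real CARD('d))"] by simp
qed

lemma walk_kernel_second_moment:
  "(\<Sum>\<^sub>\<infinity>x\<in>UNIV. (norm (lvec x))\<^sup>2 * walk_kernel \<mu> (x :: int ^ 'd)) = - \<mu>"
proof -
  have l0: "lvec (0 :: int ^ 'd) = 0" by (simp add: lvec_def vec_eq_iff)
  have "(\<Sum>\<^sub>\<infinity>x\<in>UNIV. (norm (lvec x))\<^sup>2 * walk_kernel \<mu> (x :: int ^ 'd))
      = (\<Sum>\<^sub>\<infinity>x\<in>UNIV. (- \<mu>) * ((norm (lvec x))\<^sup>2 * step_distribution (x :: int ^ 'd)))"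
    by (intro infsum_cong) (auto simp: walk_kernel_def l0)
  also have "\<dots> = - \<mu>"
    by (simp only: infsum_cmult_right' step_distribution_second_moment mult_1_right)
  finally show ?thesis .
qed

theorem theorem2p1:
  fixes F :: "int ^ 'd \<Rightarrow> real"
    and K1 K2 \<rho> lam \<mu> :: real
    and s0 n :: nat
    and G :: "int ^ 'd \<Rightarrow> complex"
  assumes dim: "CARD('d) > 2"
    and symm: "lattice_symmetric F"
    and K1: "K1 > 0"
    and K2: "K2 > 0"
    and rho: "\<rho> > max ((real CARD('d) - 8) / 2) 0"
    and decay: "\<And>x. \<bar>F x\<bar> \<le> K1 / max (norm (lvec x)) 1 powr (real CARD('d) + 2 + \<rho>)"
    and nonneg: "Re (fourier F 0) \<ge> 0"
    and infrared: "\<And>k. k \<in> torus \<Longrightarrow>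
          Re (fourier F k) - Re (fourier F 0) \<ge> K2 * (norm k)\<^sup>2"
    and lam_eq: "lam = 1 / (Re (fourier F 0) - (\<Sum>\<^sub>\<infinity>x\<in>UNIV. (norm (lvec x))\<^sup>2 * F x))"
    and mu_eq: "\<mu> = 1 - lam * Re (fourier F 0)"
    and s0_eq: "s0 = (if \<rho> \<le> 1 + max ((real CARD('d) - 8) / 2) 0 then 0 else 1)"
    and n_eq: "n = CARD('d) - 2 + s0"
    and G_eq: "G = fourier_integral (\<lambda>k. 1 / fourier F k)"
  shows "0 < \<mu> \<and> \<mu> \<le> 1 \<and>
    convolution (\<lambda>x. complex_of_real (F x)) G = lattice_delta \<and>
    (\<lambda>x. G x - complex_of_real lam * lattice_green \<mu> x)
      \<in> o[lattice_at_infinity](\<lambda>x. complex_of_real (1 / norm (lvec x) ^ n))"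
proof -
  let ?d = "real CARD('d)"
  let ?s = "?d + 2 + \<rho>"
  let ?M = "\<Sum>\<^sub>\<infinity>x\<in>UNIV. (norm (lvec x))\<^sup>2 * F x"
  define m where "m = Re (fourier F 0)"
  have \<rho>: "0 < \<rho>" using rho by simp
  have dec: "decays ?s F"
    unfolding decays_def using decay by (intro exI[of _ K1]) (simp only: lnorm_def powr_minus divide_inverse simp_thms)
  have s: "?s > ?d" "?s > ?d + 2" using \<rho> by auto
  have sym_eq: "symbol F k = Re (fourier F k) - m" for k
    unfolding m_def by (rule symbol_eq_fourier[OF dec s(1)])
  have KF: "kernel ?s K2 F"
    unfolding kernel_def using symm dec K2 infrared by (simp add: sym_eq m_def)
  \<comment> \<open>The infrared bound is what makes the denominator in \<open>lam\<close>
    positive.\<close>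
  have M: "?M < 0" by (rule kernel_moment2_neg[OF KF s(2)])
  have m: "0 \<le> m" using nonneg by (simp add: m_def)
  have lam: "lam = 1 / (m - ?M)" using lam_eq by (simp add: m_def)
  have lam0: "0 < lam" using M m by (simp add: lam)
  \<comment> \<open>This and \<open>\<mu>M\<close> below are the two equations that
    \<open>lam\<close> and \<open>\<mu>\<close> are chosen to solve: \<open>lam * F\<close> has
    transform \<open>1 - \<mu>\<close> at 0 and second moment \<open>- \<mu>\<close>, exactly as the
    walk kernel.\<close>
  have \<mu>1: "1 - \<mu> = lam * m" using mu_eq by (simp add: m_def)
  have "lam * (m - ?M) = 1" using M m by (simp add: lam)
  then have \<mu>M: "lam * ?M = - \<mu>" using \<mu>1 by (simp add: algebra_simps)
  have \<mu>: "0 < \<mu>" "\<mu> \<le> 1"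
    using mult_pos_neg[OF lam0 M] \<mu>M \<mu>1 mult_nonneg_nonneg[OF less_imp_le[OF lam0] m] by linarith+
  have symlam: "symbol (\<lambda>x. lam * F x) k = lam * symbol F k" for k
    unfolding symbol_def mult.assoc by (rule infsum_cmult_right')
  have KlF: "kernel ?s (lam * K2) (\<lambda>x. lam * F x)"
    unfolding kernel_def
  proof (intro conjI ballI)
    show "lattice_symmetric (\<lambda>x. lam * F x)"
      using symm unfolding lattice_symmetric_def by simp
    obtain K where K: "\<And>x. \<bar>F x\<bar> \<le> K * lnorm x powr - ?s" using dec unfolding decays_def by blast
    have "\<bar>lam * F x\<bar> \<le> lam * K * lnorm x powr - ?s" for x
      using mult_left_mono[OF K[of x], of lam] lam0 by (simp add: abs_mult mult.assoc)
    then show "decays ?s (\<lambda>x. lam * F x)" unfolding decays_def by blast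
    show "0 < lam * K2" using lam0 K2 by simp
    fix k :: "real ^ 'd" assume "k \<in> torus"
    then show "lam * K2 * (norm k)\<^sup>2 \<le> symbol (\<lambda>x. lam * F x) k"
      using KF lam0 unfolding symlam mult.assoc by (intro mult_left_mono) (auto simp: kernel_def)
  qed
  have KA: "kernel ?s (\<mu> / (18 * ?d)) (walk_kernel \<mu> :: int ^ 'd \<Rightarrow> real)"
    by (rule kernel_walk_kernel[OF \<mu>(1)])
  have fourierF: "fourier F k = complex_of_real (m + symbol F k)" for k
    unfolding sym_eq by (subst fourier_symmetric_real[OF symm]) simp
  have intF: "integrable torus_measure (\<lambda>k. 1 / fourier F k)"
    using integrable_of_real[OF kernel_reciprocal_integrable[OF KF s(1) dim m], where 'a = complex]
    by (simp add: fourierF)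
  have nz: "AE k in torus_measure. fourier F k \<noteq> 0"
    using AE_torus_nonzero AE_space
  proof eventually_elim
    case (elim k)
    have "0 < K2 * (norm k)\<^sup>2" using K2 elim by simp
    also have "\<dots> \<le> m + symbol F k" using KF elim m by (auto simp: kernel_def intro: add_increasing)
    finally show ?case unfolding fourierF of_real_eq_0_iff by simp
  qed
  have conv: "convolution (\<lambda>x. complex_of_real (F x)) G = lattice_delta"
    unfolding G_eq by (rule convolution_fourier_integral[OF dec s(1) intF nz])
  let ?A = "walk_kernel \<mu> :: int ^ 'd \<Rightarrow> real"
  have intA: "integrable torus_measure (\<lambda>k. 1 / complex_of_real (1 - \<mu> + symbol ?A k))"
    using integrable_of_real[OF kernel_reciprocal_integrable[OF KA s(1) dim, of "1 - \<mu>"], where 'a = complex] \<mu>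
    by simp
  have intlF: "integrable torus_measure (\<lambda>k. 1 / complex_of_real (1 - \<mu> + symbol (\<lambda>x. lam * F x) k))"
    using integrable_of_real[OF kernel_reciprocal_integrable[OF KlF s(1) dim, of "1 - \<mu>"], where 'a = complex] \<mu>
    by simp
  define f where "f = fourier_integral (\<lambda>k. complex_of_real (1 / (1 - \<mu> + symbol (\<lambda>x. lam * F x) k) - 1 / (1 - \<mu> + symbol ?A k)))"
  have "f \<in> o[lattice_at_infinity](\<lambda>x. complex_of_real (1 / norm (lvec x) ^ n))"
    unfolding f_def n_eq
  proof (rule kernel_difference_decay[OF dim KlF KA])
    show "(\<Sum>\<^sub>\<infinity>x\<in>UNIV. (norm (lvec x))\<^sup>2 * (lam * F x)) = (\<Sum>\<^sub>\<infinity>x\<in>UNIV. (norm (lvec x))\<^sup>2 * ?A x)"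
      unfolding walk_kernel_second_moment \<mu>M[symmetric] mult.left_commute[of _ lam] by (rule infsum_cmult_right')
    \<comment> \<open>For \<open>s0 = 0\<close> this is the assumption on \<open>\<rho>\<close>, for
      \<open>s0 = 1\<close> the negated case condition: \<open>s0\<close> counts the additional
      derivative that \<open>\<rho>\<close> affords.\<close>
    show "real s0 + max ((?d - 8) / 2) 0 < \<rho>" "s0 \<le> 1"
      using rho s0_eq by auto
  qed (use \<mu> in auto)
  then have "(\<lambda>x. complex_of_real lam * f x) \<in> o[lattice_at_infinity](\<lambda>x. complex_of_real (1 / norm (lvec x) ^ n))"
    using lam0 by simp
  moreover have "complex_of_real lam * f x = G x - complex_of_real lam * lattice_green \<mu> x" for x
  proof -
    have inv: "1 / fourier F k = complex_of_real lam * (1 / complex_of_real (1 - \<mu> + symbol (\<lambda>x. lam * F x) k))" for k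
    proof -
      have "1 - \<mu> + symbol (\<lambda>x. lam * F x) k = lam * (m + symbol F k)"
        unfolding symlam \<mu>1 by (simp add: distrib_left)
      then show ?thesis using lam0 by (simp add: fourierF)
    qed
    have "f x = fourier_integral (\<lambda>k. 1 / complex_of_real (1 - \<mu> + symbol (\<lambda>x. lam * F x) k)) x
        - fourier_integral (\<lambda>k. 1 / complex_of_real (1 - \<mu> + symbol ?A k)) x"
      using fourier_integral_linear[OF intlF intA, of 1 x] by (simp add: f_def)
    \<comment> \<open>The scalar is pulled out of the integral by
      \<open>fourier_integral_linear\<close> with the zero function as second argument.\<close>
    moreover have "G x = complex_of_real lam * fourier_integral (\<lambda>k. 1 / complex_of_real (1 - \<mu> + symbol (\<lambda>x. lam * F x) k)) x"
      using fourier_integral_linear[OF intlF, of "\<lambda>_. 0" "complex_of_real lam" x]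
      unfolding G_eq inv by (simp add: fourier_integral_eq)
    moreover have "lattice_green \<mu> x = fourier_integral (\<lambda>k. 1 / complex_of_real (1 - \<mu> + symbol ?A k)) x"
      unfolding lattice_green_def symbol_walk_kernel ..
    ultimately show ?thesis by (simp add: right_diff_distrib)
  qed
  ultimately have "(\<lambda>x. G x - complex_of_real lam * lattice_green \<mu> x) \<in> o[lattice_at_infinity](\<lambda>x. complex_of_real (1 / norm (lvec x) ^ n))"
    by simp
  then show ?thesis using \<mu> conv by blast
qed

end
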